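(* Let $M$ be a compact manifold of finite dimension and let $f:M\to M$ be a homeomorphism. Let $f_{*,1}:H_1(M,\mathbb{R})\to H_1(M,\mathbb{R})$ be the induced map on the first real homology group and $sp(f_{*,1})$ its spectral radius. If $sp(f_{*,1})=1$, then there exists $k$, depending only on $f_{*,1}$, such that $[n^k]\le o(f)$. Moreover, $k$ is computed as follows. Let $J$ be the (real) Jordan normal form associated to a matrix that represents $f_{*,1}$. Let $k_{\mathbb{R}}$ be the maximum dimension among the Jordan blocks of $J$ associated to the eigenvalues $1$ or $-1$, and let $k_{\mathbb{C}}$ be the maximum dimension among the Jordan blocks of $J$ associated to complex (non-real) eigenvalues. Then $k=\max\{k_{\mathbb{R}},k_{\mathbb{C}}/2\}-1$.
   Context: Orders of growth. Let $\mathbb{N}=\{1,2,\dots\}$ and let $\mathcal{O}$ be the set of non-decreasing sequences $a:\mathbb{N}\to[0,\infty)$. For $a_1,a_2\in\mathcal{O}$ write $a_1\approx a_2$ if there are $c,C\in(0,\infty)$ with $c\,a_1(n)\le a_2(n)\le C\,a_1(n)$ for all $n$. Let $\mathbb{O}=\mathcal{O}/{\approx}$, and let $[a(n)]\in\mathbb{O}$ denote the class of $a$. Partially order $\mathbb{O}$ by: $[a_1(n)]\le[a_2(n)]$ iff there is $C>0$ with $a_1(n)\le C\,a_2(n)$ for all $n$. Let $\overline{\mathbb{O}}$ be the Dedekind–MacNeille completion of $(\mathbb{O},\le)$ (the smallest complete lattice containing $\mathbb{O}$), so $\mathbb{O}\subset\overline{\mathbb{O}}$. Generalized topological entropy. For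 a compact metric space $(M,d)$ and a continuous map $f:M\to M$, put $d_n(x,y)=\max\{d(f^i(x),f^i(y)):0\le i\le n\}$ and $B(x,n,\epsilon)=\{y\in M:d_n(x,y)\le\epsilon\}$. Let $g_{f,\epsilon}(n)$ be the minimal cardinality of a finite set $E\subset M$ with $M=\bigcup_{x\in E}B(x,n,\epsilon)$. Then $g_{f,\epsilon}\in\mathcal{O}$, and $o(f)=\sup\{[g_{f,\epsilon}(n)]:\epsilon>0\}\in\overline{\mathbb{O}}$. (A compact manifold is given any metric compatible with its topology; $o(f)$ does not depend on the choice.) In the real Jordan normal form, a block for a pair of conjugate non-real eigenvalues corresponding to complex Jordan blocks of size $m$ is a real block of dimension $2m$. The maximum of an empty set of dimensions is taken to be $0$. *)

theory Defs
  imports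
    "HOL-Analysis.Analysis"
    "HOL-Homology.Homology"
    "Jordan_Normal_Form.VS_Connect"
    "Jordan_Normal_Form.Jordan_Normal_Form"
    "Jordan_Normal_Form.Spectral_Radius"
begin

section \<open>The Dedekind--MacNeille completion\<close>

definition upper_bounds :: "'a::order set \<Rightarrow> 'a set" where
  "upper_bounds A = {u. \<forall>a\<in>A. a \<le> u}"

definition lower_bounds :: "'a::order set \<Rightarrow> 'a set" where
  "lower_bounds A = {l. \<forall>a\<in>A. l \<le> a}"

definition dm_closure :: "'a::order set \<Rightarrow> 'a set" where
  "dm_closure A = lower_bounds (upper_bounds A)"

lemma dm_closure_increasing: "A \<subseteq> dm_closure A"
  by (auto simp: dm_closure_def upper_bounds_def lower_bounds_def)

lemma dm_closure_mono: "A \<subseteq> B \<Longrightarrow> dm_closure A \<subseteq> dm_closure B"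
  by (auto simp: dm_closure_def upper_bounds_def lower_bounds_def)

lemma dm_closure_idem [simp]: "dm_closure (dm_closure A) = dm_closure A"
  by (auto simp: dm_closure_def upper_bounds_def lower_bounds_def)

typedef (overloaded) 'a dm_completion = "{A :: 'a::order set. dm_closure A = A}"
  morphisms cut_of Abs_dm_completion
  by (rule exI[of _ "dm_closure {}"]) simp

setup_lifting type_definition_dm_completion

instantiation dm_completion :: (order) complete_lattice
begin

lift_definition less_eq_dm_completion :: "'a dm_completion \<Rightarrow> 'a dm_completion \<Rightarrow> bool"
  is "(\<subseteq>)" .

lift_definition less_dm_completion :: "'a dm_completion \<Rightarrow> 'a dm_completion \<Rightarrow> bool"
  is "(\<subset>)" .

lift_definition Inf_dm_completion :: "'a dm_completion set \<Rightarrow> 'a dm_completion"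
  is "\<lambda>S. \<Inter>S"
proof -
  fix S :: "'a set set"
  assume S: "\<And>A. A \<in> S \<Longrightarrow> dm_closure A = A"
  have "dm_closure (\<Inter>S) \<subseteq> A" if "A \<in> S" for A
    using dm_closure_mono[of "\<Inter>S" A] S[OF that] that by auto
  then show "dm_closure (\<Inter>S) = \<Inter>S"
    using dm_closure_increasing[of "\<Inter>S"] by auto
qed

lift_definition Sup_dm_completion :: "'a dm_completion set \<Rightarrow> 'a dm_completion"
  is "\<lambda>S. dm_closure (\<Union>S)"
  by simp

lift_definition inf_dm_completion :: "'a dm_completion \<Rightarrow> 'a dm_completion \<Rightarrow> 'a dm_completion"
  is "(\<inter>)"
  by (metis Int_subset_iff dm_closure_increasing dm_closure_mono inf_le1 inf_le2 subset_antisym)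

lift_definition sup_dm_completion :: "'a dm_completion \<Rightarrow> 'a dm_completion \<Rightarrow> 'a dm_completion"
  is "\<lambda>A B. dm_closure (A \<union> B)"
  by simp

lift_definition top_dm_completion :: "'a dm_completion" is UNIV
  using dm_closure_increasing by blast

lift_definition bot_dm_completion :: "'a dm_completion" is "dm_closure {}"
  by simp

instance
proof
  fix x y z :: "'a dm_completion" and S :: "'a dm_completion set"
  show "(x < y) = (x \<le> y \<and> \<not> y \<le> x)" by transfer auto
  show "x \<le> x" by transfer auto
  show "x \<le> y \<Longrightarrow> y \<le> z \<Longrightarrow> x \<le> z" by transfer auto
  show "x \<le> y \<Longrightarrow> y \<le> x \<Longrightarrow> x = y" by transfer auto
  show "inf x y \<le> x" "inf x y \<le> y" by (transfer, auto)+
  show "x \<le> y \<Longrightarrow> x \<le> z \<Longrightarrow> x \<le> inf y z" by transfer auto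
  show "x \<le> sup x y" by transfer (use dm_closure_increasing in blast)
  show "y \<le> sup x y" by transfer (use dm_closure_increasing in blast)
  show "y \<le> x \<Longrightarrow> z \<le> x \<Longrightarrow> sup y z \<le> x"
    by transfer (metis Un_least dm_closure_mono)
  show "x \<in> S \<Longrightarrow> Inf S \<le> x" by transfer auto
  show "(\<And>x. x \<in> S \<Longrightarrow> z \<le> x) \<Longrightarrow> z \<le> Inf S" by transfer auto
  show "x \<in> S \<Longrightarrow> x \<le> Sup S"
    by transfer (rule order_trans[OF Union_upper dm_closure_increasing])
  show "Sup S \<le> z" if "\<And>x. x \<in> S \<Longrightarrow> x \<le> z"
  proof -
    have "\<Union>(cut_of ` S) \<subseteq> cut_of z"
      using that by (auto simp: less_eq_dm_completion.rep_eq)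
    then have "dm_closure (\<Union>(cut_of ` S)) \<subseteq> dm_closure (cut_of z)"
      by (rule dm_closure_mono)
    moreover have "dm_closure (cut_of z) = cut_of z"
      using cut_of[of z] by simp
    ultimately show ?thesis
      by (simp add: less_eq_dm_completion.rep_eq Sup_dm_completion.rep_eq)
  qed
  show "Inf {} = (Orderings.top :: 'a dm_completion)" by transfer auto
  show "Sup {} = (Orderings.bot :: 'a dm_completion)" by transfer auto
qed

end

lift_definition dm_embed :: "'a::order \<Rightarrow> 'a dm_completion" is "\<lambda>a. {..a}"
proof -
  fix a :: 'a
  show "dm_closure {..a} = {..a}"
    by (auto simp: dm_closure_def upper_bounds_def lower_bounds_def)
qed

lemma dm_embed_le_iff: "dm_embed a \<le> dm_embed b \<longleftrightarrow> a \<le> b"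
  by transfer auto


section \<open>Orders of growth\<close>

text \<open>
  Sequences are indexed by the positive integers. They are modelled by functions on
  \<^typ>\<open>nat\<close>, and the value at 0 is never looked at.
\<close>

definition growth_seq :: "(nat \<Rightarrow> real) \<Rightarrow> bool" where
  "growth_seq a \<longleftrightarrow> (\<forall>n\<ge>1. 0 \<le> a n) \<and> (\<forall>m n. 1 \<le> m \<and> m \<le> n \<longrightarrow> a m \<le> a n)"

definition growth_le :: "(nat \<Rightarrow> real) \<Rightarrow> (nat \<Rightarrow> real) \<Rightarrow> bool" where
  "growth_le a b \<longleftrightarrow> (\<exists>C>0. \<forall>n\<ge>1. a n \<le> C * b n)"

definition growth_equiv :: "(nat \<Rightarrow> real) \<Rightarrow> (nat \<Rightarrow> real) \<Rightarrow> bool" where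
  "growth_equiv a b \<longleftrightarrow> growth_seq a \<and> growth_seq b \<and>
     (\<exists>c C. 0 < c \<and> 0 < C \<and> (\<forall>n\<ge>1. c * a n \<le> b n \<and> b n \<le> C * a n))"

lemma growth_le_refl: "growth_le a a"
  unfolding growth_le_def by (rule exI[of _ 1]) auto

lemma growth_le_trans:
  assumes "growth_le a b" "growth_le b c"
  shows "growth_le a c"
proof -
  obtain C D where C: "C > 0" "\<And>n. n \<ge> 1 \<Longrightarrow> a n \<le> C * b n"
    and D: "D > 0" "\<And>n. n \<ge> 1 \<Longrightarrow> b n \<le> D * c n"
    using assms unfolding growth_le_def by blast
  have "a n \<le> (C * D) * c n" if "n \<ge> 1" for n
    using order_trans[OF C(2)[OF that] mult_left_mono[OF D(2)[OF that], of C]] C(1)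
    by (simp add: mult.assoc)
  then show ?thesis
    unfolding growth_le_def using C(1) D(1) by (intro exI[of _ "C * D"]) auto
qed

lemma growth_equiv_iff:
  "growth_equiv a b \<longleftrightarrow> growth_seq a \<and> growth_seq b \<and> growth_le a b \<and> growth_le b a"
proof -
  have "(\<exists>c>0. \<forall>n\<ge>1. c * a n \<le> b n) \<longleftrightarrow> growth_le a b"
  proof
    assume "\<exists>c>0. \<forall>n\<ge>1. c * a n \<le> b n"
    then obtain c where "c > 0" "\<forall>n\<ge>1. c * a n \<le> b n" by blast
    then show "growth_le a b"
      unfolding growth_le_def by (intro exI[of _ "inverse c"]) (auto simp: field_simps)
  next
    assume "growth_le a b"
    then obtain C where "C > 0" "\<forall>n\<ge>1. a n \<le> C * b n" unfolding growth_le_def by blast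
    then show "\<exists>c>0. \<forall>n\<ge>1. c * a n \<le> b n"
      by (intro exI[of _ "inverse C"]) (auto simp: field_simps)
  qed
  then show ?thesis
    unfolding growth_equiv_def growth_le_def by blast
qed

lemma growth_equiv_part_equivp: "part_equivp growth_equiv"
proof (rule part_equivpI)
  have "growth_equiv (\<lambda>_. 0) (\<lambda>_. 0)"
    by (simp add: growth_equiv_iff growth_le_refl growth_seq_def)
  then show "\<exists>a. growth_equiv a a" by blast
  show "symp growth_equiv"
    by (auto simp: symp_def growth_equiv_iff)
  show "transp growth_equiv"
    unfolding transp_def growth_equiv_iff using growth_le_trans by blast
qed

quotient_type growth_order = "nat \<Rightarrow> real" / partial: growth_equiv
  morphisms rep_growth_order growth_class
  by (rule growth_equiv_part_equivp)

instantiation growth_order :: order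
begin

lift_definition less_eq_growth_order :: "growth_order \<Rightarrow> growth_order \<Rightarrow> bool"
  is growth_le
  unfolding growth_equiv_iff using growth_le_trans by blast

definition less_growth_order :: "growth_order \<Rightarrow> growth_order \<Rightarrow> bool" where
  "less_growth_order a b \<longleftrightarrow> a \<le> b \<and> \<not> b \<le> a"

instance
proof
  fix x y z :: growth_order
  show "(x < y) = (x \<le> y \<and> \<not> y \<le> x)" by (rule less_growth_order_def)
  show "x \<le> x" by transfer (rule growth_le_refl)
  show "x \<le> y \<Longrightarrow> y \<le> z \<Longrightarrow> x \<le> z" by transfer (rule growth_le_trans)
  show "x \<le> y \<Longrightarrow> y \<le> x \<Longrightarrow> x = y" by transfer (auto simp: growth_equiv_iff)
qed

end

lemma growth_class_le_iff:
  assumes "growth_seq a" "growth_seq b"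
  shows "growth_class a \<le> growth_class b \<longleftrightarrow> growth_le a b"
  by (rule less_eq_growth_order.abs_eq)
    (use assms in \<open>simp_all add: eq_onp_def growth_equiv_iff growth_le_refl\<close>)


section \<open>Generalized topological entropy\<close>

definition dyn_dist :: "('a \<Rightarrow> 'a \<Rightarrow> real) \<Rightarrow> ('a \<Rightarrow> 'a) \<Rightarrow> nat \<Rightarrow> 'a \<Rightarrow> 'a \<Rightarrow> real" where
  "dyn_dist d f n x y = Max ((\<lambda>i. d ((f ^^ i) x) ((f ^^ i) y)) ` {0..n})"

definition dyn_ball ::
    "'a set \<Rightarrow> ('a \<Rightarrow> 'a \<Rightarrow> real) \<Rightarrow> ('a \<Rightarrow> 'a) \<Rightarrow> 'a \<Rightarrow> nat \<Rightarrow> real \<Rightarrow> 'a set" where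
  "dyn_ball M d f x n \<epsilon> = {y \<in> M. dyn_dist d f n x y \<le> \<epsilon>}"

definition spanning_number ::
    "'a set \<Rightarrow> ('a \<Rightarrow> 'a \<Rightarrow> real) \<Rightarrow> ('a \<Rightarrow> 'a) \<Rightarrow> real \<Rightarrow> nat \<Rightarrow> nat" where
  "spanning_number M d f \<epsilon> n =
     (LEAST k. \<exists>E. finite E \<and> E \<subseteq> M \<and> card E = k \<and> M = (\<Union>x\<in>E. dyn_ball M d f x n \<epsilon>))"

definition generalized_entropy ::
    "'a set \<Rightarrow> ('a \<Rightarrow> 'a \<Rightarrow> real) \<Rightarrow> ('a \<Rightarrow> 'a) \<Rightarrow> growth_order dm_completion" where
  "generalized_entropy M d f =
     (SUP \<epsilon>\<in>{0<..}. dm_embed (growth_class (\<lambda>n. real (spanning_number M d f \<epsilon> n))))"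


section \<open>Compact manifolds\<close>

definition compact_manifold :: "nat \<Rightarrow> 'a topology \<Rightarrow> bool" where
  "compact_manifold m X \<longleftrightarrow>
     compact_space X \<and> Hausdorff_space X \<and> second_countable X \<and>
     (\<forall>x\<in>topspace X. \<exists>U V. openin X U \<and> x \<in> U \<and> openin (Euclidean_space m) V \<and>
        subtopology X U homeomorphic_space subtopology (Euclidean_space m) V)"


section \<open>Singular homology with real coefficients\<close>

text \<open>
  The library's singular homology has integer coefficients; its singular simplices, faces and
  induced maps on simplices are reused here, with real instead of integer coefficients.
\<close>

type_synonym 'a real_chain = "((nat \<Rightarrow> real) \<Rightarrow> 'a) \<Rightarrow>\<^sub>0 real"

definition rc_scale :: "real \<Rightarrow> ('b \<Rightarrow>\<^sub>0 real) \<Rightarrow> ('b \<Rightarrow>\<^sub>0 real)" where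
  "rc_scale r c = Poly_Mapping.map ((*) r) c"

definition rc_extend :: "('b \<Rightarrow> ('c \<Rightarrow>\<^sub>0 real)) \<Rightarrow> ('b \<Rightarrow>\<^sub>0 real) \<Rightarrow> ('c \<Rightarrow>\<^sub>0 real)" where
  "rc_extend h c = (\<Sum>\<sigma>\<in>Poly_Mapping.keys c. rc_scale (Poly_Mapping.lookup c \<sigma>) (h \<sigma>))"

definition real_chains :: "nat \<Rightarrow> 'a topology \<Rightarrow> 'a real_chain set" where
  "real_chains p X = {c. Poly_Mapping.keys c \<subseteq> singular_simplex_set p X}"

definition real_boundary :: "nat \<Rightarrow> 'a real_chain \<Rightarrow> 'a real_chain" where
  "real_boundary p c =
     (if p = 0 then 0
      else rc_extend (\<lambda>\<sigma>. \<Sum>k\<le>p. Poly_Mapping.single (singular_face p k \<sigma>) ((-1) ^ k)) c)"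

definition real_cycles :: "nat \<Rightarrow> 'a topology \<Rightarrow> 'a real_chain set" where
  "real_cycles p X = {c \<in> real_chains p X. real_boundary p c = 0}"

definition real_boundaries :: "nat \<Rightarrow> 'a topology \<Rightarrow> 'a real_chain set" where
  "real_boundaries p X = real_boundary (Suc p) ` real_chains (Suc p) X"

definition real_homology_class :: "nat \<Rightarrow> 'a topology \<Rightarrow> 'a real_chain \<Rightarrow> 'a real_chain set" where
  "real_homology_class p X c = (\<lambda>b. c + b) ` real_boundaries p X"

text \<open>
  The quotient of cycles by boundaries, as a module over \<^term>\<open>class_ring :: real ring\<close>.
  The record type inherits ring multiplication fields, which modules do not use.
\<close>

definition real_homology :: "nat \<Rightarrow> 'a topology \<Rightarrow> (real, 'a real_chain set) module" where
  "real_homology p X =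
     \<lparr>carrier = real_homology_class p X ` real_cycles p X,
      mult = undefined,
      one = undefined,
      zero = real_homology_class p X 0,
      add = (\<lambda>A B. \<Union>a\<in>A. \<Union>b\<in>B. real_homology_class p X (a + b)),
      smult = (\<lambda>r A. \<Union>a\<in>A. real_homology_class p X (rc_scale r a))\<rparr>"

definition real_chain_map :: "nat \<Rightarrow> ('a \<Rightarrow> 'b) \<Rightarrow> 'a real_chain \<Rightarrow> 'b real_chain" where
  "real_chain_map p f = rc_extend (\<lambda>\<sigma>. Poly_Mapping.single (simplex_map p f \<sigma>) 1)"

definition real_hom_induced ::
    "nat \<Rightarrow> 'b topology \<Rightarrow> ('a \<Rightarrow> 'b) \<Rightarrow> 'a real_chain set \<Rightarrow> 'b real_chain set" where
  "real_hom_induced p Y f A = (\<Union>a\<in>A. real_homology_class p Y (real_chain_map p f a))"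


section \<open>Matrices of endomorphisms, spectral radius, real Jordan normal form\<close>

definition represents_endo :: "real mat \<Rightarrow> (real, 'v) module \<Rightarrow> ('v \<Rightarrow> 'v) \<Rightarrow> bool" where
  "represents_endo A V T \<longleftrightarrow>
     (\<exists>bs. distinct bs \<and> vectorspace.basis class_ring V (set bs) \<and>
       A \<in> carrier_mat (length bs) (length bs) \<and>
       (\<forall>j<length bs. T (bs ! j) = (\<Oplus>\<^bsub>V\<^esub>i\<in>{..<length bs}. (A $$ (i, j)) \<odot>\<^bsub>V\<^esub> (bs ! i))))"

text \<open>
  The library's \<^const>\<open>spectral_radius\<close> is a maximum over the set of eigenvalues, hence
  unspecified for the matrix of dimension 0; the usual value there is 0. The spectral radius of
  an endomorphism of a finite-dimensional space is that of any matrix representing it.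
\<close>

definition real_spectral_radius :: "real mat \<Rightarrow> real" where
  "real_spectral_radius A =
     (if dim_row A = 0 then 0 else spectral_radius (map_mat complex_of_real A))"

definition endo_spectral_radius :: "(real, 'v) module \<Rightarrow> ('v \<Rightarrow> 'v) \<Rightarrow> real" where
  "endo_spectral_radius V T = (THE r. \<exists>A. represents_endo A V T \<and> r = real_spectral_radius A)"

text \<open>
  \<open>Real_Block m c\<close> is the ordinary Jordan block of size \<open>m\<close>; \<open>Complex_Block m a b\<close> is the real
  block of size \<open>2 * m\<close> for the conjugate pair of eigenvalues \<open>a + b * \<i>\<close>, \<open>a - b * \<i>\<close>: its
  diagonal consists of \<open>m\<close> copies of the matrix with rows \<open>(a, b)\<close> and \<open>(-b, a)\<close>, and its
  superdiagonal of \<open>2\<times>2\<close> identity matrices.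
\<close>

datatype real_jblock = Real_Block nat real | Complex_Block nat real real

fun jblock_dim :: "real_jblock \<Rightarrow> nat" where
  "jblock_dim (Real_Block m c) = m"
| "jblock_dim (Complex_Block m a b) = 2 * m"

fun jblock_mat :: "real_jblock \<Rightarrow> real mat" where
  "jblock_mat (Real_Block m c) = jordan_block m c"
| "jblock_mat (Complex_Block m a b) = mat (2 * m) (2 * m) (\<lambda>(i, j).
     if i div 2 = j div 2 then (if i = j then a else if i < j then b else - b)
     else if j = i + 2 then 1
     else 0)"

fun jblock_eigenvalues :: "real_jblock \<Rightarrow> complex set" where
  "jblock_eigenvalues (Real_Block m c) = {complex_of_real c}"
| "jblock_eigenvalues (Complex_Block m a b) = {Complex a b, Complex a (- b)}"

fun valid_jblock :: "real_jblock \<Rightarrow> bool" where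
  "valid_jblock (Real_Block m c) \<longleftrightarrow> m > 0"
| "valid_jblock (Complex_Block m a b) \<longleftrightarrow> m > 0 \<and> b \<noteq> 0"

definition real_jordan_nf :: "real mat \<Rightarrow> real_jblock list \<Rightarrow> bool" where
  "real_jordan_nf A J \<longleftrightarrow>
     (\<forall>B\<in>set J. valid_jblock B) \<and> similar_mat A (diag_block_mat (map jblock_mat J))"

definition max_block_dim :: "real_jblock list \<Rightarrow> complex set \<Rightarrow> nat" where
  "max_block_dim J \<Lambda> =
     Max (insert 0 {jblock_dim B | B. B \<in> set J \<and> jblock_eigenvalues B \<subseteq> \<Lambda>})"

definition k_real :: "real_jblock list \<Rightarrow> nat" where
  "k_real J = max_block_dim J {1, -1}"

definition k_complex :: "real_jblock list \<Rightarrow> nat" where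
  "k_complex J = max_block_dim J (- \<real>)"

end

theory Submission
  imports Defs
    "Jordan_Normal_Form.Jordan_Normal_Form_Uniqueness"
    "Jordan_Normal_Form.Jordan_Normal_Form_Existence"
    "HOL-Library.Transitive_Closure_Table"
begin

text \<open>Let \<open>S\<close> be a set of \<open>N\<close> points that spans \<open>M\<close> for the metric \<open>d\<^sub>n\<close> at a small scale. Since
  \<open>M\<close> is locally contractible, every cycle is homologous to a combination of loops with vertices in
  \<open>S\<close> whose edges are short for \<open>d\<^sub>n\<close>, and a spanning tree makes these loops of length at most about
  \<open>2 N\<close>. For \<open>i \<le> n\<close> the image of such a loop under \<open>f\<^sup>i\<close> is a loop of short edges of the same length, so
  its homology class has norm \<open>O(N)\<close>. The classes of these loops are integral and some
  of them form a basis.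

  On the algebraic side, by Kronecker's theorem the eigenvalues of \<open>f\<^sub>*\<close> are roots of unity, so some
  power \<open>f\<^sub>*\<^sup>q\<close> is unipotent, of index \<open>k + 1\<close>. An integral class \<open>z\<close> with \<open>(f\<^sub>*\<^sup>q - 1)\<^sup>k z \<noteq> 0\<close> has a
  \<open>k\<close>-th difference bounded away from \<open>0\<close> along its orbit, by the bounded denominators,
  whence \<open>n\<^sup>k = O(N)\<close>.\<close>

subsection \<open>Jordan forms\<close>

text \<open>The loops, and with them the class \<open>z\<close>, change with \<open>n\<close>, so
  every constant has to be fixed before \<open>z\<close> is known. Hence there are two nets: a fixed
  one, whose loops bound coordinates and denominators once and for all, and one for each
  \<open>n\<close>, which only supplies \<open>z\<close>. Integrality makes the lower bound uniform:
  one \<open>D\<close> clears the denominators of all integral cycles, so a nonzero difference is at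
  least \<open>1 / D\<close> whatever \<open>z\<close> is. The orbit is controlled only up to time
  \<open>n\<close>; this is enough because a sequence whose difference of order \<open>k + 1\<close>
  vanishes has a constant \<open>k\<close>-th difference, and a bound \<open>W\<close> for the
  sequence up to \<open>n\<close> forces this constant to be at most of order
  \<open>W / n^k\<close>. The finite dimension of the homology is a by-product: the loops of the
  fixed net span it, and a basis is chosen among them. Spectral radius 1 puts the eigenvalues into
  the closed unit disc and invertibility of \<open>f\<close> excludes 0, as Kronecker's argument
  requires. The formula for \<open>k\<close> refers to a real Jordan form, whose existence is part
  of the conclusion; it is derived from the complex one.\<close>

lemma similar_mat_four_block_swap:
  fixes A B :: "'a::comm_ring_1 mat"
  assumes A: "A \<in> carrier_mat n n" and B: "B \<in> carrier_mat m m"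
  shows "similar_mat (four_block_mat A (0\<^sub>m n m) (0\<^sub>m m n) B)
    (four_block_mat B (0\<^sub>m m n) (0\<^sub>m n m) A)"
proof -
  let ?P = "four_block_mat (0\<^sub>m n m) (1\<^sub>m n) (1\<^sub>m m) (0\<^sub>m m n) :: 'a mat"
  let ?Q = "four_block_mat (0\<^sub>m m n) (1\<^sub>m m) (1\<^sub>m n) (0\<^sub>m n m) :: 'a mat"
  let ?S = "four_block_mat B (0\<^sub>m m n) (0\<^sub>m n m) A"
  have PQ: "?P * ?Q = 1\<^sub>m (n + m)"
    by (subst mult_four_block_mat[of _ n m _ n _ m _ _ n _ m]) (auto simp: four_block_one_mat)
  have QP: "?Q * ?P = 1\<^sub>m (n + m)"
    by (subst mult_four_block_mat[of _ m n _ m _ n _ _ m _ n])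
      (auto simp: four_block_one_mat add.commute)
  have "?P * ?S = four_block_mat (0\<^sub>m n m) A B (0\<^sub>m m n)"
    using A B by (subst mult_four_block_mat[of _ n m _ n _ m _ _ m _ n]) auto
  moreover have "four_block_mat (0\<^sub>m n m) A B (0\<^sub>m m n) * ?Q
      = four_block_mat A (0\<^sub>m n m) (0\<^sub>m m n) B"
    using A B by (subst mult_four_block_mat[of _ n m _ n _ m _ _ n _ m]) auto
  ultimately show ?thesis
    using A B PQ QP by (intro similar_matI[of _ _ ?P ?Q "n + m"]) (auto simp: add.commute)
qed

lemma diag_block_mat_square_carrier:
  assumes "Ball (set As) square_mat"
  obtains m where "diag_block_mat As \<in> carrier_mat m m"
  using diag_block_mat_square[OF assms] that by (metis carrier_matI square_mat.simps)

lemma similar_diag_block_mat_append: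
  fixes As :: "'a::comm_ring_1 mat list"
  assumes "similar_mat (diag_block_mat As) (diag_block_mat As')" "Ball (set Bs) square_mat"
  shows "similar_mat (diag_block_mat (As @ Bs)) (diag_block_mat (As' @ Bs))"
proof -
  obtain n where n: "diag_block_mat As \<in> carrier_mat n n" "diag_block_mat As' \<in> carrier_mat n n"
    using similar_matD[OF assms(1)] by auto
  obtain m where B: "diag_block_mat Bs \<in> carrier_mat m m"
    by (rule diag_block_mat_square_carrier[OF assms(2)])
  from similar_mat_four_block_0_0[OF assms(1) similar_mat_refl[OF B] n(1) B] show ?thesis
    using n B by (auto simp: diag_block_mat_append Let_def)
qed

text \<open>Uniqueness of Jordan forms only controls the multiset of blocks; the order is absorbed
  here. By induction the tail of \<open>As\<close> becomes \<open>us @ vs\<close>, and a block swap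
  moves the head \<open>A\<close> past \<open>us\<close> to its place in \<open>Bs\<close>.\<close>

lemma similar_diag_block_mat_mset:
  fixes As :: "'a::comm_ring_1 mat list"
  assumes "mset As = mset Bs" "Ball (set As) square_mat"
  shows "similar_mat (diag_block_mat As) (diag_block_mat Bs)"
  using assms
proof (induction As arbitrary: Bs)
  case Nil
  then show ?case by (simp add: similar_mat_refl[of _ 0])
next
  case (Cons A As)
  have "A \<in> set Bs"
    using Cons.prems(1) by (metis list.set_intros(1) set_mset_mset)
  then obtain us vs where Bs: "Bs = us @ A # vs"
    by (meson split_list)
  have sq: "Ball (set Bs) square_mat"
    using Cons.prems by (metis set_mset_mset)
  have sim: "similar_mat (diag_block_mat As) (diag_block_mat (us @ vs))"
    using Cons.prems by (intro Cons.IH) (auto simp: Bs)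
  obtain a where A: "A \<in> carrier_mat a a"
    using Cons.prems(2) by (metis carrier_matI list.set_intros(1) square_mat.simps)
  obtain k where k: "diag_block_mat As \<in> carrier_mat k k" "diag_block_mat (us @ vs) \<in> carrier_mat k k"
    using similar_matD[OF sim] by auto
  have 1: "similar_mat (diag_block_mat (A # As)) (diag_block_mat (A # us @ vs))"
    using similar_mat_four_block_0_0[OF similar_mat_refl[OF A] sim A k(1)] k A
    by (auto simp: Let_def)
  have "Ball (set us) square_mat"
    using sq Bs by auto
  then obtain u where u: "diag_block_mat us \<in> carrier_mat u u"
    by (rule diag_block_mat_square_carrier)
  have "similar_mat (diag_block_mat (A # us)) (diag_block_mat (us @ [A]))"
    using similar_mat_four_block_swap[OF A u] u A
    by (auto simp: diag_block_mat_last Let_def)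
  then have "similar_mat (diag_block_mat ((A # us) @ vs)) (diag_block_mat ((us @ [A]) @ vs))"
    by (rule similar_diag_block_mat_append) (use sq Bs in auto)
  then have "similar_mat (diag_block_mat (A # us @ vs)) (diag_block_mat Bs)"
    by (simp add: Bs)
  with 1 show ?case by (rule similar_mat_trans)
qed

text \<open>As a function of \<open>x\<close>, the determinant of Re P + x Im P is a polynomial. It
  is not the zero polynomial, since at \<open>x = \<i>\<close> it takes the value
  \<open>det P\<close>; so only finitely many real \<open>x\<close> are roots.\<close>

lemma invertible_real_combination:
  fixes P :: "complex mat"
  assumes P: "P \<in> carrier_mat n n" and det: "det P \<noteq> 0"
  shows "\<exists>t. det (map_mat Re P + t \<cdot>\<^sub>m map_mat Im P) \<noteq> 0"
proof -
  define Pt where "Pt = mat n n (\<lambda>ij. [: complex_of_real (Re (P $$ ij)), complex_of_real (Im (P $$ ij)) :])"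
  have eval: "poly (det Pt) x = det (map_mat (\<lambda>p. poly p x) Pt)" for x
    by (rule comm_ring_hom.hom_det[OF poly_hom.comm_ring_hom_axioms, symmetric])
  have "map_mat (\<lambda>p. poly p \<i>) Pt = P"
    using P by (intro eq_matI) (auto simp: Pt_def complex_eq_iff)
  then have "det Pt \<noteq> 0"
    using eval[of \<i>] det by auto
  then have "finite {x. poly (det Pt) x = 0}"
    by (rule poly_roots_finite)
  moreover have "infinite (range complex_of_real)"
    using infinite_UNIV_char_0 by (auto dest!: finite_imageD simp: inj_def)
  ultimately obtain t where t: "poly (det Pt) (complex_of_real t) \<noteq> 0"
    by (metis (mono_tags, lifting) finite_subset image_subset_iff mem_Collect_eq)
  have "map_mat (\<lambda>p. poly p (complex_of_real t)) Pt
      = map_mat complex_of_real (map_mat Re P + t \<cdot>\<^sub>m map_mat Im P)"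
    using P by (intro eq_matI) (auto simp: Pt_def)
  with t eval show ?thesis
    by (metis of_real_eq_0_iff of_real_hom.hom_det)
qed

text \<open>For real \<open>A\<close> and \<open>B\<close> the equation \<open>A * P = P * B\<close>
  holds separately for the real and the imaginary part of \<open>P\<close>, hence for every real
  combination of the two, and one of these combinations is invertible.\<close>

lemma similar_mat_complex_imp_real:
  fixes A B :: "real mat"
  assumes A: "A \<in> carrier_mat n n" and B: "B \<in> carrier_mat n n"
    and sim: "similar_mat (map_mat complex_of_real A) (map_mat complex_of_real B)"
  shows "similar_mat A B"
proof -
  let ?A = "map_mat complex_of_real A" and ?B = "map_mat complex_of_real B"
  obtain P Q where "similar_mat_wit ?A ?B P Q"
    using sim by (auto simp: similar_mat_def)
  note wit = similar_mat_witD2[OF map_carrier_mat[THEN iffD2, OF A] this]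
  note PQ = wit(1-3) and P = wit(6) and Q = wit(7)
  have "?A * P = P * ?B"
  proof -
    have "?A * P = P * ?B * (Q * P)"
      unfolding PQ(3) using P Q B by (intro assoc_mult_mat[of _ n n _ n _ n]) auto
    then show ?thesis using PQ P B by (simp add: right_mult_one_mat[of _ n n])
  qed
  then have AP: "(\<Sum>k\<in>{0..<n}. complex_of_real (A $$ (i,k)) * P $$ (k,j))
      = (\<Sum>k\<in>{0..<n}. P $$ (i,k) * complex_of_real (B $$ (k,j)))" if "i < n" "j < n" for i j
    using that A B P by (auto simp: mat_eq_iff scalar_prod_def)
  have re: "(\<Sum>k\<in>{0..<n}. A $$ (i,k) * Re (P $$ (k,j))) = (\<Sum>k\<in>{0..<n}. Re (P $$ (i,k)) * B $$ (k,j))"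
    if "i < n" "j < n" for i j
    using arg_cong[OF AP[OF that], of Re] by (simp add: Re_sum)
  have im: "(\<Sum>k\<in>{0..<n}. A $$ (i,k) * Im (P $$ (k,j))) = (\<Sum>k\<in>{0..<n}. Im (P $$ (i,k)) * B $$ (k,j))"
    if "i < n" "j < n" for i j
    using arg_cong[OF AP[OF that], of Im] by (simp add: Im_sum)
  have "det P * det Q = 1"
    using arg_cong[OF PQ(1), of det] P Q by (simp add: det_mult[of _ n])
  then have "det P \<noteq> 0" by auto
  then obtain t where t: "det (map_mat Re P + t \<cdot>\<^sub>m map_mat Im P) \<noteq> 0"
    using invertible_real_combination[OF P] by blast
  define R where "R = map_mat Re P + t \<cdot>\<^sub>m map_mat Im P"
  have R: "R \<in> carrier_mat n n" using P by (auto simp: R_def)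
  have AR: "A * R = R * B"
  proof (rule eq_matI)
    fix i j assume "i < dim_row (R * B)" "j < dim_col (R * B)"
    then have ij: "i < n" "j < n" using R B by auto
    have "(A * R) $$ (i,j) = (\<Sum>k\<in>{0..<n}. A $$ (i,k) * Re (P $$ (k,j)))
        + t * (\<Sum>k\<in>{0..<n}. A $$ (i,k) * Im (P $$ (k,j)))"
      using ij A P by (simp add: R_def scalar_prod_def algebra_simps sum.distrib sum_distrib_left)
    also have "\<dots> = (R * B) $$ (i,j)"
      using ij B P by (simp add: re im R_def scalar_prod_def algebra_simps sum.distrib sum_distrib_left)
    finally show "(A * R) $$ (i,j) = (R * B) $$ (i,j)" .
  qed (use A B R in auto)
  obtain R' where R': "R * R' = 1\<^sub>m n" "R' * R = 1\<^sub>m n" "R' \<in> carrier_mat n n"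
    using R det_non_zero_imp_unit[OF R] t unfolding R_def[symmetric] Units_def ring_mat_def
    by auto
  have "A = A * (R * R')" using R' A by simp
  also have "\<dots> = R * B * R'"
    using assoc_mult_mat[OF A R R'(3)] by (simp add: AR)
  finally show ?thesis
    using A B R R' by (intro similar_matI[of _ _ R R' n]) auto
qed

section \<open>Complexification of the real Jordan form\<close>

lemma sum_even_odd: "(\<Sum>k\<in>{0..<2*m}. f k) = (\<Sum>t\<in>{0..<m}. f (2*t) + f (Suc (2*t)))"
  for f :: "nat \<Rightarrow> 'a::comm_monoid_add"
  by (induction m) (auto simp: algebra_simps)

text \<open>The real block orders its coordinates in adjacent pairs, the two conjugate complex
  blocks in two halves; sums over an inner index are split in one way or the other.\<close>

lemma sum_two_halves: "(\<Sum>k\<in>{0..<2*m}. f k) = (\<Sum>t\<in>{0..<m}. f t + f (m + t))"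
  for f :: "nat \<Rightarrow> 'a::comm_monoid_add"
proof -
  have "(\<Sum>k\<in>{0..<2*m}. f k) = sum f {0..<m} + sum f {m..<m+m}"
    by (simp add: sum.atLeastLessThan_concat mult_2)
  also have "sum f {m..<m+m} = (\<Sum>t\<in>{0..<m}. f (m + t))"
    using sum.shift_bounds_nat_ivl[of f 0 m m] by (simp add: add.commute)
  finally show ?thesis by (simp add: sum.distrib)
qed

text \<open>The matrix with rows \<open>(a, b)\<close> and \<open>(-b, a)\<close> has the
  eigenvectors \<open>(1, \<i>)\<close> and \<open>(1, - \<i>)\<close> for
  \<open>a + b * \<i>\<close> and \<open>a - b * \<i>\<close>. The columns of \<open>P\<close> place
  these vectors at the coordinates \<open>2 * t\<close> and \<open>2 * t + 1\<close>: the first half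
  of the columns for one eigenvalue, the second half for its conjugate.\<close>

lemma complex_jblock_similar:
  "similar_mat (map_mat complex_of_real (jblock_mat (Complex_Block m a b)))
     (jordan_matrix [(m, Complex a b), (m, Complex a (- b))])"
proof -
  define C where "C = map_mat complex_of_real (jblock_mat (Complex_Block m a b))"
  define J where "J = jordan_matrix [(m, Complex a b), (m, Complex a (- b))]"
  define P where "P = mat (2*m) (2*m) (\<lambda>(i,j). if j < m
     then (if i div 2 = j then (if even i then 1 else \<i>) else 0)
     else (if i div 2 = j - m then (if even i then 1 else - \<i>) else 0))"
  define Q where "Q = mat (2*m) (2*m) (\<lambda>(i,j). if i < m
     then (if j div 2 = i then (if even j then 1/2 else - \<i>/2) else 0)
     else (if j div 2 = i - m then (if even j then 1/2 else \<i>/2) else 0))"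
  have carr: "C \<in> carrier_mat (2*m) (2*m)" "J \<in> carrier_mat (2*m) (2*m)"
    "P \<in> carrier_mat (2*m) (2*m)" "Q \<in> carrier_mat (2*m) (2*m)"
    by (auto simp: C_def P_def Q_def) (simp add: J_def carrier_matI)
  have J: "J $$ (i,j) = (if i < m \<and> j < m then jordan_block m (Complex a b) $$ (i,j)
      else if i \<ge> m \<and> j \<ge> m then jordan_block m (Complex a (- b)) $$ (i - m, j - m) else 0)"
    if "i < 2*m" "j < 2*m" for i j
    using that by (auto simp: J_def jordan_matrix_def Let_def)
  have PQ: "P * Q = 1\<^sub>m (2*m)"
  proof (rule eq_matI)
    fix i j assume "i < dim_row (1\<^sub>m (2*m) :: complex mat)" "j < dim_col (1\<^sub>m (2*m) :: complex mat)"
    then have ij: "i < 2*m" "j < 2*m" by auto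
    have "(P * Q) $$ (i,j) = (\<Sum>k\<in>{0..<2*m}. P $$ (i,k) * Q $$ (k,j))"
      using ij carr by (simp add: scalar_prod_def)
    also have "\<dots> = (\<Sum>t\<in>{0..<m}. if t = i div 2 then (if j div 2 = i div 2
        then (if i = j then 1 else 0) else 0) else 0)"
      unfolding sum_two_halves
    proof (rule sum.cong[OF refl])
      fix t assume "t \<in> {0..<m}"
      then show "P $$ (i,t) * Q $$ (t,j) + P $$ (i,m+t) * Q $$ (m+t,j) = (if t = i div 2 then (if j div 2 = i div 2
        then (if i = j then 1 else 0) else 0) else 0)"
        using ij by (cases "even i"; cases "even j") (auto simp: P_def Q_def elim!: evenE oddE, presburger+)
    qed
    also have "\<dots> = (1\<^sub>m (2*m) :: complex mat) $$ (i,j)"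
      using ij by auto
    finally show "(P * Q) $$ (i,j) = (1\<^sub>m (2*m) :: complex mat) $$ (i,j)" .
  qed (use carr in auto)
  have QP: "Q * P = 1\<^sub>m (2*m)"
    by (rule mat_mult_left_right_inverse[OF carr(3,4) PQ])
  have CP: "C * P = P * J"
  proof (rule eq_matI)
    fix i j assume "i < dim_row (P * J)" "j < dim_col (P * J)"
    then have ij: "i < 2*m" "j < 2*m" using carr by auto
    \<comment> \<open>Column \<open>j\<close> belongs to the eigenvalue \<open>a + s * b\<close>,
      and \<open>j'\<close> is its position within that half; so both halves are treated at
      once.\<close>
    define j' where "j' = (if j < m then j else j - m)"
    define s where "s = (if j < m then \<i> else - \<i>)"
    have j': "j' < m" using ij by (auto simp: j'_def)
    have "(C * P) $$ (i,j) = (\<Sum>k\<in>{0..<2*m}. C $$ (i,k) * P $$ (k,j))"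
      using ij carr by (simp add: scalar_prod_def)
    also have "\<dots> = (\<Sum>t\<in>{0..<m}. if t = j' then C $$ (i,2*j') + s * C $$ (i, Suc (2*j')) else 0)"
      unfolding sum_even_odd
      by (rule sum.cong[OF refl]) (use ij in \<open>auto simp: P_def j'_def s_def\<close>)
    also have "\<dots> = C $$ (i,2*j') + s * C $$ (i, Suc (2*j'))"
      using j' by simp
    also have "\<dots> = (if i div 2 = j' then (if even i then 1 else s) * (a + s * b) else
        if Suc (i div 2) = j' then (if even i then 1 else s) else 0)"
    proof -
      define u where "u = i div 2"
      have ss: "s * s = -1" by (simp add: s_def)
      show ?thesis
      proof (cases "even i")
        case True
        then have i: "i = 2 * u" by (simp add: u_def)
        have "C $$ (i,2*j') = (if u = j' then a else if Suc u = j' then 1 else 0)"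
          "C $$ (i,Suc (2*j')) = (if u = j' then b else 0)"
          using ij j' unfolding i by (simp_all add: C_def)
        then show ?thesis using True by (simp add: i)
      next
        case False
        then have i: "i = Suc (2 * u)" by (simp add: u_def)
        have "C $$ (i,2*j') = (if u = j' then - b else 0)"
          "C $$ (i,Suc (2*j')) = (if u = j' then a else if Suc u = j' then 1 else 0)"
          using ij j' unfolding i by (simp_all add: C_def) presburger
        then show ?thesis using False ss by (simp add: i algebra_simps flip: mult.assoc)
      qed
    qed
    also have "\<dots> = (\<Sum>t\<in>{0..<m}. if t = i div 2 then (if t = j' then (if even i then 1 else s) * (a + s * b) else
        if Suc t = j' then (if even i then 1 else s) else 0) else 0)"
      using ij by simp
    also have "\<dots> = (\<Sum>k\<in>{0..<2*m}. P $$ (i,k) * J $$ (k,j))"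
      unfolding sum_two_halves
    proof (rule sum.cong[OF refl])
      fix t assume "t \<in> {0..<m}"
      then have t: "t < m" "t < 2*m" "m + t < 2*m" by auto
      have lam: "Complex a b = a + \<i> * b" "Complex a (- b) = a - \<i> * b"
        by (simp_all add: complex_eq_iff)
      have J1: "J $$ (t,j) = (if j < m then if t = j' then a + s * b else if Suc t = j' then 1 else 0 else 0)"
        "J $$ (m+t,j) = (if j < m then 0 else if t = j' then a + s * b else if Suc t = j' then 1 else 0)"
        using t ij by (simp_all add: J j'_def s_def lam jordan_block_def)
      have P1: "P $$ (i,t) = (if t = i div 2 then if even i then 1 else \<i> else 0)"
        "P $$ (i,m+t) = (if t = i div 2 then if even i then 1 else - \<i> else 0)"
        using t ij by (auto simp: P_def)
      show "(if t = i div 2 then (if t = j' then (if even i then 1 else s) * (a + s * b) else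
        if Suc t = j' then (if even i then 1 else s) else 0) else 0)
        = P $$ (i,t) * J $$ (t,j) + P $$ (i,m+t) * J $$ (m+t,j)"
        unfolding J1 P1 by (simp add: s_def)
    qed
    also have "\<dots> = (P * J) $$ (i,j)"
      using ij carr by (simp add: scalar_prod_def)
    finally show "(C * P) $$ (i,j) = (P * J) $$ (i,j)" .
  qed (use carr in auto)
  have "C = C * (P * Q)" using PQ carr by simp
  also have "\<dots> = P * J * Q"
    using assoc_mult_mat[OF carr(1,3,4)] CP by simp
  finally show ?thesis
    using carr PQ QP unfolding C_def[symmetric] J_def[symmetric]
    by (intro similar_matI[of _ _ P Q "2*m"]) auto
qed

fun complex_blocks :: "real_jblock \<Rightarrow> (nat \<times> complex) list" where
  "complex_blocks (Real_Block m c) = [(m, complex_of_real c)]"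
| "complex_blocks (Complex_Block m a b) = [(m, Complex a b), (m, Complex a (- b))]"

lemma jblock_mat_similar: "similar_mat (map_mat complex_of_real (jblock_mat B)) (jordan_matrix (complex_blocks B))"
proof (cases B)
  case (Real_Block m c)
  have "map_mat complex_of_real (jordan_block m c) = jordan_block m (complex_of_real c)"
    by (rule eq_matI) (auto simp: jordan_block_def)
  then show ?thesis
    by (auto simp: Real_Block jordan_matrix_def simp del: diag_block_mat.simps intro!: similar_mat_refl[of _ m])
qed (use complex_jblock_similar in simp)

lemma map_mat_diag_block_mat:
  assumes "f 0 = 0"
  shows "map_mat f (diag_block_mat As) = diag_block_mat (map (map_mat f) As)"
proof (induction As)
  case (Cons A As)
  have "map_mat f (0\<^sub>m k l) = 0\<^sub>m k l" for k l
    by (rule eq_matI) (auto simp: assms)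
  moreover have "dim_row (diag_block_mat (map (map_mat f) As)) = dim_row (diag_block_mat As)"
    "dim_col (diag_block_mat (map (map_mat f) As)) = dim_col (diag_block_mat As)"
    by (simp_all flip: Cons)
  ultimately show ?case
    by (simp add: Let_def map_four_block_mat[OF carrier_matI carrier_matI carrier_matI carrier_matI] Cons)
qed (auto intro!: eq_matI)

lemma jordan_nf_complex_blocks:
  assumes "\<forall>B\<in>set J. valid_jblock B"
  shows "jordan_nf (map_mat complex_of_real (diag_block_mat (map jblock_mat J)))
    (concat (map complex_blocks J))"
proof -
  let ?Ms = "map (\<lambda>B. (map_mat complex_of_real (jblock_mat B), complex_blocks B)) J"
  have "jordan_nf M bs" if "(M, bs) \<in> set ?Ms" for M bs
  proof -
    obtain B where "B \<in> set J" and "M = map_mat complex_of_real (jblock_mat B)" "bs = complex_blocks B"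
      using \<open>(M, bs) \<in> set ?Ms\<close> by auto
    moreover have "0 \<notin> fst ` set (complex_blocks B)"
      using bspec[OF assms \<open>B \<in> set J\<close>] by (cases B) auto
    ultimately show ?thesis
      using jblock_mat_similar[of B] by (auto simp: jordan_nf_def)
  qed
  from jordan_nf_diag_block_mat[of ?Ms, OF this] show ?thesis
    by (simp add: map_mat_diag_block_mat comp_def)
qed

lemma similar_mat_of_real:
  assumes "similar_mat A B"
  shows "similar_mat (map_mat complex_of_real A) (map_mat complex_of_real B)"
proof -
  obtain n P Q where c: "A \<in> carrier_mat n n" "B \<in> carrier_mat n n" "P \<in> carrier_mat n n" "Q \<in> carrier_mat n n"
    and e: "P * Q = 1\<^sub>m n" "Q * P = 1\<^sub>m n" "A = P * B * Q"
    using similar_matD[OF assms] by auto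
  let ?h = "map_mat complex_of_real"
  have "?h P * ?h Q = 1\<^sub>m n" "?h Q * ?h P = 1\<^sub>m n"
    using c e(1,2) by (metis of_real_hom.mat_hom_mult of_real_hom.mat_hom_one)+
  moreover have "?h A = ?h P * ?h B * ?h Q"
    using c e(3) by (metis of_real_hom.mat_hom_mult mult_carrier_mat)
  ultimately show ?thesis
    using c by (intro similar_matI[of _ _ "?h P" "?h Q" n]) auto
qed

lemma real_jordan_nf_imp_jordan_nf:
  assumes "real_jordan_nf A J"
  shows "jordan_nf (map_mat complex_of_real A) (concat (map complex_blocks J))"
  using assms jordan_nf_complex_blocks[of J] similar_mat_of_real similar_mat_trans
  unfolding real_jordan_nf_def jordan_nf_def by blast

text \<open>Conjugating the base change fixes a real matrix. Together with uniqueness this pairs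
  every non-real block with one of the same size for the conjugate eigenvalue.\<close>

lemma jordan_nf_cnj:
  assumes "jordan_nf (map_mat complex_of_real A) n_as"
  shows "jordan_nf (map_mat complex_of_real A) (map (\<lambda>(n, a). (n, cnj a)) n_as)"
proof -
  let ?A = "map_mat complex_of_real A" and ?h = "map_mat cnj"
  let ?J = "jordan_matrix n_as" and ?J' = "jordan_matrix (map (\<lambda>(n, a). (n, cnj a)) n_as)"
  interpret cnj: comm_ring_hom cnj
    by unfold_locales auto
  obtain n P Q where c: "?A \<in> carrier_mat n n" "?J \<in> carrier_mat n n" "P \<in> carrier_mat n n" "Q \<in> carrier_mat n n"
    and e: "P * Q = 1\<^sub>m n" "Q * P = 1\<^sub>m n" "?A = P * ?J * Q"
    using similar_matD[of ?A ?J] assms unfolding jordan_nf_def insert_subset by metis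
  have "?h (jordan_block m a) = jordan_block m (cnj a)" for m a
    by (rule eq_matI) (auto simp: jordan_block_def)
  then have JJ: "?h ?J = ?J'"
    by (simp add: jordan_matrix_def map_mat_diag_block_mat comp_def split_def)
  have AA: "?h ?A = ?A" by (rule eq_matI) auto
  have "?h P * ?h Q = 1\<^sub>m n" "?h Q * ?h P = 1\<^sub>m n"
    using c e(1,2) by (metis cnj.mat_hom_mult cnj.mat_hom_one)+
  moreover have "?A = ?h P * ?J' * ?h Q"
    using c e(3) AA JJ by (metis cnj.mat_hom_mult mult_carrier_mat)
  moreover have "?J' \<in> carrier_mat n n"
    using c(2) by (metis JJ map_carrier_mat)
  ultimately have "similar_mat ?A ?J'"
    using c by (intro similar_matI[of _ _ "?h P" "?h Q" n]) auto
  then show ?thesis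
    using assms by (force simp: jordan_nf_def)
qed

text \<open>The number of blocks of positive size \<open>k\<close> for \<open>a\<close> can be read
  off the matrix. Blocks of size 0 would escape this count, but \<open>jordan_nf\<close> excludes
  them.\<close>

lemma mset_jordan_nf_unique:
  fixes A :: "complex mat"
  assumes "jordan_nf A xs" "jordan_nf A ys"
  shows "mset xs = mset ys"
proof (rule multiset_eqI)
  fix x :: "nat \<times> complex"
  obtain k a where x: "x = (k, a)" by force
  show "count (mset xs) x = count (mset ys) x"
  proof (cases "k = 0")
    case True
    then have "x \<notin> set xs" "x \<notin> set ys"
      using assms x by (force simp: jordan_nf_def)+
    then show ?thesis by (metis not_in_iff set_mset_mset)
  next
    case False
    have "length (filter ((=) (k, a)) xs) = length (filter ((=) (k, a)) ys)"
      using compute_nr_of_jordan_blocks[OF assms(1) False] compute_nr_of_jordan_blocks[OF assms(2) False]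
      by metis
    then show ?thesis by (simp add: x count_mset count_list_eq_length_filter)
  qed
qed

text \<open>Of each conjugate pair only the member with \<open>Im a > 0\<close> is kept. Its real
  block produces both members again, and by \<open>sym\<close> every block with
  \<open>Im a < 0\<close> arises in this way.\<close>

lemma mset_complex_blocks:
  fixes xs :: "(nat \<times> complex) list"
  assumes sym: "mset (map (\<lambda>(n, a). (n, cnj a)) xs) = mset xs"
  shows "mset (concat (map complex_blocks (map (\<lambda>(n, a). Real_Block n (Re a)) (filter (\<lambda>(n, a). Im a = 0) xs)
     @ map (\<lambda>(n, a). Complex_Block n (Re a) (Im a)) (filter (\<lambda>(n, a). Im a > 0) xs)))) = mset xs"
proof -
  have 1: "mset (concat (map complex_blocks (map (\<lambda>(n, a). Real_Block n (Re a)) (filter (\<lambda>(n, a). Im a = 0) zs))))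
      = filter_mset (\<lambda>(n, a). Im a = 0) (mset zs)" for zs
    by (induction zs) (auto simp: complex_eq_iff)
  have 2: "mset (concat (map complex_blocks (map (\<lambda>(n, a). Complex_Block n (Re a) (Im a)) (filter (\<lambda>(n, a). Im a > 0) zs))))
      = filter_mset (\<lambda>(n, a). Im a > 0) (mset zs) + filter_mset (\<lambda>(n, a). Im a < 0) (mset (map (\<lambda>(n, a). (n, cnj a)) zs))" for zs
    by (induction zs) (auto simp: complex_eq_iff)
  have 3: "filter_mset (\<lambda>(n, a). Im a = 0) M + (filter_mset (\<lambda>(n, a). Im a > 0) M
      + filter_mset (\<lambda>(n, a). Im a < 0) M) = M" for M :: "(nat \<times> complex) multiset"
    by (induction M) auto
  show ?thesis
    unfolding map_append concat_append mset_append 1 2 sym 3 ..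
qed

text \<open>Folding the conjugate pairs of a complex Jordan form gives a real matrix with the same
  complex blocks up to order, and complex similarity of real matrices descends to real
  similarity.\<close>

theorem real_jordan_nf_exists:
  assumes A: "A \<in> carrier_mat n n"
  shows "\<exists>J. real_jordan_nf A J"
proof -
  let ?A = "map_mat complex_of_real A"
  have cA: "?A \<in> carrier_mat n n" using A by simp
  obtain as where "char_poly ?A = (\<Prod>a\<leftarrow>as. [:- a, 1:])"
    using char_poly_factorized[OF cA] by auto
  from jordan_nf_exists[OF cA this] obtain xs where xs: "jordan_nf ?A xs" ..
  define J where "J = map (\<lambda>(n, a). Real_Block n (Re a)) (filter (\<lambda>(n, a). Im a = 0) xs)
     @ map (\<lambda>(n, a). Complex_Block n (Re a) (Im a)) (filter (\<lambda>(n, a). Im a > 0) xs)"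
  have ms: "mset (concat (map complex_blocks J)) = mset xs"
    unfolding J_def by (rule mset_complex_blocks, rule mset_jordan_nf_unique[OF jordan_nf_cnj[OF xs] xs])
  have valid: "\<forall>B\<in>set J. valid_jblock B"
    using xs by (force simp: J_def jordan_nf_def)
  let ?D = "diag_block_mat (map jblock_mat J)"
  have "similar_mat (jordan_matrix xs) (jordan_matrix (concat (map complex_blocks J)))"
    unfolding jordan_matrix_def
    by (rule similar_diag_block_mat_mset) (auto simp: ms square_mat.simps)
  then have sim: "similar_mat ?A (map_mat complex_of_real ?D)"
    using xs jordan_nf_complex_blocks[OF valid] similar_mat_trans similar_mat_sym
    unfolding jordan_nf_def by blast
  then have "?D \<in> carrier_mat n n"
    using similar_matD[OF sim] A by auto
  then show ?thesis
    using similar_mat_complex_imp_real[OF A _ sim] valid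
    unfolding real_jordan_nf_def by blast
qed

section \<open>Unipotency index in terms of Jordan blocks\<close>

lemma diag_block_mat_eq_0_iff:
  assumes "Ball (set As) square_mat"
  shows "diag_block_mat As = 0\<^sub>m (dim_row (diag_block_mat As)) (dim_row (diag_block_mat As))
    \<longleftrightarrow> (\<forall>A\<in>set As. A = 0\<^sub>m (dim_row A) (dim_row A))"
  using assms
proof (induction As)
  case (Cons A As)
  obtain k where k: "A \<in> carrier_mat k k"
    using Cons.prems by (metis carrier_matI list.set_intros(1) square_mat.simps)
  have sq: "Ball (set As) square_mat" using Cons.prems by simp
  then obtain l where l: "diag_block_mat As \<in> carrier_mat l l"
    by (rule diag_block_mat_square_carrier)
  define D where "D = diag_block_mat As"
  have D: "D \<in> carrier_mat l l" using l by (simp add: D_def)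
  have "four_block_mat A (0\<^sub>m k l) (0\<^sub>m l k) D = 0\<^sub>m (k + l) (k + l) \<longleftrightarrow> A = 0\<^sub>m k k \<and> D = 0\<^sub>m l l"
  proof
    assume *: "four_block_mat A (0\<^sub>m k l) (0\<^sub>m l k) D = 0\<^sub>m (k + l) (k + l)"
    have e: "four_block_mat A (0\<^sub>m k l) (0\<^sub>m l k) D $$ (i,j) = 0" if "i < k + l" "j < k + l" for i j
      using that by (simp add: *)
    have "A $$ (i,j) = 0" if "i < k" "j < k" for i j
      using e[of i j] that k D by simp
    moreover have "D $$ (i,j) = 0" if "i < l" "j < l" for i j
      using e[of "k + i" "k + j"] that k D by simp
    ultimately show "A = 0\<^sub>m k k \<and> D = 0\<^sub>m l l"
      using k D by (auto intro!: eq_matI)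
  qed auto
  moreover have "diag_block_mat (A # As) = four_block_mat A (0\<^sub>m k l) (0\<^sub>m l k) D"
    using k D by (simp add: Let_def D_def)
  moreover have "D = 0\<^sub>m l l \<longleftrightarrow> (\<forall>A\<in>set As. A = 0\<^sub>m (dim_row A) (dim_row A))"
    using Cons.IH[OF sq] l by (simp add: D_def)
  ultimately show ?case
    using k D by simp
qed simp

lemma char_matrix_diag_block_mat:
  fixes As :: "'a::field mat list"
  assumes "Ball (set As) square_mat"
  shows "char_matrix (diag_block_mat As) e = diag_block_mat (map (\<lambda>A. char_matrix A e) As)"
  using assms
proof (induction As)
  case Nil
  then show ?case by (auto simp: char_matrix_def intro!: eq_matI)
next
  case (Cons A As)
  obtain k where k: "A \<in> carrier_mat k k"
    using Cons.prems by (metis carrier_matI list.set_intros(1) square_mat.simps)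
  have sq: "Ball (set As) square_mat" using Cons.prems by simp
  then obtain l where l: "diag_block_mat As \<in> carrier_mat l l"
    by (rule diag_block_mat_square_carrier)
  have "char_matrix (four_block_mat A (0\<^sub>m k l) (0\<^sub>m l k) (diag_block_mat As)) e
    = four_block_mat (char_matrix A e) (0\<^sub>m k l) (0\<^sub>m l k) (char_matrix (diag_block_mat As) e)"
    using k l by (intro eq_matI) (auto simp: char_matrix_def)
  then show ?case
    using k l carrier_matD[OF char_matrix_closed[OF l, of e]] carrier_matD[OF char_matrix_closed[OF k, of e]]
    by (simp add: Let_def flip: Cons.IH[OF sq])
qed

text \<open>Only the first superdiagonal that may be nonzero is recorded. It is constant and
  multiplicative, and it decides when a power vanishes, so the remaining entries never have to be
  computed.\<close>

definition shifted_diag :: "nat \<Rightarrow> nat \<Rightarrow> 'a::comm_ring_1 \<Rightarrow> 'a mat \<Rightarrow> bool" where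
  "shifted_diag n j c X \<longleftrightarrow> X \<in> carrier_mat n n \<and>
     (\<forall>i<n. \<forall>i'<n. i' < i + j \<longrightarrow> X $$ (i,i') = 0) \<and> (\<forall>i. i + j < n \<longrightarrow> X $$ (i,i + j) = c)"

lemma shifted_diag_mult:
  assumes "shifted_diag n j c X" "shifted_diag n j' c' Y"
  shows "shifted_diag n (j + j') (c * c') (X * Y)"
  unfolding shifted_diag_def
proof (intro conjI allI impI)
  show "X * Y \<in> carrier_mat n n" using assms by (auto simp: shifted_diag_def)
  fix i i' assume i: "i < n" "i' < n"
  have XY: "(X * Y) $$ (i,i') = (\<Sum>k\<in>{0..<n}. X $$ (i,k) * Y $$ (k,i'))"
    using assms i by (auto simp: shifted_diag_def scalar_prod_def)
  show "(X * Y) $$ (i,i') = 0" if "i' < i + (j + j')"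
    unfolding XY
  proof (rule sum.neutral, safe)
    fix k assume "k \<in> {0..<n}"
    then show "X $$ (i,k) * Y $$ (k,i') = 0"
      using assms i that by (cases "k < i + j") (auto simp: shifted_diag_def)
  qed
next
  fix i assume i: "i + (j + j') < n"
  have Y: "Y $$ (i + j, i + (j + j')) = c'"
    using assms(2) i unfolding shifted_diag_def by (metis add.assoc)
  have "(X * Y) $$ (i,i + (j + j')) = (\<Sum>k\<in>{0..<n}. X $$ (i,k) * Y $$ (k,i + (j + j')))"
    using assms i by (auto simp: shifted_diag_def scalar_prod_def)
  also have "\<dots> = (\<Sum>k\<in>{0..<n}. if k = i + j then c * c' else 0)"
  proof (rule sum.cong[OF refl])
    fix k assume "k \<in> {0..<n}"
    then show "X $$ (i,k) * Y $$ (k,i + (j + j')) = (if k = i + j then c * c' else 0)"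
      using assms i Y by (cases k "i + j" rule: linorder_cases) (auto simp: shifted_diag_def)
  qed
  also have "\<dots> = c * c'" using i by simp
  finally show "(X * Y) $$ (i,i + (j + j')) = c * c'" .
qed

lemma shifted_diag_pow:
  assumes "shifted_diag n 1 c X"
  shows "shifted_diag n j (c ^ j) (X ^\<^sub>m j)"
proof (induction j)
  case 0
  then show ?case using assms by (auto simp: shifted_diag_def)
next
  case (Suc j)
  then show ?case using shifted_diag_mult[OF Suc assms] by (simp add: mult.commute)
qed

text \<open>On the diagonal \<open>a ^ q - 1\<close> vanishes, and the first superdiagonal is
  \<open>q * a ^ (q - 1)\<close>, which is nonzero in characteristic 0. So taking the
  \<open>q\<close>-th power and subtracting 1 keeps the nilpotency index of the block, namely its
  size.\<close>

lemma jordan_block_unipotent_index: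
  fixes a :: "'a::field_char_0"
  assumes a: "a ^ q = 1" and q: "q > 0"
  shows "(char_matrix (jordan_block n a ^\<^sub>m q) 1) ^\<^sub>m j = 0\<^sub>m n n \<longleftrightarrow> n \<le> j"
proof -
  let ?c = "of_nat q * a ^ (q - 1) :: 'a"
  have dim: "dim_row (char_matrix (jordan_block n a ^\<^sub>m q) 1) = n" "dim_col (char_matrix (jordan_block n a ^\<^sub>m q) 1) = n"
    by (simp_all add: char_matrix_def)
  have a0: "a \<noteq> 0" using a q by (auto simp: power_0_left)
  have "shifted_diag n 1 ?c (char_matrix (jordan_block n a ^\<^sub>m q) 1)"
    using a by (auto simp: shifted_diag_def jordan_block_pow char_matrix_def)
  then have s: "shifted_diag n j (?c ^ j) ((char_matrix (jordan_block n a ^\<^sub>m q) 1) ^\<^sub>m j)" (is "shifted_diag n j _ ?X")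
    by (rule shifted_diag_pow)
  show ?thesis
  proof
    assume "n \<le> j"
    then show "?X = 0\<^sub>m n n"
      using s dim by (intro eq_matI) (auto simp: shifted_diag_def)
  next
    assume X: "?X = 0\<^sub>m n n"
    show "n \<le> j"
    proof (rule ccontr)
      assume j: "\<not> n \<le> j"
      then have "0 + j < n" by simp
      then have "?X $$ (0, 0 + j) = ?c ^ j" using s unfolding shifted_diag_def by blast
      moreover have "?X $$ (0, j) = 0" using X j by simp
      ultimately show False using a0 q by simp
    qed
  qed
qed

text \<open>Similarity and the block structure reduce this to a single block. With \<open>j\<close>
  equal to the largest block size, and to one less, it yields the vanishing and the nonvanishing
  power on which the growth estimate rests.\<close>

lemma jordan_nf_unipotent_index:
  fixes A :: "'a::field_char_0 mat"
  assumes A: "A \<in> carrier_mat n n" and jnf: "jordan_nf A xs" and q: "q > 0"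
    and root: "\<And>m a. (m, a) \<in> set xs \<Longrightarrow> a ^ q = 1"
  shows "(char_matrix (A ^\<^sub>m q) 1) ^\<^sub>m j = 0\<^sub>m n n \<longleftrightarrow> (\<forall>(m, a)\<in>set xs. m \<le> j)"
proof -
  let ?J = "jordan_matrix xs"
  let ?N = "(char_matrix (?J ^\<^sub>m q) 1) ^\<^sub>m j"
  obtain P Q where "similar_mat_wit A ?J P Q"
    using jnf by (auto simp: jordan_nf_def similar_mat_def)
  then have w: "similar_mat_wit ((char_matrix (A ^\<^sub>m q) 1) ^\<^sub>m j) ?N P Q"
    by (intro similar_mat_wit_pow similar_mat_wit_char_matrix)
  have c: "(char_matrix (A ^\<^sub>m q) 1) ^\<^sub>m j \<in> carrier_mat n n"
    using A by (intro pow_carrier_mat) (auto simp: char_matrix_def)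
  note wD = similar_mat_witD2[OF c w]
  note wD' = similar_mat_witD2[OF wD(5) similar_mat_wit_sym[OF w]]
  have "(char_matrix (A ^\<^sub>m q) 1) ^\<^sub>m j = 0\<^sub>m n n \<longleftrightarrow> ?N = 0\<^sub>m n n"
  proof
    assume 0: "(char_matrix (A ^\<^sub>m q) 1) ^\<^sub>m j = 0\<^sub>m n n"
    show "?N = 0\<^sub>m n n"
      by (subst wD'(3)) (use wD(6,7) in \<open>simp add: 0\<close>)
  next
    assume 0: "?N = 0\<^sub>m n n"
    show "(char_matrix (A ^\<^sub>m q) 1) ^\<^sub>m j = 0\<^sub>m n n"
      by (subst wD(3)) (use wD(6,7) in \<open>simp add: 0\<close>)
  qed
  also have "?N = diag_block_mat (map (\<lambda>(m, a). (char_matrix (jordan_block m a ^\<^sub>m q) 1) ^\<^sub>m j) xs)"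
    (is "_ = diag_block_mat ?Bs")
  proof -
    have "char_matrix (?J ^\<^sub>m q) 1 = diag_block_mat (map (\<lambda>(m, a). char_matrix (jordan_block m a ^\<^sub>m q) 1) xs)"
      unfolding jordan_matrix_pow
      by (subst char_matrix_diag_block_mat) (auto simp: square_mat.simps comp_def split_def)
    then show ?thesis
      by (simp only:) (subst diag_block_pow_mat, auto simp: square_mat.simps comp_def split_def char_matrix_def)
  qed
  also have "diag_block_mat ?Bs = 0\<^sub>m n n \<longleftrightarrow> (\<forall>(m, a)\<in>set xs. m \<le> j)"
  proof -
    have dim: "dim_row (diag_block_mat ?Bs) = n"
      using calculation wD(5) by (metis carrier_matD(1) \<open>?N = diag_block_mat ?Bs\<close>)
    have "Ball (set ?Bs) square_mat"
      by (auto simp: square_mat.simps char_matrix_def)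
    from diag_block_mat_eq_0_iff[OF this, unfolded dim]
    have "diag_block_mat ?Bs = 0\<^sub>m n n \<longleftrightarrow> (\<forall>(m, a)\<in>set xs. (char_matrix (jordan_block m a ^\<^sub>m q) 1) ^\<^sub>m j = 0\<^sub>m m m)"
      by (auto simp: char_matrix_def split_def)
    then show ?thesis
      using jordan_block_unipotent_index[OF root q] by fastforce
  qed
  finally show ?thesis .
qed

section \<open>The exponent read off the real blocks\<close>

lemma real_root_of_unity:
  fixes c :: real
  assumes "c ^ q = 1" "q > 0"
  shows "c = 1 \<or> c = -1"
proof -
  have "\<bar>c\<bar> ^ q = 1" using assms by (simp flip: power_abs)
  then have "\<bar>c\<bar> = 1" using assms power_eq_iff_eq_base[of q "\<bar>c\<bar>" 1] by simp
  then show ?thesis by linarith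
qed

lemma max_block_dim_max:
  "finite {jblock_dim B | B. B \<in> set J \<and> jblock_eigenvalues B \<subseteq> L}"
  by (rule finite_subset[of _ "jblock_dim ` set J"]) auto

lemma max_block_dim_ge:
  assumes "B \<in> set J" "jblock_eigenvalues B \<subseteq> L"
  shows "jblock_dim B \<le> max_block_dim J L"
  unfolding max_block_dim_def using max_block_dim_max[of J L] assms by (intro Max_ge) auto

lemma max_block_dim_cases:
  obtains "max_block_dim J L = 0"
  | B where "B \<in> set J" "jblock_eigenvalues B \<subseteq> L" "max_block_dim J L = jblock_dim B"
proof -
  have "max_block_dim J L \<in> insert 0 {jblock_dim B | B. B \<in> set J \<and> jblock_eigenvalues B \<subseteq> L}"
    unfolding max_block_dim_def using max_block_dim_max[of J L] by (intro Max_in) auto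
  then show ?thesis using that by auto
qed

text \<open>A real root of unity is 1 or -1, so every block is counted either by
  \<open>k_real\<close> or by \<open>k_complex\<close>. A real block of dimension
  \<open>2 * m\<close> for a conjugate pair stands for two complex blocks of size \<open>m\<close>,
  whence the division by 2.\<close>

lemma max_k_real_k_complex:
  assumes valid: "\<forall>B\<in>set J. valid_jblock B" and q: "q > 0"
    and root: "\<And>m a. (m, a) \<in> set (concat (map complex_blocks J)) \<Longrightarrow> a ^ q = 1"
    and max: "\<And>m a. (m, a) \<in> set (concat (map complex_blocks J)) \<Longrightarrow> m \<le> K"
    and ex: "(K, a) \<in> set (concat (map complex_blocks J))"
  shows "max (real (k_real J)) (real (k_complex J) / 2) = real K"
proof -
  have nr: "Complex a b \<notin> \<real>" "Complex a b \<noteq> 1" "Complex a b \<noteq> -1" if "b \<noteq> 0" for a b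
    using that by (auto simp: complex_eq_iff complex_is_Real_iff)
  have "k_real J \<le> K"
    unfolding k_real_def
  proof (cases rule: max_block_dim_cases[of J "{1, -1}"])
    case (2 B)
    show "max_block_dim J {1, -1} \<le> K"
    proof (cases B)
      case (Real_Block m c)
      then have "(m, complex_of_real c) \<in> set (concat (map complex_blocks J))"
        using 2(1) by (auto intro!: bexI[of _ B])
      from max[OF this] show ?thesis using 2(3) Real_Block by simp
    qed (use 2 valid nr in auto)
  qed simp
  moreover have "k_complex J \<le> 2 * K"
    unfolding k_complex_def
  proof (cases rule: max_block_dim_cases[of J "- \<real>"])
    case (2 B)
    show "max_block_dim J (- \<real>) \<le> 2 * K"
    proof (cases B)
      case (Complex_Block m a b)
      then have "(m, Complex a b) \<in> set (concat (map complex_blocks J))"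
        using 2(1) by (auto intro!: bexI[of _ B])
      from max[OF this] show ?thesis using 2(3) Complex_Block by simp
    qed (use 2 in auto)
  qed simp
  moreover have "K \<le> k_real J \<or> 2 * K \<le> k_complex J"
  proof -
    obtain B where B: "B \<in> set J" "(K, a) \<in> set (complex_blocks B)" using ex by auto
    show ?thesis
    proof (cases B)
      case (Real_Block m c)
      then have "(m, complex_of_real c) \<in> set (concat (map complex_blocks J))"
        using B(1) by (auto intro!: bexI[of _ B])
      then have "complex_of_real c ^ q = 1" by (rule root)
      then have "c ^ q = 1" by (metis of_real_eq_1_iff of_real_power)
      then have "jblock_eigenvalues B \<subseteq> {1, -1}"
        using real_root_of_unity[OF _ q, of c] by (auto simp: Real_Block)
      from max_block_dim_ge[OF B(1) this] show ?thesis using B Real_Block by (simp add: k_real_def)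
    next
      case (Complex_Block m a b)
      then have "jblock_eigenvalues B \<subseteq> - \<real>" using valid B nr by auto
      from max_block_dim_ge[OF B(1) this] show ?thesis using B Complex_Block by (auto simp: k_complex_def)
    qed
  qed
  ultimately show ?thesis by (auto simp: max_def)
qed

subsection \<open>Eigenvalues of integral matrices and growth of their powers\<close>

lemma upper_triangular_pow:
  fixes U :: "'a::comm_ring_1 mat"
  assumes U: "U \<in> carrier_mat n n" and ut: "upper_triangular U"
  shows "upper_triangular (U ^\<^sub>m k) \<and> (\<forall>i<n. (U ^\<^sub>m k) $$ (i,i) = (U $$ (i,i)) ^ k)"
proof (induction k)
  case 0
  then show ?case using U by auto
next
  case (Suc k)
  have Uk: "U ^\<^sub>m k \<in> carrier_mat n n" using U by simp
  have e: "(U ^\<^sub>m Suc k) $$ (i,j) = (\<Sum>l\<in>{0..<n}. (U ^\<^sub>m k) $$ (i,l) * U $$ (l,j))"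
    if "i < n" "j < n" for i j
    using U Uk that by (simp add: scalar_prod_def)
  have lt: "(U ^\<^sub>m k) $$ (i,l) = 0" if "l < i" "i < n" for i l
    using Suc Uk that by auto
  have lt': "U $$ (i,l) = 0" if "l < i" "i < n" for i l
    using ut U that by auto
  have "(U ^\<^sub>m Suc k) $$ (i,j) = 0" if "j < i" "i < n" for i j
  proof -
    have "(U ^\<^sub>m k) $$ (i,l) * U $$ (l,j) = 0" if "l < n" for l
      using lt[of l i] lt'[of j l] \<open>j < i\<close> \<open>i < n\<close> that by (cases "l < i") auto
    then show ?thesis using e[of i j] that by simp
  qed
  moreover have "(U ^\<^sub>m Suc k) $$ (i,i) = (U $$ (i,i)) ^ Suc k" if "i < n" for i
  proof -
    have "(\<Sum>l\<in>{0..<n}. (U ^\<^sub>m k) $$ (i,l) * U $$ (l,i)) = (\<Sum>l\<in>{0..<n}. if l = i then (U $$ (i,i)) ^ Suc k else 0)"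
    proof (rule sum.cong[OF refl])
      fix l assume "l \<in> {0..<n}"
      then show "(U ^\<^sub>m k) $$ (i,l) * U $$ (l,i) = (if l = i then (U $$ (i,i)) ^ Suc k else 0)"
        using lt[of l i] lt'[of i l] that Suc by (cases l i rule: linorder_cases) (auto simp: mult.commute)
    qed
    then show ?thesis using e[OF that that] that by simp
  qed
  ultimately show ?case
    using Uk U by (auto simp: upper_triangular_def simp del: pow_mat.simps)
qed

text \<open>The coefficients are dominated by those of the power of \<open>x + R\<close>, whose sum
  is its value at 1. In the induction, multiplication by \<open>x - a\<close> adds a shifted copy
  and a copy scaled by at most \<open>R\<close>.\<close>

lemma norm_coeff_prod_linear_le:
  fixes as :: "complex list"
  assumes "R \<ge> 0" "\<And>a. a \<in> set as \<Longrightarrow> norm a \<le> R"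
  shows "norm (poly.coeff (\<Prod>a\<leftarrow>as. [:- a, 1:]) j) \<le> (1 + R) ^ length as"
  using assms(2)
proof (induction as arbitrary: j)
  case Nil
  then show ?case by (cases j) auto
next
  case (Cons a as)
  let ?q = "\<Prod>a\<leftarrow>as. [:- a, 1:]"
  let ?B = "(1 + R) ^ length as"
  have B: "norm (poly.coeff ?q j) \<le> ?B" for j
    using Cons by simp
  have 1: "norm (a * poly.coeff ?q j) \<le> R * ?B"
    unfolding norm_mult using B Cons.prems assms(1) by (intro mult_mono) auto
  have 2: "norm (poly.coeff (pCons 0 ?q) j) \<le> ?B"
    using B assms(1) by (cases j) auto
  have eq: "poly.coeff (\<Prod>a\<leftarrow>a # as. [:- a, 1:]) j = poly.coeff (pCons 0 ?q) j - a * poly.coeff ?q j"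
    by simp
  have "norm (poly.coeff (\<Prod>a\<leftarrow>a # as. [:- a, 1:]) j) \<le> ?B + R * ?B"
    unfolding eq by (rule order_trans[OF norm_triangle_ineq4 add_mono[OF 2 1]])
  then show ?case by (simp add: algebra_simps)
qed

lemma finite_bounded_int_polys:
  "finite {p :: int poly. degree p \<le> n \<and> (\<forall>j. \<bar>poly.coeff p j\<bar> \<le> B)}" (is "finite ?F")
proof (rule finite_subset)
  show "?F \<subseteq> Poly ` {xs. set xs \<subseteq> {-B..B} \<and> length xs = Suc n}"
  proof safe
    fix p :: "int poly" assume p: "degree p \<le> n" "\<forall>j. \<bar>poly.coeff p j\<bar> \<le> B"
    have "p = Poly (map (poly.coeff p) [0..<Suc n])"
      using p(1) by (intro poly_eqI) (auto simp: nth_default_def coeff_eq_0 simp del: upt_Suc)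
    moreover have "set (map (poly.coeff p) [0..<Suc n]) \<subseteq> {-B..B}"
      using p(2) by (auto simp: abs_le_iff minus_le_iff)
    ultimately show "p \<in> Poly ` {xs. set xs \<subseteq> {-B..B} \<and> length xs = Suc n}"
      by (intro image_eqI[of _ _ "map (poly.coeff p) [0..<Suc n]"]) auto
  qed
  show "finite (Poly ` {xs :: int list. set xs \<subseteq> {-B..B} \<and> length xs = Suc n})"
    by (intro finite_imageI finite_lists_length_eq) simp
qed

text \<open>Two of the powers coincide by the pigeonhole principle. The factor \<open>c\<close> is
  there because only the multiples \<open>D * a ^ k\<close> will be confined to a finite
  set.\<close>

lemma finite_power_orbit_imp_root_of_unity:
  fixes a c :: complex
  assumes "finite S" "\<And>k::nat. c * a ^ k \<in> S" "a \<noteq> 0" "c \<noteq> 0"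
  shows "\<exists>q>0. a ^ q = 1"
proof -
  have "\<not> inj (\<lambda>k::nat. c * a ^ k)"
    using assms(1,2) by (metis finite_subset image_subsetI infinite_UNIV_nat finite_imageD)
  then obtain k l :: nat where kl: "k < l" "a ^ k = a ^ l"
    using assms(4) by (auto simp: inj_def) (metis linorder_neqE_nat)
  have "a ^ l = a ^ k * a ^ (l - k)"
    using kl(1) by (simp flip: power_add)
  then have "a ^ k * a ^ (l - k) = a ^ k * 1"
    using kl(2) by simp
  then show ?thesis using kl(1) assms(3) by (intro exI[of _ "l - k"]) auto
qed

lemma finite_common_root_of_unity:
  fixes S :: "complex set"
  assumes "finite S" "\<And>a. a \<in> S \<Longrightarrow> \<exists>q>0. a ^ q = 1"
  shows "\<exists>q>0. \<forall>a\<in>S. a ^ q = 1"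
  using assms
proof (induction S rule: finite_induct)
  case (insert a S)
  then obtain q q' where "q > 0" "\<forall>a\<in>S. a ^ q = 1" "q' > 0" "a ^ q' = 1" by blast
  then show ?case
    by (intro exI[of _ "q * q'"]) (auto simp: power_mult power_mult[of _ q' q] mult.commute[of q q'],
        metis mult.commute power_mult power_one)
qed auto

text \<open>Kronecker's argument: the characteristic polynomials of the integer matrices \<open>D M\<^sup>k\<close> have
  bounded coefficients, so only finitely many numbers \<open>D a\<^sup>k\<close> occur.\<close>

theorem eigenvalues_roots_of_unity:
  fixes M :: "real mat" and D :: int
  assumes M: "M \<in> carrier_mat n n" and D: "D > 0"
    and int: "\<And>k i j. i < n \<Longrightarrow> j < n \<Longrightarrow> of_int D * (M ^\<^sub>m k) $$ (i,j) \<in> \<int>"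
    and le1: "\<And>a. eigenvalue (map_mat complex_of_real M) a \<Longrightarrow> norm a \<le> 1"
    and det: "det M \<noteq> 0"
    and jnf: "jordan_nf (map_mat complex_of_real M) xs"
  shows "\<exists>q>0. \<forall>(m, a)\<in>set xs. a ^ q = 1"
proof -
  let ?h = "map_mat complex_of_real" and ?J = "jordan_matrix xs"
  have hM: "?h M \<in> carrier_mat n n" using M by simp
  obtain P Q where wit: "similar_mat_wit (?h M) ?J P Q"
    using jnf by (auto simp: jordan_nf_def similar_mat_def)
  have J: "?J \<in> carrier_mat n n"
    by (rule similar_mat_witD2(5)[OF hM wit])
  then have sumn: "sum_list (map fst xs) = n" by (metis carrier_matD(1) jordan_matrix_dim(1))
  have ut: "upper_triangular ?J"
    using J jordan_matrix_upper_triangular[of _ xs] sumn by auto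
  have cp: "char_poly (?h M) = (\<Prod>a\<leftarrow>diag_mat ?J. [:- a, 1:])"
    using char_poly_similar[of "?h M" ?J] wit char_poly_upper_triangular[OF J ut]
    by (auto simp: similar_mat_def)
  have ev: "eigenvalue (?h M) a" if "a \<in> set (diag_mat ?J)" for a
    using that unfolding eigenvalue_root_char_poly[OF hM] cp
    by (auto simp: poly_prod_list prod_list_zero_iff)
  have nz: "a \<noteq> 0" if "a \<in> set (diag_mat ?J)" for a
  proof -
    have "det (?h M) \<noteq> 0" using det by (simp add: of_real_hom.hom_det)
    moreover have "det (?h M) = prod_list (diag_mat ?J)"
      using det_similar[of "?h M" ?J] wit det_upper_triangular[OF ut J]
      by (auto simp: similar_mat_def)
    ultimately have "prod_list (diag_mat ?J) \<noteq> 0" by metis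
    then show ?thesis using that by (auto simp: prod_list_zero_iff)
  qed
  \<comment> \<open>All eigenvalues of \<open>D\<close> times a power of \<open>M\<close> have
    modulus at most \<open>D\<close>, which bounds the coefficients of its characteristic polynomial
    independently of the exponent.\<close>
  define B where "B = \<lfloor>(1 + real_of_int D) ^ n\<rfloor>"
  define F where "F = {p :: int poly. degree p \<le> n \<and> (\<forall>j. \<bar>poly.coeff p j\<bar> \<le> B)}"
  define S where "S = (\<Union>p\<in>F - {0}. {z :: complex. poly (map_poly of_int p) z = 0})"
  have "finite S"
    unfolding S_def F_def using finite_bounded_int_polys[of n B]
    by (intro finite_UN_I poly_roots_finite) auto
  have orbit: "of_int D * a ^ k \<in> S" if a: "a \<in> set (diag_mat ?J)" for a k
  proof -
    \<comment> \<open>By \<open>int\<close> the floor is exact; it only turns the entries into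
      integers.\<close>
    define K where "K = map_mat (\<lambda>x. \<lfloor>of_int D * x\<rfloor>) (M ^\<^sub>m k)"
    have K: "K \<in> carrier_mat n n" using M by (simp add: K_def)
    have KM: "map_mat of_int K = complex_of_int D \<cdot>\<^sub>m (?h M ^\<^sub>m k)"
    proof -
      have "complex_of_int \<lfloor>of_int D * (M ^\<^sub>m k) $$ (i,j)\<rfloor> = complex_of_int D * (?h (M ^\<^sub>m k)) $$ (i,j)"
        if "i < n" "j < n" for i j
      proof -
        have "real_of_int \<lfloor>of_int D * (M ^\<^sub>m k) $$ (i,j)\<rfloor> = of_int D * (M ^\<^sub>m k) $$ (i,j)"
          using int[OF that, of k] by (simp add: Ints_def)
        then have "complex_of_real (real_of_int \<lfloor>of_int D * (M ^\<^sub>m k) $$ (i,j)\<rfloor>)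
            = complex_of_real (of_int D * (M ^\<^sub>m k) $$ (i,j))"
          by (rule arg_cong)
        then show ?thesis
          using that carrier_matD[OF pow_carrier_mat[OF M, of k]] by simp
      qed
      then have "map_mat of_int K = complex_of_int D \<cdot>\<^sub>m ?h (M ^\<^sub>m k)"
        using carrier_matD[OF pow_carrier_mat[OF M, of k]]
        by (intro eq_matI) (auto simp: K_def simp del: pow_mat_dim)
      then show ?thesis using M by (simp add: of_real_hom.mat_hom_pow)
    qed
    have Jk: "?J ^\<^sub>m k \<in> carrier_mat n n" using J by simp
    let ?U = "complex_of_int D \<cdot>\<^sub>m (?J ^\<^sub>m k)"
    have U: "?U \<in> carrier_mat n n" using Jk by simp
    have "similar_mat (map_mat of_int K) ?U"
      unfolding KM using similar_mat_smult similar_mat_wit_pow[OF wit] by (metis similar_mat_def)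
    moreover have "upper_triangular ?U"
      using upper_triangular_pow[OF J ut, of k] carrier_matD[OF Jk]
      by (simp add: upper_triangular_def del: pow_mat_dim)
    ultimately have cpK: "map_poly of_int (char_poly K) = (\<Prod>a\<leftarrow>diag_mat ?U. [:- a, 1:])"
      using char_poly_similar char_poly_upper_triangular[OF U] of_int_hom.char_poly_hom[OF K] by metis
    have dU: "diag_mat ?U = map (\<lambda>a. of_int D * a ^ k) (diag_mat ?J)"
      using upper_triangular_pow[OF J ut, of k] Jk J by (auto simp: diag_mat_def)
    have "norm (poly.coeff (map_poly complex_of_int (char_poly K)) j) \<le> (1 + real_of_int D) ^ length (diag_mat ?U)" for j
      unfolding cpK
    proof (rule norm_coeff_prod_linear_le)
      fix x assume "x \<in> set (diag_mat ?U)"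
      then obtain b where b: "b \<in> set (diag_mat ?J)" "x = of_int D * b ^ k" by (auto simp: dU)
      have "norm b ^ k \<le> 1" using le1[OF ev[OF b(1)]] by (simp add: power_le_one)
      then show "norm x \<le> real_of_int D"
        using D by (simp add: b norm_mult norm_power mult_left_le)
    qed (use D in simp)
    then have bd: "\<bar>real_of_int (poly.coeff (char_poly K) j)\<bar> \<le> (1 + real_of_int D) ^ n" for j
      using Jk by (simp add: diag_mat_def sumn)
    have "\<bar>poly.coeff (char_poly K) j\<bar> \<le> B" for j
      unfolding B_def le_floor_iff using bd[of j] by simp
    moreover have "degree (char_poly K) = n" "monic (char_poly K)"
      using degree_monic_char_poly[OF K] by auto
    \<comment> \<open>A monic polynomial is nonzero, so its roots belong to the finite set
      \<open>S\<close>.\<close>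
    ultimately have "char_poly K \<in> F - {0}"
      by (auto simp: F_def)
    moreover have "poly (map_poly of_int (char_poly K)) (of_int D * a ^ k) = 0"
      unfolding cpK dU using a by (auto simp: poly_prod_list prod_list_zero_iff)
    ultimately show ?thesis unfolding S_def by blast
  qed
  have "\<exists>q>0. \<forall>a\<in>set (diag_mat ?J). a ^ q = 1"
  proof (rule finite_common_root_of_unity)
    fix a assume a: "a \<in> set (diag_mat ?J)"
    show "\<exists>q>0. a ^ q = 1"
      by (rule finite_power_orbit_imp_root_of_unity[OF \<open>finite S\<close> orbit[OF a] nz[OF a]]) (use D in simp)
  qed simp
  then obtain q where q: "q > 0" "\<And>a. a \<in> set (diag_mat ?J) \<Longrightarrow> a ^ q = 1" by blast
  have "a \<in> set (diag_mat ?J)" if "(m, a) \<in> set xs" for m a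
  proof -
    have "m \<noteq> 0" using jnf that by (force simp: jordan_nf_def)
    then have "poly (char_poly (?h M)) a = 0"
      using that unfolding jordan_nf_char_poly[OF jnf]
      by (force simp: poly_prod_list prod_list_zero_iff)
    then show ?thesis
      unfolding cp by (auto simp: poly_prod_list prod_list_zero_iff)
  qed
  then show ?thesis using q by (intro exI[of _ q]) auto
qed

section \<open>Growth of unipotent orbits by finite differences\<close>

definition fdiff :: "(nat \<Rightarrow> real) \<Rightarrow> nat \<Rightarrow> real" where
  "fdiff u = (\<lambda>i. u (Suc i) - u i)"

lemma fdiff_apply: "fdiff u i = u (Suc i) - u i"
  by (simp add: fdiff_def)

lemma fdiff_funpow_shift:
  "(fdiff ^^ l) (\<lambda>i. u (i + j) - u i) = (\<lambda>i. (fdiff ^^ l) u (i + j) - (fdiff ^^ l) u i)"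
  by (induction l) (auto simp: fdiff_def)

lemma fdiff_funpow_Ints:
  assumes "\<And>i. c * u i \<in> \<int>"
  shows "c * (fdiff ^^ l) u i \<in> \<int>"
  by (induction l arbitrary: i) (auto simp: fdiff_def assms right_diff_distrib)

text \<open>Such a \<open>u\<close> is a polynomial of degree at most \<open>k\<close>. Taking
  \<open>k\<close> differences with step \<open>j\<close> multiplies the leading difference by
  \<open>j ^ k\<close>, while each of them at most doubles the bound and uses \<open>j\<close> more
  terms of the sequence.\<close>

lemma leading_difference_bound:
  assumes "(fdiff ^^ Suc k) u = (\<lambda>_. 0)" "\<And>i. i \<le> k * j \<Longrightarrow> \<bar>u i\<bar> \<le> W"
  shows "real j ^ k * \<bar>(fdiff ^^ k) u 0\<bar> \<le> 2 ^ k * W"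
  using assms
proof (induction k arbitrary: u W)
  case 0
  then show ?case by simp
next
  case (Suc k)
  \<comment> \<open>One difference with step \<open>j\<close>: the order drops by one and the
    leading difference acquires a factor \<open>j\<close>.\<close>
  let ?v = "\<lambda>i. u (i + j) - u i"
  have step: "(fdiff ^^ Suc k) u (Suc i) = (fdiff ^^ Suc k) u i" for i
  proof -
    have "fdiff ((fdiff ^^ Suc k) u) i = 0"
      using fun_cong[OF Suc.prems(1), of i] by simp
    then show ?thesis unfolding fdiff_apply[of "(fdiff ^^ Suc k) u"] by simp
  qed
  have const: "(fdiff ^^ Suc k) u i = (fdiff ^^ Suc k) u 0" for i
    by (induction i) (simp_all add: step del: funpow.simps)
  have "(fdiff ^^ Suc k) ?v = (\<lambda>_. 0)"
    unfolding fdiff_funpow_shift by (subst (1 2) const) simp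
  moreover have "\<bar>?v i\<bar> \<le> 2 * W" if "i \<le> k * j" for i
    using Suc.prems(2)[of i] Suc.prems(2)[of "i + j"] that by auto
  ultimately have "real j ^ k * \<bar>(fdiff ^^ k) ?v 0\<bar> \<le> 2 ^ k * (2 * W)"
    by (rule Suc.IH)
  moreover have "(fdiff ^^ k) u i - (fdiff ^^ k) u 0 = real i * (fdiff ^^ Suc k) u 0" for i
  proof (induction i)
    case (Suc i)
    have "(fdiff ^^ k) u (Suc i) - (fdiff ^^ k) u i = (fdiff ^^ Suc k) u 0"
      using const[of i] by (simp add: fdiff_apply)
    with Suc show ?case by (simp add: algebra_simps del: funpow.simps)
  qed simp
  then have "(fdiff ^^ k) ?v 0 = real j * (fdiff ^^ Suc k) u 0"
    unfolding fdiff_funpow_shift by simp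
  ultimately show ?case by (simp add: abs_mult mult_ac del: funpow.simps)
qed

lemma pow_mat_add:
  fixes A :: "'a::semiring_1 mat"
  assumes "A \<in> carrier_mat n n"
  shows "A ^\<^sub>m (k + l) = A ^\<^sub>m k * A ^\<^sub>m l"
proof (induction l)
  case (Suc l)
  then show ?case
    using assms assoc_mult_mat[of "A ^\<^sub>m k" n n "A ^\<^sub>m l" n A n] by simp
qed (use assms in simp)

text \<open>Along the times \<open>q * i\<close>, differences of a coordinate of the orbit are
  coordinates of powers of the nilpotent matrix applied to \<open>v\<close>. The \<open>k\<close>-th
  difference is therefore a nonzero constant, and at least \<open>1 / D\<close> in absolute value.
  The vector \<open>v\<close> enters the estimate only through \<open>W\<close>.\<close>

lemma unipotent_growth:
  fixes M :: "real mat" and D :: int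
  assumes M: "M \<in> carrier_mat r r" and v: "v \<in> carrier_vec r"
    and D: "D > 0" and q: "q > 0" and W: "W \<ge> 1"
    and nil: "(char_matrix (M ^\<^sub>m q) 1) ^\<^sub>m Suc k = 0\<^sub>m r r"
    and ne: "(char_matrix (M ^\<^sub>m q) 1) ^\<^sub>m k *\<^sub>v v \<noteq> 0\<^sub>v r"
    and int: "\<And>i a. a < r \<Longrightarrow> of_int D * (M ^\<^sub>m i *\<^sub>v v) $ a \<in> \<int>"
    and bd: "\<And>i a. i \<le> n \<Longrightarrow> a < r \<Longrightarrow> \<bar>(M ^\<^sub>m i *\<^sub>v v) $ a\<bar> \<le> W"
  shows "real n ^ k \<le> real (2 * q * k) ^ k * 2 ^ k * of_int D * W"
proof -
  let ?N = "char_matrix (M ^\<^sub>m q) 1"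
  have Mq: "M ^\<^sub>m i \<in> carrier_mat r r" for i using M by simp
  have N: "?N \<in> carrier_mat r r" using Mq by simp
  have Nl: "?N ^\<^sub>m l \<in> carrier_mat r r" for l using N by simp
  obtain a where a: "a < r" "(?N ^\<^sub>m k *\<^sub>v v) $ a \<noteq> 0"
    using ne Nl[of k] by (metis carrier_matD(1) dim_mult_mat_vec eq_vecI index_zero_vec)
  define u where "u = (\<lambda>i. (M ^\<^sub>m (q * i) *\<^sub>v v) $ a)"
  have diff: "(fdiff ^^ l) u = (\<lambda>i. (M ^\<^sub>m (q * i) *\<^sub>v (?N ^\<^sub>m l *\<^sub>v v)) $ a)" for l
  proof (induction l)
    case 0
    then show ?case using v carrier_matD[OF N] by (simp add: u_def)
  next
    case (Suc l)
    define w where "w = ?N ^\<^sub>m l *\<^sub>v v"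
    have w: "w \<in> carrier_vec r" unfolding w_def by (rule mult_mat_vec_carrier[OF Nl v])
    have Nw: "?N ^\<^sub>m Suc l *\<^sub>v v = M ^\<^sub>m q *\<^sub>v w - w"
    proof -
      have "?N ^\<^sub>m Suc l = ?N * ?N ^\<^sub>m l"
        using pow_mat_add[OF N, of 1 l] N by simp
      then have "?N ^\<^sub>m Suc l *\<^sub>v v = ?N *\<^sub>v w"
        using N Nl v by (simp add: w_def assoc_mult_mat_vec[of _ r r _ r])
      also have "\<dots> = M ^\<^sub>m q *\<^sub>v w - w"
      proof (rule eq_vecI)
        fix i assume "i < dim_vec (M ^\<^sub>m q *\<^sub>v w - w)"
        then have i: "i < r" using w by simp
        have "(?N *\<^sub>v w) $ i = (\<Sum>j\<in>{0..<r}. (M ^\<^sub>m q) $$ (i,j) * w $ j - (if j = i then w $ i else 0))"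
          using i w carrier_matD[OF Mq[of q]]
          by (auto simp: char_matrix_def scalar_prod_def algebra_simps intro!: sum.cong simp del: pow_mat_dim)
        then show "(?N *\<^sub>v w) $ i = (M ^\<^sub>m q *\<^sub>v w - w) $ i"
          using i w carrier_matD[OF Mq[of q]] by (simp add: scalar_prod_def sum_subtractf del: pow_mat_dim)
      qed (use w carrier_matD[OF N] in simp)
      finally show ?thesis .
    qed
    have "(M ^\<^sub>m (q * i) *\<^sub>v (?N ^\<^sub>m Suc l *\<^sub>v v)) $ a = (M ^\<^sub>m (q * Suc i) *\<^sub>v w) $ a - (M ^\<^sub>m (q * i) *\<^sub>v w) $ a" for i
    proof -
      have "M ^\<^sub>m (q * i) *\<^sub>v (M ^\<^sub>m q *\<^sub>v w - w) = M ^\<^sub>m (q * i) *\<^sub>v (M ^\<^sub>m q *\<^sub>v w) - M ^\<^sub>m (q * i) *\<^sub>v w"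
        by (rule mult_minus_distrib_mat_vec[OF Mq mult_mat_vec_carrier[OF Mq w] w])
      moreover have "M ^\<^sub>m (q * i) *\<^sub>v (M ^\<^sub>m q *\<^sub>v w) = M ^\<^sub>m (q * Suc i) *\<^sub>v w"
        using assoc_mult_mat_vec[OF Mq[of "q * i"] Mq[of q] w] pow_mat_add[OF M, of "q * i" q]
        by (simp add: add.commute)
      moreover have "a < dim_vec (M ^\<^sub>m (q * i) *\<^sub>v w)"
        using a carrier_matD[OF Mq[of "q * i"]] by (simp del: pow_mat_dim)
      ultimately show ?thesis using Nw by (simp add: index_minus_vec del: pow_mat.simps)
    qed
    then show ?case using Suc by (simp add: fdiff_def w_def del: pow_mat.simps)
  qed
  have z: "M ^\<^sub>m i *\<^sub>v 0\<^sub>v r = 0\<^sub>v r" for i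
    using carrier_matD[OF Mq[of i]] by (intro eq_vecI) (simp_all add: scalar_prod_def del: pow_mat_dim)
  have "(fdiff ^^ Suc k) u = (\<lambda>_. 0)"
  proof -
    have "0\<^sub>m r r *\<^sub>v v = 0\<^sub>v r"
      using v by (intro eq_vecI) (auto simp: scalar_prod_def)
    then show ?thesis unfolding diff nil using a z by auto
  qed
  have c: "(fdiff ^^ k) u 0 = (?N ^\<^sub>m k *\<^sub>v v) $ a"
    unfolding diff using one_mult_mat_vec[OF mult_mat_vec_carrier[OF Nl v]] M by simp
  have "of_int D * (fdiff ^^ k) u 0 \<in> \<int>"
    by (rule fdiff_funpow_Ints) (use int a in \<open>simp add: u_def\<close>)
  then have c1: "of_int D * \<bar>(fdiff ^^ k) u 0\<bar> \<ge> 1"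
    using c a D Ints_nonzero_abs_ge1[of "of_int D * (fdiff ^^ k) u 0"] by (simp add: abs_mult)
  have main: "real j ^ k \<le> 2 ^ k * of_int D * W" if j: "q * (k * j) \<le> n" for j
  proof -
    have "real j ^ k * 1 \<le> real j ^ k * (of_int D * \<bar>(fdiff ^^ k) u 0\<bar>)"
      using c1 by (intro mult_left_mono) auto
    also have "\<dots> = of_int D * (real j ^ k * \<bar>(fdiff ^^ k) u 0\<bar>)" by (simp add: mult_ac)
    also have "\<dots> \<le> of_int D * (2 ^ k * W)"
    proof (intro mult_left_mono leading_difference_bound)
      fix i assume "i \<le> k * j"
      then have "q * i \<le> n" using j by (meson le_trans mult_le_mono2)
      then show "\<bar>u i\<bar> \<le> W" using bd a by (simp add: u_def)
    qed (use D \<open>(fdiff ^^ Suc k) u = (\<lambda>_. 0)\<close> in auto)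
    finally show ?thesis by (simp add: mult_ac)
  qed
  have D1: "real_of_int D \<ge> 1" using D by simp
  show ?thesis
  proof (cases "n \<ge> q * k \<and> k > 0")
    case True
    \<comment> \<open>The largest \<open>j\<close> for which all times \<open>q * i\<close> with
      \<open>i \<le> k * j\<close> are at most \<open>n\<close>. Since \<open>j \<ge> 1\<close>,
      rounding loses at most a factor 2, which is the 2 in \<open>2 * q * k\<close>.\<close>
    define j where "j = n div (q * k)"
    have "j \<ge> 1" using True q by (simp add: j_def div_greater_zero_iff Suc_le_eq)
    have "q * (k * j) \<le> n" by (simp add: j_def flip: mult.assoc)
    have "n < (j + 1) * (q * k)"
      using dividend_less_div_times[of "q * k" n] q True by (simp add: j_def)
    also have "\<dots> \<le> (2 * j) * (q * k)" using \<open>j \<ge> 1\<close> by (intro mult_le_mono1) simp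
    finally have "real n \<le> real (2 * q * k) * real j"
      by (metis (no_types, lifting) less_imp_le mult.assoc mult.commute of_nat_le_iff of_nat_mult)
    then have "real n ^ k \<le> (real (2 * q * k) * real j) ^ k" by (intro power_mono) auto
    also have "\<dots> = real (2 * q * k) ^ k * real j ^ k" by (rule power_mult_distrib)
    also have "\<dots> \<le> real (2 * q * k) ^ k * (2 ^ k * of_int D * W)"
      by (intro mult_left_mono main \<open>q * (k * j) \<le> n\<close>) simp
    finally show ?thesis by (simp only: mult.assoc)
  next
    case False
    \<comment> \<open>For short times, and for \<open>k = 0\<close>, the constant alone dominates,
      since \<open>D\<close> and \<open>W\<close> are at least 1.\<close>
    then have "n \<le> 2 * q * k \<or> k = 0" by auto
    then have "real n ^ k \<le> real (2 * q * k) ^ k"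
    proof
      assume "n \<le> 2 * q * k"
      then have "real n \<le> real (2 * q * k)" by (simp only: of_nat_le_iff)
      then show ?thesis by (rule power_mono) simp
    qed simp
    also have "\<dots> * 1 \<le> real (2 * q * k) ^ k * (2 ^ k * of_int D * W)"
      using W D1 by (intro mult_left_mono mult_ge1_I) auto
    finally show ?thesis by (simp add: mult.assoc)
  qed
qed

subsection \<open>Real chains\<close>

lemma lookup_map_zero: "f 0 = 0 \<Longrightarrow> Poly_Mapping.lookup (Poly_Mapping.map f c) x = f (Poly_Mapping.lookup c x)"
  by (simp add: Poly_Mapping.map.rep_eq when_def)

lemma lookup_rc_scale [simp]: "Poly_Mapping.lookup (rc_scale r c) x = r * Poly_Mapping.lookup c x"
  by (simp add: rc_scale_def lookup_map_zero)

lemma rc_scale_simps [simp]: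
  "rc_scale 0 c = 0" "rc_scale 1 c = c" "rc_scale r 0 = 0" "rc_scale r (rc_scale s c) = rc_scale (r * s) c"
  "rc_scale r (Poly_Mapping.single x s) = Poly_Mapping.single x (r * s)"
  by (intro poly_mapping_eqI; simp add: lookup_single when_def)+

lemma rc_scale_minus_one: "rc_scale (-1) c = - c"
  by (intro poly_mapping_eqI) simp

lemma rc_scale_distrib:
  "rc_scale r (a + b) = rc_scale r a + rc_scale r b" "rc_scale (r + s) a = rc_scale r a + rc_scale s a"
  "rc_scale r (a - b) = rc_scale r a - rc_scale r b" "rc_scale (r - s) a = rc_scale r a - rc_scale s a"
  "rc_scale r (- a) = - rc_scale r a" "rc_scale (- r) a = - rc_scale r a"
  by (intro poly_mapping_eqI; simp add: lookup_add lookup_minus algebra_simps)+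

lemma rc_scale_sum: "rc_scale r (sum g I) = (\<Sum>i\<in>I. rc_scale r (g i))"
  by (induction I rule: infinite_finite_induct) (auto simp: rc_scale_distrib)

lemma rc_extend_superset:
  assumes "finite S" "Poly_Mapping.keys c \<subseteq> S"
  shows "rc_extend h c = (\<Sum>\<sigma>\<in>S. rc_scale (Poly_Mapping.lookup c \<sigma>) (h \<sigma>))"
  unfolding rc_extend_def using assms
  by (intro sum.mono_neutral_left) (auto simp: in_keys_iff)

lemma rc_extend_0 [simp]: "rc_extend h 0 = 0"
  by (simp add: rc_extend_def)

lemma rc_extend_single [simp]: "rc_extend h (Poly_Mapping.single x r) = rc_scale r (h x)"
  by (subst rc_extend_superset[of "{x}"]) (auto split: if_splits)

lemma rc_extend_add: "rc_extend h (a + b) = rc_extend h a + rc_extend h b"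
proof -
  let ?S = "Poly_Mapping.keys a \<union> Poly_Mapping.keys b"
  have "rc_extend h (a + b) = (\<Sum>\<sigma>\<in>?S. rc_scale (Poly_Mapping.lookup (a + b) \<sigma>) (h \<sigma>))"
    using Poly_Mapping.keys_add[of a b] by (intro rc_extend_superset) auto
  also have "\<dots> = rc_extend h a + rc_extend h b"
    by (subst (1 2) rc_extend_superset[of ?S]) (auto simp: lookup_add rc_scale_distrib sum.distrib)
  finally show ?thesis .
qed

lemma rc_extend_scale: "rc_extend h (rc_scale r a) = rc_scale r (rc_extend h a)"
proof -
  have "rc_extend h (rc_scale r a) = (\<Sum>\<sigma>\<in>Poly_Mapping.keys a. rc_scale (Poly_Mapping.lookup (rc_scale r a) \<sigma>) (h \<sigma>))"
    by (rule rc_extend_superset) (auto simp: in_keys_iff)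
  then show ?thesis by (simp add: rc_extend_def rc_scale_sum)
qed

lemma rc_extend_minus: "rc_extend h (- a) = - rc_extend h a"
  using rc_extend_scale[of h "-1" a] by (simp add: rc_scale_minus_one)

lemma rc_extend_diff: "rc_extend h (a - b) = rc_extend h a - rc_extend h b"
  using rc_extend_add[of h a "- b"] by (simp add: rc_extend_minus)

lemma rc_extend_sum: "rc_extend h (sum g I) = (\<Sum>i\<in>I. rc_extend h (g i))"
  by (induction I rule: infinite_finite_induct) (auto simp: rc_extend_add)

lemma rc_extend_compose: "rc_extend g (rc_extend h c) = rc_extend (\<lambda>\<sigma>. rc_extend g (h \<sigma>)) c"
  by (simp add: rc_extend_def[of h] rc_extend_def[of "\<lambda>\<sigma>. rc_extend g (h \<sigma>)"] rc_extend_sum rc_extend_scale)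

lemma rc_extend_cong: "(\<And>\<sigma>. \<sigma> \<in> Poly_Mapping.keys c \<Longrightarrow> g \<sigma> = h \<sigma>) \<Longrightarrow> rc_extend g c = rc_extend h c"
  by (simp add: rc_extend_def)

lemma rc_extend_diff_fun: "rc_extend (\<lambda>\<sigma>. g \<sigma> - h \<sigma>) c = rc_extend g c - rc_extend h c"
  by (simp add: rc_extend_def rc_scale_distrib sum_subtractf)

lemma rc_extend_single_fun: "rc_extend (\<lambda>\<sigma>. Poly_Mapping.single \<sigma> 1) c = c"
proof -
  have "Poly_Mapping.lookup (rc_extend (\<lambda>\<sigma>. Poly_Mapping.single \<sigma> 1) c) x = Poly_Mapping.lookup c x" for x
    by (simp add: rc_extend_def lookup_sum lookup_single when_def sum.delta in_keys_iff)
  then show ?thesis by (rule poly_mapping_eqI)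
qed

subsection \<open>Subspaces of chains\<close>

definition rc_subspace :: "('b \<Rightarrow>\<^sub>0 real) set \<Rightarrow> bool" where
  "rc_subspace S \<longleftrightarrow> 0 \<in> S \<and> (\<forall>a\<in>S. \<forall>b\<in>S. a + b \<in> S) \<and> (\<forall>r. \<forall>a\<in>S. rc_scale r a \<in> S)"

lemma rc_subspaceD:
  assumes "rc_subspace S"
  shows "0 \<in> S" "a \<in> S \<Longrightarrow> b \<in> S \<Longrightarrow> a + b \<in> S" "a \<in> S \<Longrightarrow> rc_scale r a \<in> S"
    "a \<in> S \<Longrightarrow> - a \<in> S" "a \<in> S \<Longrightarrow> b \<in> S \<Longrightarrow> a - b \<in> S"
proof -
  show 0: "0 \<in> S" "\<And>a b. a \<in> S \<Longrightarrow> b \<in> S \<Longrightarrow> a + b \<in> S" "\<And>a r. a \<in> S \<Longrightarrow> rc_scale r a \<in> S"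
    using assms by (auto simp: rc_subspace_def)
  show 1: "\<And>a. a \<in> S \<Longrightarrow> - a \<in> S" using 0(3)[of _ "-1"] by (simp add: rc_scale_minus_one)
  show "a \<in> S \<Longrightarrow> b \<in> S \<Longrightarrow> a - b \<in> S" using 0(2)[of a "- b"] 1 by simp
qed

lemma rc_subspace_sum:
  assumes "rc_subspace S" "\<And>i. i \<in> I \<Longrightarrow> g i \<in> S"
  shows "sum g I \<in> S"
  using assms(2) by (induction I rule: infinite_finite_induct) (auto intro: rc_subspaceD[OF assms(1)])

lemma rc_subspace_extend:
  assumes "rc_subspace S" "\<And>\<sigma>. \<sigma> \<in> Poly_Mapping.keys c \<Longrightarrow> h \<sigma> \<in> S"
  shows "rc_extend h c \<in> S"
  unfolding rc_extend_def using assms by (intro rc_subspace_sum rc_subspaceD(3)) auto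

lemma rc_subspace_real_chains: "rc_subspace (real_chains p X)"
proof -
  have "Poly_Mapping.keys (rc_scale r a) \<subseteq> Poly_Mapping.keys a" for r and a :: "'a real_chain"
    by (auto simp: in_keys_iff)
  moreover have "Poly_Mapping.keys (a + b) \<subseteq> Poly_Mapping.keys a \<union> Poly_Mapping.keys b" for a b :: "'a real_chain"
    by (rule Poly_Mapping.keys_add)
  ultimately show ?thesis
    unfolding rc_subspace_def real_chains_def by (simp, meson Un_least subset_trans)
qed

lemma real_boundary_linear:
  "real_boundary p (a + b) = real_boundary p a + real_boundary p b"
  "real_boundary p (a - b) = real_boundary p a - real_boundary p b"
  "real_boundary p (- a) = - real_boundary p a"
  "real_boundary p (rc_scale r a) = rc_scale r (real_boundary p a)"
  "real_boundary p 0 = 0"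
  by (auto simp: real_boundary_def rc_extend_add rc_extend_diff rc_extend_scale rc_extend_minus)

lemma rc_subspace_real_cycles: "rc_subspace (real_cycles p X)"
  using rc_subspace_real_chains[of p X]
  by (auto simp: real_cycles_def rc_subspace_def real_boundary_linear)

lemma rc_subspace_real_boundaries: "rc_subspace (real_boundaries p X)"
  unfolding rc_subspace_def real_boundaries_def
proof (intro conjI ballI allI)
  note [intro] = rc_subspaceD[OF rc_subspace_real_chains]
  show "0 \<in> real_boundary (Suc p) ` real_chains (Suc p) X"
    by (rule image_eqI[of _ _ 0]) (auto simp: real_boundary_linear)
  fix a assume "a \<in> real_boundary (Suc p) ` real_chains (Suc p) X"
  then obtain a' where a: "a = real_boundary (Suc p) a'" "a' \<in> real_chains (Suc p) X" by blast
  show "rc_scale r a \<in> real_boundary (Suc p) ` real_chains (Suc p) X" for r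
    using a by (intro image_eqI[of _ _ "rc_scale r a'"]) (auto simp: real_boundary_linear)
  fix b assume "b \<in> real_boundary (Suc p) ` real_chains (Suc p) X"
  then obtain b' where b: "b = real_boundary (Suc p) b'" "b' \<in> real_chains (Suc p) X" by blast
  show "a + b \<in> real_boundary (Suc p) ` real_chains (Suc p) X"
    using a b by (intro image_eqI[of _ _ "a' + b'"]) (auto simp: real_boundary_linear)
qed

subsection \<open>Change of coefficients\<close>

text \<open>Geometric facts are obtained for integral chains and transported along this map; real
  coefficients then enter by linearity, one simplex at a time.\<close>

definition real_of_chain :: "('b \<Rightarrow>\<^sub>0 int) \<Rightarrow> ('b \<Rightarrow>\<^sub>0 real)" where
  "real_of_chain c = Poly_Mapping.map real_of_int c"

lemma lookup_real_of_chain [simp]: "Poly_Mapping.lookup (real_of_chain c) x = real_of_int (Poly_Mapping.lookup c x)"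
  by (simp add: real_of_chain_def lookup_map_zero)

lemma keys_real_of_chain [simp]: "Poly_Mapping.keys (real_of_chain c) = Poly_Mapping.keys c"
  by (auto simp: in_keys_iff)

lemma real_of_chain_linear:
  "real_of_chain (a + b) = real_of_chain a + real_of_chain b"
  "real_of_chain (a - b) = real_of_chain a - real_of_chain b"
  "real_of_chain (- a) = - real_of_chain a"
  "real_of_chain 0 = 0"
  "real_of_chain (frag_cmul k a) = rc_scale (of_int k) (real_of_chain a)"
  by (intro poly_mapping_eqI; simp add: lookup_add lookup_minus)+

lemma real_of_chain_sum: "real_of_chain (sum g I) = (\<Sum>i\<in>I. real_of_chain (g i))"
  by (induction I rule: infinite_finite_induct) (auto simp: real_of_chain_linear)

lemma real_of_chain_frag_of [simp]: "real_of_chain (frag_of x) = Poly_Mapping.single x 1"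
  by (intro poly_mapping_eqI) (simp add: lookup_single when_def)

lemma real_of_chain_extend: "real_of_chain (frag_extend h c) = rc_extend (\<lambda>\<sigma>. real_of_chain (h \<sigma>)) (real_of_chain c)"
  by (simp add: frag_extend_def rc_extend_def real_of_chain_sum real_of_chain_linear)

lemma real_of_chain_boundary: "real_of_chain (chain_boundary p c) = real_boundary p (real_of_chain c)"
  by (simp add: chain_boundary_def real_boundary_def real_of_chain_extend real_of_chain_sum real_of_chain_linear)

lemma real_of_chain_chain_map: "real_of_chain (chain_map p f c) = real_chain_map p f (real_of_chain c)"
  by (simp add: chain_map_def real_chain_map_def real_of_chain_extend)

lemma real_of_chain_real_chains: "singular_chain p X c \<Longrightarrow> real_of_chain c \<in> real_chains p X"
  by (simp add: singular_chain_def real_chains_def)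

lemma real_of_chain_real_boundaries:
  assumes "singular_relboundary p X {} c"
  shows "real_of_chain c \<in> real_boundaries p X"
proof -
  obtain d where "singular_chain (Suc p) X d" "chain_boundary (Suc p) d = c"
    using assms by (auto simp: singular_boundary)
  then show ?thesis
    unfolding real_boundaries_def
    by (metis image_eqI real_of_chain_boundary real_of_chain_real_chains)
qed

lemma real_boundary_single:
  "p > 0 \<Longrightarrow> real_boundary p (Poly_Mapping.single \<sigma> 1) = real_of_chain (chain_boundary p (frag_of \<sigma>))"
  by (simp add: real_of_chain_boundary)

lemma real_boundary_eq_extend:
  "p > 0 \<Longrightarrow> real_boundary p c = rc_extend (\<lambda>\<sigma>. real_of_chain (chain_boundary p (frag_of \<sigma>))) c"
  by (simp add: real_of_chain_boundary) (simp add: real_boundary_def)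

lemma real_chain_map_linear:
  "real_chain_map p f (a + b) = real_chain_map p f a + real_chain_map p f b"
  "real_chain_map p f (a - b) = real_chain_map p f a - real_chain_map p f b"
  "real_chain_map p f (- a) = - real_chain_map p f a"
  "real_chain_map p f (rc_scale r a) = rc_scale r (real_chain_map p f a)"
  "real_chain_map p f 0 = 0"
  by (auto simp: real_chain_map_def rc_extend_add rc_extend_diff rc_extend_scale rc_extend_minus)

lemma real_chain_map_sum: "real_chain_map p f (sum g I) = (\<Sum>i\<in>I. real_chain_map p f (g i))"
  by (induction I rule: infinite_finite_induct) (auto simp: real_chain_map_linear)

lemma real_chain_map_real_chains:
  assumes "c \<in> real_chains p X" "continuous_map X Y f"
  shows "real_chain_map p f c \<in> real_chains p Y"
  unfolding real_chain_map_def
  by (rule rc_subspace_extend[OF rc_subspace_real_chains])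
    (use assms in \<open>auto simp: real_chains_def intro!: singular_simplex_simplex_map\<close>)

text \<open>Both sides are linear in \<open>c\<close>, and on a single simplex the equation is the
  image of naturality for integral chains.\<close>

lemma real_boundary_chain_map:
  assumes "c \<in> real_chains p X"
  shows "real_boundary p (real_chain_map p f c) = real_chain_map (p - Suc 0) f (real_boundary p c)"
proof (cases "p = 0")
  case True
  then show ?thesis by (simp add: real_boundary_def real_chain_map_linear)
next
  case False
  have "real_boundary p (real_chain_map p f c)
      = rc_extend (\<lambda>\<sigma>. real_boundary p (real_chain_map p f (Poly_Mapping.single \<sigma> 1))) c"
    using False by (simp add: real_chain_map_def real_boundary_def rc_extend_compose)
  also have "\<dots> = rc_extend (\<lambda>\<sigma>. real_chain_map (p - Suc 0) f (real_boundary p (Poly_Mapping.single \<sigma> 1))) c"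
  proof (rule rc_extend_cong)
    fix \<sigma> assume "\<sigma> \<in> Poly_Mapping.keys c"
    then have "singular_chain p X (frag_of \<sigma>)"
      using assms by (auto simp: real_chains_def singular_chain_of)
    from arg_cong[OF chain_boundary_chain_map[OF this, of f], of real_of_chain]
    show "real_boundary p (real_chain_map p f (Poly_Mapping.single \<sigma> 1))
        = real_chain_map (p - Suc 0) f (real_boundary p (Poly_Mapping.single \<sigma> 1))"
      by (simp only: real_of_chain_chain_map real_of_chain_boundary real_of_chain_frag_of)
  qed
  also have "\<dots> = real_chain_map (p - Suc 0) f (real_boundary p c)"
    using False by (simp add: real_chain_map_def[of "p - Suc 0"] real_boundary_def rc_extend_compose)
  finally show ?thesis .
qed

lemma real_chain_map_cycles:
  assumes "c \<in> real_cycles p X" "continuous_map X Y f"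
  shows "real_chain_map p f c \<in> real_cycles p Y"
  using assms by (auto simp: real_cycles_def real_chain_map_real_chains real_boundary_chain_map real_chain_map_linear)

lemma real_chain_map_boundaries:
  assumes "c \<in> real_boundaries p X" "continuous_map X Y f"
  shows "real_chain_map p f c \<in> real_boundaries p Y"
proof -
  obtain d where "d \<in> real_chains (Suc p) X" "c = real_boundary (Suc p) d"
    using assms by (auto simp: real_boundaries_def)
  then show ?thesis
    using assms(2) real_boundary_chain_map[of d "Suc p" X f]
    by (auto simp: real_boundaries_def intro!: image_eqI[of _ _ "real_chain_map (Suc p) f d"] real_chain_map_real_chains)
qed

lemma real_chain_map_compose_inverse:
  assumes "c \<in> real_chains p X" "\<And>x. x \<in> topspace X \<Longrightarrow> g (f x) = x"
  shows "real_chain_map p g (real_chain_map p f c) = c"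
proof -
  have "real_chain_map p g (real_chain_map p f c)
      = rc_extend (\<lambda>\<sigma>. Poly_Mapping.single (simplex_map p g (simplex_map p f \<sigma>)) 1) c"
    by (simp add: real_chain_map_def rc_extend_compose)
  also have "\<dots> = rc_extend (\<lambda>\<sigma>. Poly_Mapping.single \<sigma> 1) c"
  proof (rule rc_extend_cong)
    fix \<sigma> assume "\<sigma> \<in> Poly_Mapping.keys c"
    then have "singular_simplex p X \<sigma>" using assms(1) by (auto simp: real_chains_def)
    then have "simplex_map p (g \<circ> f) \<sigma> = \<sigma>"
      by (intro simplex_map_id_gen[of p X]) (auto simp: assms(2))
    then show "Poly_Mapping.single (simplex_map p g (simplex_map p f \<sigma>)) (1::real) = Poly_Mapping.single \<sigma> 1"
      by (simp add: simplex_map_compose)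
  qed
  finally show ?thesis by (simp add: rc_extend_single_fun)
qed

subsection \<open>Rational structure\<close>

text \<open>A \<open>\<rat>\<close>-linear retraction \<open>\<real> \<rightarrow> \<rat>\<close> applied to coefficients turns a real relation
  between integral chains into a rational one.\<close>

definition integral_chain :: "('b \<Rightarrow>\<^sub>0 real) \<Rightarrow> bool" where
  "integral_chain c \<longleftrightarrow> (\<forall>x. Poly_Mapping.lookup c x \<in> \<int>)"

lemma integral_chain_real_of_chain: "integral_chain (real_of_chain c)"
  by (simp add: integral_chain_def)

text \<open>Extend 1 to a basis of \<real> over \<rat> and send all other basis elements to
  0.\<close>

lemma rational_retraction_exists:
  "\<exists>\<phi> :: real \<Rightarrow> real. (\<forall>x y. \<phi> (x + y) = \<phi> x + \<phi> y) \<and> (\<forall>x. \<phi> x \<in> \<rat>) \<and> \<phi> 1 = 1"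
proof -
  interpret Q: vector_space "\<lambda>(q::rat) (x::real). of_rat q * x"
    by unfold_locales (auto simp: algebra_simps of_rat_add of_rat_mult)
  interpret QQ: vector_space_pair "\<lambda>(q::rat) (x::real). of_rat q * x" "\<lambda>(q::rat) (x::real). of_rat q * x"
    by unfold_locales
  have ind: "Q.independent {1}" by (simp add: Q.dependent_single)
  define B where "B = Q.extend_basis {1}"
  define \<phi> where "\<phi> = QQ.construct B (\<lambda>b. if b = 1 then 1 else 0)"
  have indB: "Q.independent B" and spB: "Q.span B = UNIV" and 1: "1 \<in> B"
    using Q.independent_extend_basis[OF ind] Q.span_extend_basis[OF ind] Q.extend_basis_superset[OF ind]
    by (auto simp: B_def)
  have lin: "Vector_Spaces.linear (\<lambda>(q::rat) (x::real). of_rat q * x) (\<lambda>(q::rat) (x::real). of_rat q * x) \<phi>"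
    unfolding \<phi>_def by (rule QQ.linear_construct[OF indB])
  then interpret L: Vector_Spaces.linear "\<lambda>(q::rat) (x::real). of_rat q * x" "\<lambda>(q::rat) (x::real). of_rat q * x" \<phi> .
  have "\<phi> x \<in> \<rat>" for x
  proof -
    have "x \<in> Q.span B" using spB by simp
    then show ?thesis
    proof (induction rule: Q.span_induct_alt)
      case base
      then show ?case by (simp add: L.zero)
    next
      case (step c b y)
      have "\<phi> b \<in> \<rat>" unfolding \<phi>_def using QQ.construct_basis[OF indB step(1)] by simp
      then show ?case using step by (simp add: L.add L.scale Rats_add Rats_mult)
    qed
  qed
  moreover have "\<phi> 1 = 1"
    unfolding \<phi>_def using QQ.construct_basis[OF indB 1] by simp
  ultimately show ?thesis using L.add by blast
qed

lemma additive_of_int_mult: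
  fixes \<phi> :: "real \<Rightarrow> real"
  assumes add: "\<And>x y. \<phi> (x + y) = \<phi> x + \<phi> y"
  shows "\<phi> (of_int k * x) = of_int k * \<phi> x" "\<phi> 0 = 0"
proof -
  show 0: "\<phi> 0 = 0" using add[of 0 0] by simp
  have neg: "\<phi> (- y) = - \<phi> y" for y using add[of y "- y"] 0 by simp
  have nat: "\<phi> (of_nat m * x) = of_nat m * \<phi> x" for m
    by (induction m) (auto simp: 0 add algebra_simps)
  show "\<phi> (of_int k * x) = of_int k * \<phi> x"
    by (cases k rule: int_cases2) (use nat neg in simp_all)
qed

text \<open>An additive map need not be multiplicative, but it commutes with multiplication by
  integers; this is where the integrality of \<open>c\<close> enters.\<close>

lemma map_coeffs_scale:
  assumes "\<phi> 0 = 0" "integral_chain c" and add: "\<And>x y. \<phi> (x + y) = \<phi> x + \<phi> y"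
  shows "Poly_Mapping.map \<phi> (rc_scale r c) = rc_scale (\<phi> r) c"
proof (rule poly_mapping_eqI)
  fix x
  obtain k where "Poly_Mapping.lookup c x = of_int k"
    using assms(2) by (auto simp: integral_chain_def Ints_def)
  then show "Poly_Mapping.lookup (Poly_Mapping.map \<phi> (rc_scale r c)) x = Poly_Mapping.lookup (rc_scale (\<phi> r) c) x"
    using additive_of_int_mult(1)[of \<phi> k r, OF add] assms(1) by (simp add: lookup_map_zero mult.commute)
qed

lemma map_coeffs_sum:
  assumes add: "\<And>x y. \<phi> (x + y) = \<phi> x + (\<phi> y :: real)"
  shows "Poly_Mapping.map \<phi> (sum g I) = (\<Sum>i\<in>I. Poly_Mapping.map \<phi> (g i :: 'b \<Rightarrow>\<^sub>0 real))"
proof -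
  have 0: "\<phi> 0 = 0" by (rule additive_of_int_mult(2)[OF add])
  have "Poly_Mapping.map \<phi> (a + b) = Poly_Mapping.map \<phi> a + Poly_Mapping.map \<phi> b" for a b :: "'b \<Rightarrow>\<^sub>0 real"
    by (rule poly_mapping_eqI) (simp add: lookup_map_zero 0 lookup_add add)
  moreover have "Poly_Mapping.map \<phi> 0 = (0 :: 'b \<Rightarrow>\<^sub>0 real)"
    by (rule poly_mapping_eqI) (simp add: lookup_map_zero 0)
  ultimately show ?thesis
    by (induction I rule: infinite_finite_induct) auto
qed

text \<open>The boundary of a simplex has integral coefficients, so applying an additive map to
  coefficients commutes with the boundary operator.\<close>

lemma map_coeffs_boundaries:
  assumes add: "\<And>x y. \<phi> (x + y) = \<phi> x + (\<phi> y :: real)" and c: "c \<in> real_boundaries p X"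
  shows "Poly_Mapping.map \<phi> c \<in> real_boundaries p X"
proof -
  have 0: "\<phi> 0 = 0" by (rule additive_of_int_mult(2)[OF add])
  obtain d where d: "d \<in> real_chains (Suc p) X" "c = real_boundary (Suc p) d"
    using c by (auto simp: real_boundaries_def)
  let ?d = "Poly_Mapping.map \<phi> d"
  have keys: "Poly_Mapping.keys ?d \<subseteq> Poly_Mapping.keys d"
    by (auto simp: in_keys_iff lookup_map_zero 0)
  have "Poly_Mapping.map \<phi> c = (\<Sum>\<sigma>\<in>Poly_Mapping.keys d. rc_scale (\<phi> (Poly_Mapping.lookup d \<sigma>))
      (real_of_chain (chain_boundary (Suc p) (frag_of \<sigma>))))"
    by (simp add: d(2) real_boundary_eq_extend rc_extend_def map_coeffs_sum[of \<phi>, OF add] map_coeffs_scale[OF 0 integral_chain_real_of_chain add])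
  also have "\<dots> = real_boundary (Suc p) ?d"
    using keys by (subst real_boundary_eq_extend, simp)
      (subst rc_extend_superset[of "Poly_Mapping.keys d"], auto simp: lookup_map_zero 0)
  finally show ?thesis
    using keys d(1) by (auto simp: real_boundaries_def real_chains_def)
qed

text \<open>The retraction fixes \<open>c0\<close>, because it fixes 1, and makes the other
  coefficients rational. Since coordinates in a basis are unique, integral cycles will have rational
  coordinates in a basis of integral cycles.\<close>

lemma rational_relation:
  fixes X :: "'a topology"
  assumes "finite I" "\<And>i. i \<in> I \<Longrightarrow> integral_chain (c i)" "integral_chain c0"
    and "c0 - (\<Sum>i\<in>I. rc_scale (r i) (c i)) \<in> real_boundaries p X"
  shows "\<exists>s. (\<forall>i. s i \<in> \<rat>) \<and> c0 - (\<Sum>i\<in>I. rc_scale (s i) (c i)) \<in> real_boundaries p X"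
proof -
  obtain \<phi> :: "real \<Rightarrow> real" where add: "\<And>x y. \<phi> (x + y) = \<phi> x + \<phi> y" and rat: "\<And>x. \<phi> x \<in> \<rat>" and 1: "\<phi> 1 = 1"
    using rational_retraction_exists by blast
  have 0: "\<phi> 0 = 0" by (rule additive_of_int_mult(2)[OF add])
  let ?m = "Poly_Mapping.map \<phi>"
  have "?m c0 = c0" using map_coeffs_scale[OF 0 assms(3) add, of 1] 1 by simp
  moreover have "?m (\<Sum>i\<in>I. rc_scale (r i) (c i)) = (\<Sum>i\<in>I. rc_scale (\<phi> (r i)) (c i))"
    unfolding map_coeffs_sum[of \<phi>, OF add]
    by (rule sum.cong[OF refl]) (rule map_coeffs_scale[OF 0 assms(2) add])
  moreover have "?m (a - b) = ?m a - ?m b" for a b :: "'a real_chain"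
  proof (rule poly_mapping_eqI)
    fix x
    have "\<phi> (s - t) = \<phi> s - \<phi> t" for s t using add[of "s - t" t] by simp
    then show "Poly_Mapping.lookup (?m (a - b)) x = Poly_Mapping.lookup (?m a - ?m b) x"
      by (simp add: lookup_map_zero 0 lookup_minus)
  qed
  moreover have "?m (c0 - (\<Sum>i\<in>I. rc_scale (r i) (c i))) \<in> real_boundaries p X"
    by (rule map_coeffs_boundaries[of \<phi>, OF add assms(4)])
  ultimately have "c0 - (\<Sum>i\<in>I. rc_scale (\<phi> (r i)) (c i)) \<in> real_boundaries p X"
    by simp
  then show ?thesis using rat by (intro exI[of _ "\<lambda>i. \<phi> (r i)"]) simp
qed

subsection \<open>Local contractibility\<close>

text \<open>The strong form, a basis of open sets each contractible in itself: paths can then be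
  joined, and cycles filled, within one and the same small set.\<close>

definition locally_contractible_space :: "'a topology \<Rightarrow> bool" where
  "locally_contractible_space X \<longleftrightarrow> (\<forall>U x. openin X U \<and> x \<in> U \<longrightarrow>
     (\<exists>W. openin X W \<and> x \<in> W \<and> W \<subseteq> U \<and> contractible_space (subtopology X W)))"

lemma contractible_space_convex_functions:
  fixes W :: "('i \<Rightarrow> real) set"
  assumes "a \<in> W"
    and "\<And>x t. x \<in> W \<Longrightarrow> 0 \<le> t \<Longrightarrow> t \<le> 1 \<Longrightarrow> (\<lambda>i. (1 - t) * x i + t * a i) \<in> W"
  shows "contractible_space (subtopology (powertop_real UNIV) W)"
proof -
  let ?X = "subtopology (powertop_real UNIV) W"
  let ?h = "\<lambda>z i. (1 - fst z) * snd z i + fst z * a i"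
  have snd: "continuous_map (prod_topology (top_of_set {0..1::real}) ?X) euclideanreal (\<lambda>z. snd z i)" for i
  proof -
    have "continuous_map ?X euclideanreal (\<lambda>x. x i)"
      by (rule continuous_map_from_subtopology) (rule continuous_map_product_projection, simp)
    from continuous_map_compose[OF continuous_map_snd this] show ?thesis by (simp add: comp_def)
  qed
  have fst: "continuous_map (prod_topology (top_of_set {0..1::real}) ?X) euclideanreal fst"
    using continuous_map_fst by (rule continuous_map_into_fulltopology)
  have "continuous_map (prod_topology (top_of_set {0..1::real}) ?X) ?X ?h"
    unfolding continuous_map_in_subtopology continuous_map_componentwise_UNIV
    using assms(2) by (auto intro!: continuous_intros fst snd)
  then show ?thesis
    unfolding contractible_space_def homotopic_with_def
    by (intro exI[of _ a] exI[of _ ?h]) auto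
qed

text \<open>\<open>Euclidean_space m\<close> is a subspace of a product of lines. A basic open box
  around \<open>a\<close> is shrunk factor by factor to a convex one, which contracts to
  \<open>a\<close> along segments.\<close>

lemma locally_contractible_Euclidean_space: "locally_contractible_space (Euclidean_space m)"
  unfolding locally_contractible_space_def
proof (intro allI impI, elim conjE)
  fix V :: "(nat \<Rightarrow> real) set" and a assume V: "openin (Euclidean_space m) V" and a: "a \<in> V"
  let ?E = "{x :: nat \<Rightarrow> real. \<forall>i\<ge>m. x i = 0}"
  obtain T where T: "openin (powertop_real UNIV) T" "V = T \<inter> ?E"
    using V by (auto simp: Euclidean_space_def openin_subtopology)
  obtain B where B: "finite {i. B i \<noteq> (UNIV :: real set)}" "\<And>i. open (B i)" "a \<in> Pi\<^sub>E UNIV B" "Pi\<^sub>E UNIV B \<subseteq> T"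
    using T(1) a T(2) unfolding openin_product_topology_alt by (force simp: topspace_euclidean)
  \<comment> \<open>Factors that are the whole line are kept, since an open box may have only
    finitely many proper factors.\<close>
  have "\<exists>I. open I \<and> convex I \<and> a i \<in> I \<and> I \<subseteq> B i \<and> (B i = UNIV \<longrightarrow> I = UNIV)" for i
  proof (cases "B i = UNIV")
    case False
    have "a i \<in> B i" using B(3) by (auto simp: PiE_iff)
    then obtain e where "e > 0" "ball (a i) e \<subseteq> B i"
      using B(2)[of i] by (auto simp: open_contains_ball)
    then show ?thesis using False by (intro exI[of _ "ball (a i) e"]) auto
  qed auto
  then obtain I where I: "\<And>i. open (I i)" "\<And>i. convex (I i)" "\<And>i. a i \<in> I i" "\<And>i. I i \<subseteq> B i"
    "\<And>i. B i = UNIV \<Longrightarrow> I i = UNIV" by metis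
  define W where "W = Pi\<^sub>E UNIV I \<inter> ?E"
  have "openin (powertop_real UNIV) (Pi\<^sub>E UNIV I)"
    by (intro product_topology_basis)
      (use I B(1) in \<open>auto simp: topspace_euclidean intro: rev_finite_subset\<close>)
  then have oW: "openin (Euclidean_space m) W"
    unfolding W_def Euclidean_space_def openin_subtopology by blast
  have aW: "a \<in> W" using a T(2) I(3) by (auto simp: W_def PiE_iff)
  have "contractible_space (subtopology (powertop_real UNIV) W)"
  proof (rule contractible_space_convex_functions[OF aW])
    fix x and t :: real assume x: "x \<in> W" and t: "0 \<le> t" "t \<le> 1"
    have "(1 - t) * x i + t * a i \<in> I i" for i
      using convexD[OF I(2)[of i], of "x i" "a i" "1 - t" t] x t I(3)[of i]
      by (auto simp: W_def PiE_iff)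
    then show "(\<lambda>i. (1 - t) * x i + t * a i) \<in> W"
      using x aW by (auto simp: W_def PiE_iff)
  qed
  moreover have "subtopology (Euclidean_space m) W = subtopology (powertop_real UNIV) W"
    by (simp add: Euclidean_space_def subtopology_subtopology W_def Int_assoc Int_commute Int_left_commute)
  moreover have "W \<subseteq> V" using I(4) B(4) T(2) by (force simp: W_def PiE_iff)
  ultimately show "\<exists>W. openin (Euclidean_space m) W \<and> a \<in> W \<and> W \<subseteq> V \<and> contractible_space (subtopology (Euclidean_space m) W)"
    using oW aW by auto
qed

text \<open>A chart carries \<open>U \<inter> U\<^sub>0\<close> to an open set of the model space. A
  contractible neighbourhood found there is pulled back; openness survives both ways because
  \<open>U\<close> and \<open>V\<close> are open.\<close>

lemma compact_manifold_locally_contractible: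
  assumes "compact_manifold m X"
  shows "locally_contractible_space X"
  unfolding locally_contractible_space_def
proof (intro allI impI, elim conjE)
  fix U\<^sub>0 x assume U0: "openin X U\<^sub>0" and x: "x \<in> U\<^sub>0"
  let ?E = "Euclidean_space m"
  have "x \<in> topspace X" using openin_subset[OF U0] x by blast
  then obtain U V where U: "openin X U" "x \<in> U" and V: "openin ?E V"
    and "subtopology X U homeomorphic_space subtopology ?E V"
    using assms unfolding compact_manifold_def by blast
  then obtain \<phi> where \<phi>: "homeomorphic_map (subtopology X U) (subtopology ?E V) \<phi>"
    by (auto simp: homeomorphic_space)
  have UX: "U \<subseteq> topspace X" and VE: "V \<subseteq> topspace ?E"
    using U(1) V openin_subset by blast+
  have "openin (subtopology X U) (U \<inter> U\<^sub>0)"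
    using U0 by (simp add: openin_subtopology_Int2)
  then have "openin (subtopology ?E V) (\<phi> ` (U \<inter> U\<^sub>0))"
    using homeomorphic_imp_open_map[OF \<phi>] by (auto simp: open_map_def)
  then have o: "openin ?E (\<phi> ` (U \<inter> U\<^sub>0))"
    using V openin_trans_full by blast
  obtain W' where W': "openin ?E W'" "\<phi> x \<in> W'" "W' \<subseteq> \<phi> ` (U \<inter> U\<^sub>0)" "contractible_space (subtopology ?E W')"
    using locally_contractible_Euclidean_space[of m] o U(2) x
    unfolding locally_contractible_space_def by (metis IntI imageI)
  define W where "W = {y \<in> topspace (subtopology X U). \<phi> y \<in> W'}"
  have im: "\<phi> ` U = V"
    using homeomorphic_imp_surjective_map[OF \<phi>] UX VE by (simp add: inf.absorb2)
  have inj: "inj_on \<phi> U"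
    using homeomorphic_imp_injective_map[OF \<phi>] UX by (simp add: inf.absorb2)
  have W'V: "W' \<subseteq> V" using W'(3) im by blast
  have oW': "openin (subtopology ?E V) W'"
    using W'(1) W'V by (metis inf.absorb1 openin_subtopology_Int)
  have "openin (subtopology X U) W"
    unfolding W_def
    by (rule openin_continuous_map_preimage[OF homeomorphic_imp_continuous_map[OF \<phi>] oW'])
  then have oW: "openin X W" using U(1) openin_trans_full by blast
  have WU: "W \<subseteq> U" by (auto simp: W_def)
  have WU0: "W \<subseteq> U\<^sub>0"
    using W'(3) inj WU by (auto simp: W_def inj_on_def)
  have "\<phi> ` W = W'"
    using W'V im UX by (auto simp: W_def)
  then have "homeomorphic_map (subtopology (subtopology X U) W) (subtopology (subtopology ?E V) W') \<phi>"
    using WU W'V UX VE im by (intro homeomorphic_map_subtopologies[OF \<phi>]) (auto simp: inf.absorb2 Int_absorb1)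
  then have "subtopology X W homeomorphic_space subtopology ?E W'"
    using WU W'V by (metis homeomorphic_map_imp_homeomorphic_space inf.absorb2 subtopology_subtopology)
  then have "contractible_space (subtopology X W)"
    using W'(4) homeomorphic_space_contractibility by blast
  then show "\<exists>W. openin X W \<and> x \<in> W \<and> W \<subseteq> U\<^sub>0 \<and> contractible_space (subtopology X W)"
    using oW WU0 U(2) W'(2) UX x by (intro exI[of _ W]) (auto simp: W_def)
qed

subsection \<open>Singular one-chains\<close>

text \<open>The contraction makes a cycle homologous to its image under a constant map, and in
  positive degree every cycle of a one-point space bounds.\<close>

lemma contractible_cycle_boundary:
  assumes "contractible_space X" "singular_relcycle 1 X {} c"
  shows "singular_relboundary 1 X {} c"
proof -
  obtain a where "homotopic_with (\<lambda>x. True) X X id (\<lambda>x. a)"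
    using assms(1) by (auto simp: contractible_space_def)
  then have hom: "homotopic_with (\<lambda>h. h \<in> {} \<rightarrow> {}) X X id (\<lambda>x. a)"
    by simp
  have c: "singular_chain 1 X c" using assms(2) by (simp add: singular_cycle)
  have "homologous_rel 1 X {} (chain_map 1 id c) (chain_map 1 (\<lambda>x. a) c)"
    by (rule homotopic_imp_homologous_rel_chain_maps[OF hom assms(2)])
  then have 1: "singular_relboundary 1 X {} (c - chain_map 1 (\<lambda>x. a) c)"
    unfolding homologous_rel_def chain_map_ident[OF c] .
  have "singular_relboundary 1 X {} (chain_map 1 (\<lambda>x. a) c)"
  \<comment> \<open>In an empty space the centre \<open>a\<close> of the contraction need not be a
    point of \<open>X\<close>.\<close>
  proof (cases "topspace X = {}")
    case True
    then have "c = 0" using c by (simp add: singular_chain_empty)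
    then show ?thesis by simp
  next
    case False
    have cont: "continuous_map X X (\<lambda>x. a)" using homotopic_with_imp_continuous_maps[OF hom] by simp
    then have a: "a \<in> topspace X" using False by (auto simp: continuous_map_def)
    have "continuous_map X (subtopology X {a}) (\<lambda>x. a)"
      using cont by (auto simp: continuous_map_in_subtopology)
    then have "singular_relcycle 1 (subtopology X {a}) {} (chain_map 1 (\<lambda>x. a) c)"
      using assms(2) by (intro singular_relcycle_chain_map) auto
    moreover have "topspace (subtopology X {a}) = {a}" using a by auto
    ultimately have "singular_relboundary 1 (subtopology X {a}) {} (chain_map 1 (\<lambda>x. a) c)"
      by (simp add: singular_boundary_eq_cycle_singleton)
    then have "singular_relboundary 1 (subtopology X UNIV) {} (chain_map 1 (\<lambda>x. a) c)"
      by (rule singular_boundary_mono[rotated]) simp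
    then show ?thesis by simp
  qed
  from singular_relboundary_add[OF 1 this] show ?thesis by simp
qed

text \<open>Local contractibility enters the homology of \<open>X\<close> in this form: a cycle
  inside a small set bounds in the whole space.\<close>

lemma contractible_subset_cycle_boundary:
  assumes "contractible_space (subtopology X W)" "singular_chain 1 (subtopology X W) c" "chain_boundary 1 c = 0"
  shows "real_of_chain c \<in> real_boundaries 1 X"
proof -
  have "singular_relboundary 1 (subtopology X W) {} c"
    using assms by (intro contractible_cycle_boundary) (auto simp: singular_cycle)
  then have "singular_relboundary 1 (subtopology X UNIV) {} c"
    by (rule singular_boundary_mono[rotated]) simp
  then show ?thesis by (simp add: real_of_chain_real_boundaries)
qed

definition point_simplex :: "'a \<Rightarrow> (nat \<Rightarrow> real) \<Rightarrow> 'a" where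
  "point_simplex x = restrict (\<lambda>_. x) (standard_simplex 0)"

definition simplex_vertex :: "nat \<Rightarrow> nat \<Rightarrow> real" where
  "simplex_vertex k = (\<lambda>i. if i = k then 1 else 0)"

definition source :: "((nat \<Rightarrow> real) \<Rightarrow> 'a) \<Rightarrow> 'a" where "source \<sigma> = \<sigma> (simplex_vertex 0)"

definition target :: "((nat \<Rightarrow> real) \<Rightarrow> 'a) \<Rightarrow> 'a" where "target \<sigma> = \<sigma> (simplex_vertex 1)"

lemma simplex_vertex_in: "k \<le> p \<Longrightarrow> simplex_vertex k \<in> standard_simplex p"
  by (auto simp: simplex_vertex_def)

text \<open>Face \<open>k\<close> omits vertex \<open>k\<close> and thus sits at vertex
  \<open>1 - k\<close>; so the target carries the positive sign.\<close>

lemma chain_boundary_1: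
  "chain_boundary 1 (frag_of \<sigma>) = frag_of (point_simplex (target \<sigma>)) - frag_of (point_simplex (source \<sigma>))"
proof -
  have "singular_face 1 k \<sigma> = point_simplex (\<sigma> (simplex_vertex (1 - k)))" if "k \<le> 1" for k
  proof
    fix z
    show "singular_face 1 k \<sigma> z = point_simplex (\<sigma> (simplex_vertex (1 - k))) z"
    proof (cases "z \<in> standard_simplex 0")
      case True
      then have z: "z = (\<lambda>j. if j = 0 then 1 else 0)" by (simp add: standard_simplex_0)
      have "k = 0 \<or> k = 1" using that by linarith
      then have "simplical_face k z = simplex_vertex (1 - k)"
        unfolding z by (auto simp: simplical_face_def simplex_vertex_def fun_eq_iff)
      then show ?thesis using True by (simp add: singular_face_def point_simplex_def)
    qed (simp add: singular_face_def point_simplex_def)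
  qed
  moreover have "{..1::nat} = {0, 1}" by auto
  ultimately show ?thesis
    by (simp add: chain_boundary_of source_def target_def del: One_nat_def)
qed

definition path_simplex :: "(real \<Rightarrow> 'a) \<Rightarrow> (nat \<Rightarrow> real) \<Rightarrow> 'a" where
  "path_simplex g = restrict (\<lambda>z. g (z 1)) (standard_simplex 1)"

lemma source_target_path_simplex [simp]: "source (path_simplex g) = g 0" "target (path_simplex g) = g 1"
  using simplex_vertex_in[of 0 1] simplex_vertex_in[of 1 1]
  by (auto simp: source_def target_def path_simplex_def) (auto simp: simplex_vertex_def)

lemma standard_simplex_1_image: "(\<lambda>z. z 1) ` standard_simplex 1 \<subseteq> {0..1}"
  by (auto simp: standard_simplex_def)

lemma singular_simplex_path_simplex:
  assumes "pathin X g"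
  shows "singular_simplex 1 X (path_simplex g)"
proof -
  have "continuous_map (subtopology (powertop_real UNIV) (standard_simplex 1)) (top_of_set {0..1}) (\<lambda>z. z 1)"
    using standard_simplex_1_image
    by (auto simp: continuous_map_in_subtopology intro!: continuous_map_from_subtopology continuous_map_product_projection)
  from continuous_map_compose[OF this assms[unfolded pathin_def]] show ?thesis
    by (auto simp: singular_simplex_def path_simplex_def comp_def intro: continuous_map_eq)
qed

text \<open>The point with barycentric coordinates \<open>1 - t\<close> and \<open>t\<close> is
  taken at time \<open>t\<close>. Thus any singular 1-simplex may be subdivided as a path.\<close>

lemma singular_simplex_eq_path_simplex:
  assumes "singular_simplex 1 X \<sigma>"
  obtains g where "pathin X g" "\<sigma> = path_simplex g"
proof
  let ?l = "\<lambda>t (i::nat). if i = 0 then 1 - t else if i = 1 then t else (0::real)"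
  let ?g = "\<lambda>t. \<sigma> (?l t)"
  have "continuous_map (top_of_set {0..1}) euclideanreal (\<lambda>t. ?l t k)" for k :: nat
    by (cases "k = 0"; cases "k = 1") (auto intro!: continuous_intros)
  then have "continuous_map (top_of_set {0..1}) (powertop_real UNIV) ?l"
    unfolding continuous_map_componentwise_UNIV by blast
  moreover have "?l t \<in> standard_simplex 1" if "t \<in> {0..1}" for t
    using that by (auto simp: standard_simplex_def)
  ultimately have "continuous_map (top_of_set {0..1}) (subtopology (powertop_real UNIV) (standard_simplex 1)) ?l"
    by (auto simp: continuous_map_in_subtopology)
  moreover have "continuous_map (subtopology (powertop_real UNIV) (standard_simplex 1)) X \<sigma>"
    using assms by (simp add: singular_simplex_def)
  ultimately show "pathin X ?g"
    unfolding pathin_def by (rule continuous_map_compose[unfolded comp_def])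
  show "\<sigma> = path_simplex ?g"
  proof
    fix z
    show "\<sigma> z = path_simplex ?g z"
    proof (cases "z \<in> standard_simplex 1")
      case True
      then have "z i = ?l (z 1) i" for i by (auto simp: standard_simplex_def)
      then have "z = ?l (z 1)" by blast
      then show ?thesis using True by (simp add: path_simplex_def)
    qed (use assms in \<open>auto simp: path_simplex_def singular_simplex_def extensional_def\<close>)
  qed
qed

lemma simplex_map_path_simplex: "simplex_map 1 f (path_simplex g) = path_simplex (f \<circ> g)"
  by (auto simp: simplex_map_def path_simplex_def)

text \<open>It suffices to treat the identity path of the unit interval: there the identity minus
  its pieces is a cycle, by telescoping, and it bounds because the interval is contractible. The
  general case is its image under \<open>g\<close>.\<close>

lemma path_subdivision_boundary:
  fixes N :: nat
  assumes g: "pathin X g" and N: "N > 0"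
  shows "real_of_chain (frag_of (path_simplex g)
    - (\<Sum>j<N. frag_of (path_simplex (\<lambda>t. g ((real j + t) / real N))))) \<in> real_boundaries 1 X"
proof -
  let ?I = "top_of_set {0..1::real}"
  let ?p = "\<lambda>j t. (real j + t) / real N"
  let ?c = "frag_of (path_simplex id) - (\<Sum>j<N. frag_of (path_simplex (?p j)))"
  have "pathin ?I (?p j)" if "j < N" for j
  proof -
    have "0 \<le> ?p j t \<and> ?p j t \<le> 1" if "0 \<le> t" "t \<le> 1" for t
    proof -
      have "real j + t \<le> real N" using \<open>j < N\<close> that by linarith
      then show ?thesis using N that by simp
    qed
    then show ?thesis
      using N by (auto simp: pathin_def intro!: continuous_intros)
  qed
  moreover have "pathin ?I id" by (auto simp: pathin_def)
  ultimately have ch: "singular_chain 1 ?I ?c"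
    by (intro singular_chain_diff singular_chain_sum) (auto simp: singular_chain_of simp del: One_nat_def intro: singular_simplex_path_simplex)
  have tele: "(\<Sum>j<n. frag_of (point_simplex (real (Suc j) / real N)) - frag_of (point_simplex (real j / real N)))
      = frag_of (point_simplex (real n / real N)) - frag_of (point_simplex 0)" for n
    by (induction n) auto
  have "chain_boundary 1 ?c = 0"
    using tele[of N] N by (simp add: chain_boundary_diff chain_boundary_sum comp_def chain_boundary_1 add.commute del: One_nat_def)
  then have "singular_relboundary 1 ?I {} ?c"
    using ch by (intro contractible_cycle_boundary) (auto simp: singular_cycle convex_imp_contractible)
  then have "singular_relboundary 1 X {} (chain_map 1 g ?c)"
    by (rule singular_relboundary_chain_map) (use g in \<open>auto simp: pathin_def\<close>)
  moreover have "chain_map 1 g ?c = frag_of (path_simplex g) - (\<Sum>j<N. frag_of (path_simplex (\<lambda>t. g (?p j t))))"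
    by (simp add: chain_map_diff chain_map_sum simplex_map_path_simplex comp_def del: One_nat_def)
  ultimately show ?thesis by (metis real_of_chain_real_boundaries)
qed

text \<open>A Lebesgue number for the preimages of the sets \<open>G\<close> gives the mesh. The
  relation \<open>R\<close> is arbitrary, so that closeness can later be measured along several
  iterates of \<open>f\<close> at once.\<close>

lemma path_fine_subdivision:
  assumes g: "pathin X g"
    and R: "\<And>x. x \<in> topspace X \<Longrightarrow> \<exists>G. openin X G \<and> x \<in> G \<and> (\<forall>y\<in>G. \<forall>z\<in>G. R y z)"
  shows "\<exists>N>0::nat. \<forall>j<N. \<forall>s\<in>{0..1}. \<forall>t\<in>{0..1}. R (g ((real j + s) / real N)) (g ((real j + t) / real N))"
proof -
  have gX: "g t \<in> topspace X" if "t \<in> {0..1}" for t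
    using g that by (auto simp: pathin_def continuous_map_def)
  define C where "C = {B. open B \<and> (\<forall>s\<in>B \<inter> {0..1}. \<forall>t\<in>B \<inter> {0..1}. R (g s) (g t))}"
  have cover: "{0..1} \<subseteq> \<Union>C"
  proof
    fix s :: real assume s: "s \<in> {0..1}"
    obtain G where G: "openin X G" "g s \<in> G" "\<forall>y\<in>G. \<forall>z\<in>G. R y z"
      using R[OF gX[OF s]] by blast
    have "openin (top_of_set {0..1}) {t \<in> topspace (top_of_set {0..1}). g t \<in> G}"
      by (rule openin_continuous_map_preimage[OF g[unfolded pathin_def] G(1)])
    then obtain B where "open B" "{t \<in> {0..1}. g t \<in> G} = B \<inter> {0..1}"
      by (auto simp: openin_subtopology)
    then show "s \<in> \<Union>C" using s G by (intro UnionI[of B]) (auto simp: C_def)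
  qed
  then have "C \<noteq> {}" by fastforce
  obtain \<delta> where \<delta>: "\<delta> > 0" "\<And>T. T \<subseteq> {0..1} \<Longrightarrow> diameter T < \<delta> \<Longrightarrow> \<exists>B\<in>C. T \<subseteq> B"
    using Lebesgue_number_lemma[OF compact_Icc \<open>C \<noteq> {}\<close> cover] by (auto simp: C_def)
  obtain N :: nat where N: "N > 0" "1 / real N < \<delta>"
    using \<delta>(1) by (metis inverse_eq_divide reals_Archimedean zero_less_Suc)
  have "R (g ((real j + s) / real N)) (g ((real j + t) / real N))"
    if "j < N" "s \<in> {0..1}" "t \<in> {0..1}" for j s t
  proof -
    let ?T = "{real j / real N .. (real j + 1) / real N}"
    have "diameter ?T < \<delta>"
      using N by (simp add: diameter_closed_interval divide_simps)
    moreover have "?T \<subseteq> {0..1}" using N \<open>j < N\<close> by (auto simp: divide_simps)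
    ultimately obtain B where "B \<in> C" "?T \<subseteq> B" using \<delta>(2) by blast
    moreover have "(real j + s) / real N \<in> ?T" "(real j + t) / real N \<in> ?T"
      using that N by (auto simp: divide_simps)
    ultimately have "(real j + s) / real N \<in> B \<inter> {0..1}" "(real j + t) / real N \<in> B \<inter> {0..1}"
      using \<open>?T \<subseteq> {0..1}\<close> by blast+
    then show ?thesis using \<open>B \<in> C\<close> by (auto simp: C_def)
  qed
  then show ?thesis using N by blast
qed

subsection \<open>Short edges in a compact locally contractible metric space\<close>

definition vertex_chain :: "'a \<Rightarrow> 'a real_chain" where
  "vertex_chain x = Poly_Mapping.single (point_simplex x) 1"

lemma real_boundary_1_single:
  "real_boundary 1 (Poly_Mapping.single \<sigma> 1) = vertex_chain (target \<sigma>) - vertex_chain (source \<sigma>)"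
  by (subst real_boundary_single, simp)
    (simp only: chain_boundary_1 real_of_chain_linear vertex_chain_def real_of_chain_frag_of)

locale lc_system = Metric_space M d for M :: "'a set" and d +
  fixes f :: "'a \<Rightarrow> 'a"
  assumes compact: "compact_space mtopology"
    and lc: "locally_contractible_space mtopology"
    and cont: "continuous_map mtopology mtopology f"
begin

lemma f_M: "x \<in> M \<Longrightarrow> f x \<in> M"
  using cont by (auto simp: continuous_map_def)

text \<open>Balls of half the admissible radius cover \<open>M\<close>. Finitely many of them
  suffice, and by the triangle inequality the least of their radii works everywhere.\<close>

lemma Lebesgue_number:
  assumes "\<And>x. x \<in> M \<Longrightarrow> \<exists>U. openin mtopology U \<and> x \<in> U \<and> P U"
  obtains r where "r > 0" "\<And>x. x \<in> M \<Longrightarrow> \<exists>U. P U \<and> mball x r \<subseteq> U"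
proof -
  have "\<exists>U s. P U \<and> s > 0 \<and> mball x (2 * s) \<subseteq> U" if x: "x \<in> M" for x
  proof -
    obtain U where U: "openin mtopology U" "x \<in> U" "P U" using assms[OF x] by blast
    then obtain s where "s > 0" "mball x s \<subseteq> U" by (auto simp: openin_mtopology)
    then show ?thesis using U by (intro exI[of _ U] exI[of _ "s / 2"]) auto
  qed
  then obtain U s where Us: "\<And>x. x \<in> M \<Longrightarrow> P (U x)" "\<And>x. x \<in> M \<Longrightarrow> s x > 0"
    "\<And>x. x \<in> M \<Longrightarrow> mball x (2 * s x) \<subseteq> U x" by metis
  have "compactin mtopology M" using compact by (simp add: compact_space_def)
  moreover have "M \<subseteq> \<Union>((\<lambda>x. mball x (s x)) ` M)" using Us(2) by (auto intro!: bexI)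
  ultimately obtain \<F> where F: "finite \<F>" "\<F> \<subseteq> (\<lambda>x. mball x (s x)) ` M" "M \<subseteq> \<Union>\<F>"
    unfolding compactin_def by (metis (no_types, lifting) imageE openin_mball)
  then obtain A where A: "finite A" "A \<subseteq> M" "\<F> = (\<lambda>x. mball x (s x)) ` A"
    by (meson finite_subset_image)
  \<comment> \<open>The element 1 keeps the minimum defined when \<open>M\<close> is empty.\<close>
  define r where "r = Min (insert 1 (s ` A))"
  have "r > 0" using A Us(2) by (auto simp: r_def)
  moreover have "\<exists>V. P V \<and> mball x r \<subseteq> V" if x: "x \<in> M" for x
  proof -
    obtain y where y: "y \<in> A" "x \<in> mball y (s y)" using F(3) A(3) x by auto
    have "r \<le> s y" using y A by (auto simp: r_def)
    have "mball x r \<subseteq> mball y (2 * s y)"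
    proof
      fix z assume z: "z \<in> mball x r"
      then have "d y z \<le> d y x + d x z" using y by (auto intro: triangle)
      also have "\<dots> < s y + s y" using z y \<open>r \<le> s y\<close> by auto
      finally show "z \<in> mball y (2 * s y)" using z y by auto
    qed
    then show ?thesis using Us y A by blast
  qed
  ultimately show ?thesis using that by blast
qed

text \<open>What the later argument needs of local contractibility: below the scale
  \<open>\<eta>\<close> two points determine a chain, additively on triangles and compatibly with
  \<open>f\<close>, always up to boundaries. In the last clause \<open>R\<close> is any relation
  that contains a neighbourhood of the diagonal and forces \<open>d y z < \<eta>\<close>; every
  simplex is homologous to a chain of edges between points related by \<open>R\<close>.\<close>

definition edge_system :: "real \<Rightarrow> ('a \<Rightarrow> 'a \<Rightarrow> 'a real_chain) \<Rightarrow> bool" where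
  "edge_system \<eta> E \<longleftrightarrow> \<eta> > 0 \<and>
    (\<forall>x\<in>M. \<forall>y\<in>M. d x y < \<eta> \<longrightarrow> E x y \<in> real_chains 1 mtopology \<and> integral_chain (E x y) \<and>
       real_boundary 1 (E x y) = vertex_chain y - vertex_chain x) \<and>
    (\<forall>x\<in>M. \<forall>y\<in>M. \<forall>z\<in>M. d x y < \<eta> \<and> d y z < \<eta> \<and> d x z < \<eta> \<longrightarrow>
       E x y + E y z - E x z \<in> real_boundaries 1 mtopology) \<and>
    (\<forall>x\<in>M. \<forall>y\<in>M. d x y < \<eta> \<and> d (f x) (f y) < \<eta> \<longrightarrow>
       real_chain_map 1 f (E x y) - E (f x) (f y) \<in> real_boundaries 1 mtopology) \<and>
    (\<forall>\<sigma> R. singular_simplex 1 mtopology \<sigma> \<and>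
       (\<forall>x\<in>M. \<exists>G. openin mtopology G \<and> x \<in> G \<and> (\<forall>y\<in>G. \<forall>z\<in>G. R y z)) \<and>
       (\<forall>y\<in>M. \<forall>z\<in>M. R y z \<longrightarrow> d y z < \<eta>) \<longrightarrow>
       (\<exists>N p. p 0 = source \<sigma> \<and> p N = target \<sigma> \<and> (\<forall>j\<le>N. p j \<in> M) \<and> (\<forall>j<N. R (p j) (p (Suc j))) \<and>
         Poly_Mapping.single \<sigma> 1 - (\<Sum>j<N. E (p j) (p (Suc j))) \<in> real_boundaries 1 mtopology))"

text \<open>Nested scales: \<open>r0\<close>-balls lie in contractible sets, \<open>f\<close> maps
  \<open>r1\<close>-balls into \<open>r0\<close>-balls, and points closer than \<open>r2\<close> are
  joined within a set of small diameter. Every relation in the definition then concerns a cycle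
  inside an \<open>r0\<close>-ball.\<close>

theorem edge_system_exists: "\<exists>\<eta> E. edge_system \<eta> E"
proof -
  have "\<exists>U. openin mtopology U \<and> x \<in> U \<and> contractible_space (subtopology mtopology U)" if x: "x \<in> M" for x
  proof -
    have "openin mtopology M \<and> x \<in> M" using x by simp
    then show ?thesis using lc unfolding locally_contractible_space_def by blast
  qed
  then obtain r0 where r0: "r0 > 0"
    "\<And>x. x \<in> M \<Longrightarrow> \<exists>U. contractible_space (subtopology mtopology U) \<and> mball x r0 \<subseteq> U"
    by (rule Lebesgue_number[where P = "\<lambda>U. contractible_space (subtopology mtopology U)"]) auto
  have "\<exists>U. openin mtopology U \<and> x \<in> U \<and> (\<forall>y\<in>U. \<forall>z\<in>U. d (f y) (f z) < r0)" if x: "x \<in> M" for x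
  proof (intro exI conjI ballI)
    let ?U = "{y \<in> topspace mtopology. f y \<in> mball (f x) (r0 / 2)}"
    show "openin mtopology ?U" by (rule openin_continuous_map_preimage[OF cont openin_mball])
    show "x \<in> ?U" using x f_M r0 by auto
    fix y z assume yz: "y \<in> ?U" "z \<in> ?U"
    have "d (f y) (f z) \<le> d (f y) (f x) + d (f x) (f z)" using yz x f_M by (auto intro!: triangle)
    then show "d (f y) (f z) < r0" using yz commute[of "f x" "f y"] by auto
  qed
  then obtain r1 where r1: "r1 > 0"
    "\<And>x. x \<in> M \<Longrightarrow> \<exists>U. (\<forall>y\<in>U. \<forall>z\<in>U. d (f y) (f z) < r0) \<and> mball x r1 \<subseteq> U"
    by (rule Lebesgue_number[where P = "\<lambda>U. \<forall>y\<in>U. \<forall>z\<in>U. d (f y) (f z) < r0"]) auto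
  have f_ball: "f y \<in> mball (f x) r0" if y: "y \<in> mball x r1" for x y
  proof -
    obtain U where U: "\<forall>y\<in>U. \<forall>z\<in>U. d (f y) (f z) < r0" "mball x r1 \<subseteq> U" using r1(2)[of x] y by auto
    have "x \<in> mball x r1" using y r1(1) by auto
    then have "d (f x) (f y) < r0" using U y by blast
    then show ?thesis using y f_M by auto
  qed
  \<comment> \<open>Edges will stay within \<open>\<rho>\<close> of their source. A quarter leaves
    room: two consecutive edges from \<open>x\<close> remain in the \<open>r0\<close>-ball around
    \<open>x\<close>, and a single edge remains in the \<open>r1\<close>-ball, whose image under
    \<open>f\<close> is controlled.\<close>
  define \<rho> where "\<rho> = min r0 r1 / 4"
  have \<rho>: "\<rho> > 0" "4 * \<rho> \<le> r0" "4 * \<rho> \<le> r1" using r0(1) r1(1) by (auto simp: \<rho>_def)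
  have "\<exists>U. openin mtopology U \<and> x \<in> U \<and> contractible_space (subtopology mtopology U) \<and>
      (\<forall>y\<in>U. \<forall>z\<in>U. d y z < \<rho>)" if x: "x \<in> M" for x
  proof -
    obtain U where U: "openin mtopology U" "x \<in> U" "U \<subseteq> mball x (\<rho> / 2)" "contractible_space (subtopology mtopology U)"
      using lc x \<rho> unfolding locally_contractible_space_def by (metis centre_in_mball_iff half_gt_zero openin_mball)
    have "d y z < \<rho>" if "y \<in> U" "z \<in> U" for y z
    proof -
      have "y \<in> mball x (\<rho> / 2)" "z \<in> mball x (\<rho> / 2)" using U(3) that by auto
      then show ?thesis using triangle[of y x z] commute[of x y] by auto
    qed
    then show ?thesis using U by blast
  qed
  then obtain r2 where r2: "r2 > 0" "\<And>x. x \<in> M \<Longrightarrow> \<exists>U. (contractible_space (subtopology mtopology U) \<and>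
      (\<forall>y\<in>U. \<forall>z\<in>U. d y z < \<rho>)) \<and> mball x r2 \<subseteq> U"
    by (rule Lebesgue_number[where P = "\<lambda>U. contractible_space (subtopology mtopology U) \<and> (\<forall>y\<in>U. \<forall>z\<in>U. d y z < \<rho>)"]) auto
  \<comment> \<open>The bound by \<open>r2\<close> gives short connecting paths; the bound by
    \<open>\<rho>\<close> keeps the second edge of a triangle inside the \<open>r0\<close>-ball of
    the first vertex.\<close>
  define \<eta> where "\<eta> = min r2 \<rho>"
  have \<eta>: "\<eta> > 0" "\<eta> \<le> r2" "\<eta> \<le> \<rho>" using r2(1) \<rho>(1) by (auto simp: \<eta>_def)
  have "\<exists>\<sigma>. singular_simplex 1 mtopology \<sigma> \<and> source \<sigma> = x \<and> target \<sigma> = y \<and>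
      \<sigma> ` standard_simplex 1 \<subseteq> mball x \<rho>" if xy: "x \<in> M" "y \<in> M" "d x y < \<eta>" for x y
  proof -
    obtain U where U: "contractible_space (subtopology mtopology U)" "\<forall>y\<in>U. \<forall>z\<in>U. d y z < \<rho>" "mball x r2 \<subseteq> U"
      using r2(2)[OF xy(1)] by blast
    have "x \<in> U" "y \<in> U" using U(3) xy \<eta> r2(1) by auto
    then obtain g where g: "pathin (subtopology mtopology U) g" "g 0 = x" "g 1 = y"
      using contractible_imp_path_connected_space[OF U(1)] xy unfolding path_connected_space_def by auto
    have ss: "singular_simplex 1 (subtopology mtopology U) (path_simplex g)"
      by (rule singular_simplex_path_simplex[OF g(1)])
    then have im: "path_simplex g ` standard_simplex 1 \<subseteq> U \<inter> M"
      by (auto simp: singular_simplex_def continuous_map_def simp del: One_nat_def)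
    show ?thesis
    proof (intro exI conjI)
      show "singular_simplex 1 mtopology (path_simplex g)"
        using ss by (simp add: singular_simplex_subtopology)
      have "U \<inter> M \<subseteq> mball x \<rho>" using U(2) \<open>x \<in> U\<close> xy by auto
      with im show "path_simplex g ` standard_simplex 1 \<subseteq> mball x \<rho>" by (rule order_trans)
    qed (use g in auto)
  qed
  note path = this
  define e where "e = (\<lambda>x y. SOME \<sigma>. singular_simplex 1 mtopology \<sigma> \<and> source \<sigma> = x \<and> target \<sigma> = y \<and>
      \<sigma> ` standard_simplex 1 \<subseteq> mball x \<rho>)"
  have e: "singular_simplex 1 mtopology (e x y)" "source (e x y) = x" "target (e x y) = y"
    "e x y ` standard_simplex 1 \<subseteq> mball x \<rho>" if "x \<in> M" "y \<in> M" "d x y < \<eta>" for x y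
    using someI_ex[OF path[OF that], folded e_def] unfolding e_def by blast+
  define E where "E = (\<lambda>x y. real_of_chain (frag_of (e x y)))"
  have small: "real_of_chain c \<in> real_boundaries 1 mtopology"
    if c: "singular_chain 1 (subtopology mtopology (mball x r0)) c" "chain_boundary 1 c = 0" and x: "x \<in> M" for c x
  proof -
    obtain U where U: "contractible_space (subtopology mtopology U)" "mball x r0 \<subseteq> U" using r0(2)[OF x] by blast
    show ?thesis by (rule contractible_subset_cycle_boundary[OF U(1) singular_chain_mono[OF c(1) U(2)] c(2)])
  qed
  have ball_sub: "mball y \<rho> \<subseteq> mball x r0" if "x \<in> M" "y \<in> M" "d x y < \<eta>" for x y
  proof
    fix z assume z: "z \<in> mball y \<rho>"
    then have "d x z \<le> d x y + d y z" using that by (auto intro: triangle)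
    also have "\<dots> < r0" using z that \<eta> \<rho> by auto
    finally show "z \<in> mball x r0" using z that by auto
  qed
  have e_in: "singular_chain 1 (subtopology mtopology (mball x r0)) (frag_of (e y z))"
    if "x \<in> M" "y \<in> M" "z \<in> M" "d x y < \<eta>" "d y z < \<eta>" for x y z
    using e(1,4)[of y z] ball_sub[of x y] that
    by (auto simp: singular_chain_of singular_simplex_subtopology simp del: One_nat_def)
  have dxx: "d x x < \<eta>" if "x \<in> M" for x using that \<eta> by simp
  have "edge_system \<eta> E"
    unfolding edge_system_def
  proof (intro conjI ballI allI impI)
    show "\<eta> > 0" by (rule \<eta>(1))
  next
    fix x y assume xy: "x \<in> M" "y \<in> M" "d x y < \<eta>"
    show "E x y \<in> real_chains 1 mtopology"
      using e(1)[OF xy] by (auto simp: E_def real_of_chain_frag_of[symmetric] simp del: real_of_chain_frag_of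
          intro!: real_of_chain_real_chains simp: singular_chain_of simp del: One_nat_def)
    show "integral_chain (E x y)" unfolding E_def by (rule integral_chain_real_of_chain)
    show "real_boundary 1 (E x y) = vertex_chain y - vertex_chain x"
      by (simp add: E_def real_boundary_1_single e(2,3)[OF xy] del: One_nat_def)
  next
    fix x y z assume xyz: "x \<in> M" "y \<in> M" "z \<in> M" "d x y < \<eta> \<and> d y z < \<eta> \<and> d x z < \<eta>"
    have "real_of_chain (frag_of (e x y) + frag_of (e y z) - frag_of (e x z)) \<in> real_boundaries 1 mtopology"
    proof (rule small[OF _ _ xyz(1)])
      show "singular_chain 1 (subtopology mtopology (mball x r0)) (frag_of (e x y) + frag_of (e y z) - frag_of (e x z))"
        using xyz dxx by (intro singular_chain_diff singular_chain_add e_in) auto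
      show "chain_boundary 1 (frag_of (e x y) + frag_of (e y z) - frag_of (e x z)) = 0"
        unfolding chain_boundary_diff chain_boundary_add chain_boundary_1 using xyz by (simp add: e(2,3))
    qed
    then show "E x y + E y z - E x z \<in> real_boundaries 1 mtopology"
      by (simp add: E_def real_of_chain_linear)
  next
    fix x y assume xy: "x \<in> M" "y \<in> M" "d x y < \<eta> \<and> d (f x) (f y) < \<eta>"
    have fxy: "f x \<in> M" "f y \<in> M" using xy f_M by auto
    have s: "source (simplex_map 1 f (e x y)) = f x" "target (simplex_map 1 f (e x y)) = f y"
      using e(2,3)[of x y] xy simplex_vertex_in[of 0 1] simplex_vertex_in[of 1 1]
      by (auto simp: source_def target_def simplex_map_def)
    have "real_of_chain (chain_map 1 f (frag_of (e x y)) - frag_of (e (f x) (f y))) \<in> real_boundaries 1 mtopology"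
    proof (rule small[OF _ _ fxy(1)])
      have "simplex_map 1 f (e x y) ` standard_simplex 1 \<subseteq> mball (f x) r0"
      proof -
        have "e x y ` standard_simplex 1 \<subseteq> mball x r1"
          using e(4)[of x y] xy mball_subset_concentric[of \<rho> r1 x] \<rho> by force
        then have *: "f (e x y z) \<in> mball (f x) r0" if "z \<in> standard_simplex 1" for z
          using f_ball that by blast
        show ?thesis
        proof (rule image_subsetI)
          fix z :: "nat \<Rightarrow> real" assume z: "z \<in> standard_simplex 1"
          show "simplex_map 1 f (e x y) z \<in> mball (f x) r0"
            using *[OF z] z by (simp only: simplex_map_def restrict_apply comp_apply if_True)
        qed
      qed
      then show "singular_chain 1 (subtopology mtopology (mball (f x) r0)) (chain_map 1 f (frag_of (e x y)) - frag_of (e (f x) (f y)))"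
        using xy fxy dxx e(1)[of x y] cont
        by (intro singular_chain_diff e_in)
          (auto simp: singular_chain_of singular_simplex_subtopology simp del: One_nat_def intro!: singular_simplex_simplex_map)
      show "chain_boundary 1 (chain_map 1 f (frag_of (e x y)) - frag_of (e (f x) (f y))) = 0"
        unfolding chain_boundary_diff chain_map_of chain_boundary_1 s using fxy xy by (simp add: e(2,3))
    qed
    then show "real_chain_map 1 f (E x y) - E (f x) (f y) \<in> real_boundaries 1 mtopology"
      by (simp only: E_def real_of_chain_linear real_of_chain_chain_map)
  next
    fix \<sigma> R assume *: "singular_simplex 1 mtopology \<sigma> \<and>
       (\<forall>x\<in>M. \<exists>G. openin mtopology G \<and> x \<in> G \<and> (\<forall>y\<in>G. \<forall>z\<in>G. R y z)) \<and>
       (\<forall>y\<in>M. \<forall>z\<in>M. R y z \<longrightarrow> d y z < \<eta>)"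
    then obtain g where g: "pathin mtopology g" "\<sigma> = path_simplex g"
      using singular_simplex_eq_path_simplex by blast
    have gM: "g t \<in> M" if "t \<in> {0..1}" for t
      using g that by (auto simp: pathin_def continuous_map_def)
    obtain N :: nat where N: "N > 0" "\<And>j s t. j < N \<Longrightarrow> s \<in> {0..1} \<Longrightarrow> t \<in> {0..1} \<Longrightarrow>
        R (g ((real j + s) / real N)) (g ((real j + t) / real N))"
      using path_fine_subdivision[OF g(1), of R] * by auto
    define p where "p = (\<lambda>j::nat. g (real j / real N))"
    have in01: "(real j + t) / real N \<in> {0..1}" if "j < N" "t \<in> {0..1}" for j t
    proof -
      have "real j + t \<le> real N" using that by auto
      then show ?thesis using that N(1) by simp
    qed
    have pM: "p j \<in> M" if "j \<le> N" for j
      using that N(1) by (auto simp: p_def intro!: gM)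
    have Rp: "R (p j) (p (Suc j))" if "j < N" for j
      using N(2)[OF that, of 0 1] by (simp add: p_def add.commute)
    let ?s = "\<lambda>j. path_simplex (\<lambda>t. g ((real j + t) / real N))"
    have piece: "real_of_chain (frag_of (?s j)) - E (p j) (p (Suc j)) \<in> real_boundaries 1 mtopology" if j: "j < N" for j
    proof -
      have pj: "p j \<in> M" "p (Suc j) \<in> M" "d (p j) (p (Suc j)) < \<eta>" using j pM Rp * by auto
      have "pathin mtopology (\<lambda>t. g ((real j + t) / real N))"
      proof -
        have "continuous_map (top_of_set {0..1}) (top_of_set {0..1}) (\<lambda>t. (real j + t) / real N)"
          using in01[OF j] N(1) by (auto intro!: continuous_intros)
        from continuous_map_compose[OF this g(1)[unfolded pathin_def]] show ?thesis
          by (simp add: pathin_def comp_def)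
      qed
      then have ss: "singular_simplex 1 mtopology (?s j)" by (rule singular_simplex_path_simplex)
      have "?s j ` standard_simplex 1 \<subseteq> mball (p j) r0"
      proof
        fix y assume "y \<in> ?s j ` standard_simplex 1"
        then obtain t where t: "t \<in> {0..1}" "y = g ((real j + t) / real N)"
          using standard_simplex_1_image by (auto simp: path_simplex_def simp del: One_nat_def)
        \<comment> \<open>The subdivision relates \<open>p j\<close> to every point of the piece,
          not only to its end, so the whole piece lies in one ball together with the edge replacing
          it.\<close>
        have "R (p j) y" using N(2)[OF j, of 0 t] t by (simp add: p_def)
        moreover have "y \<in> M" using t in01[OF j] gM by auto
        ultimately show "y \<in> mball (p j) r0" using * pj \<eta> \<rho> by force
      qed
      then have "singular_chain 1 (subtopology mtopology (mball (p j) r0)) (frag_of (?s j) - frag_of (e (p j) (p (Suc j))))"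
        using ss pj dxx by (intro singular_chain_diff e_in)
          (auto simp: singular_chain_of singular_simplex_subtopology simp del: One_nat_def)
      moreover have "chain_boundary 1 (frag_of (?s j) - frag_of (e (p j) (p (Suc j)))) = 0"
        unfolding chain_boundary_diff chain_boundary_1 using pj by (simp add: e(2,3) p_def add.commute)
      ultimately have "real_of_chain (frag_of (?s j) - frag_of (e (p j) (p (Suc j)))) \<in> real_boundaries 1 mtopology"
        by (rule small[OF _ _ pj(1)])
      then show ?thesis by (simp only: E_def real_of_chain_linear)
    qed
    have "(\<Sum>j<N. real_of_chain (frag_of (?s j)) - E (p j) (p (Suc j))) \<in> real_boundaries 1 mtopology"
      by (rule rc_subspace_sum[OF rc_subspace_real_boundaries]) (use piece in simp)
    then have "real_of_chain (frag_of \<sigma> - (\<Sum>j<N. frag_of (?s j))) +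
        (\<Sum>j<N. real_of_chain (frag_of (?s j)) - E (p j) (p (Suc j))) \<in> real_boundaries 1 mtopology"
      using path_subdivision_boundary[OF g(1) N(1)] unfolding g(2)
      by (intro rc_subspaceD(2)[OF rc_subspace_real_boundaries])
    then have "Poly_Mapping.single \<sigma> 1 - (\<Sum>j<N. E (p j) (p (Suc j))) \<in> real_boundaries 1 mtopology"
      by (simp add: real_of_chain_linear real_of_chain_sum sum_subtractf)
    moreover have "p 0 = source \<sigma>" "p N = target \<sigma>" using N(1) by (simp_all add: g(2) p_def)
    ultimately show "\<exists>N p. p 0 = source \<sigma> \<and> p N = target \<sigma> \<and> (\<forall>j\<le>N. p j \<in> M) \<and> (\<forall>j<N. R (p j) (p (Suc j))) \<and>
         Poly_Mapping.single \<sigma> 1 - (\<Sum>j<N. E (p j) (p (Suc j))) \<in> real_boundaries 1 mtopology"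
      using pM Rp by blast
  qed
  then show ?thesis by blast
qed

end

subsection \<open>Homologous chains and combinations of loops\<close>

fun walk_sum :: "('a \<Rightarrow> 'a \<Rightarrow> 'b::comm_monoid_add) \<Rightarrow> 'a list \<Rightarrow> 'b" where
  "walk_sum E (x # y # zs) = E x y + walk_sum E (y # zs)"
| "walk_sum E _ = 0"

text \<open>This plays the part of a spanning forest: each vertex gets a path from the root of its
  component. The paths are chosen independently of each other; being simple, they have at most
  \<open>card V\<close> vertices.\<close>

lemma tree_paths_exist:
  assumes fin: "finite V" and sym: "\<And>u v. R u v \<Longrightarrow> R v u" and V: "\<And>u v. R u v \<Longrightarrow> u \<in> V \<and> v \<in> V"
  shows "\<exists>P. (\<forall>v\<in>V. P v \<noteq> [] \<and> last (P v) = v \<and> set (P v) \<subseteq> V \<and> successively R (P v) \<and> length (P v) \<le> card V)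
    \<and> (\<forall>u v. R u v \<longrightarrow> hd (P u) = hd (P v))"
proof -
  \<comment> \<open>By symmetry adjacent vertices are reached from exactly the same points, so the
    choice yields the same root for both.\<close>
  define root where "root = (\<lambda>x. SOME y. R\<^sup>*\<^sup>* y x)"
  have root: "R\<^sup>*\<^sup>* (root x) x" for x
    unfolding root_def by (rule someI[of _ x]) simp
  have path: "successively R (x # xs) \<and> last (x # xs) = y" if "rtrancl_path R x xs y" for x xs y
    using that by (induction rule: rtrancl_path.induct) (auto simp: successively_Cons)
  have setV: "set xs \<subseteq> V" if "rtrancl_path R x xs y" for x xs y
    using that by (induction rule: rtrancl_path.induct) (use V in auto)
  have startV: "x \<in> V" if "rtrancl_path R x xs y" "y \<in> V" for x xs y
    using that by (cases rule: rtrancl_path.cases) (use V in auto)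
  have "\<exists>xs. rtrancl_path R (root v) xs v \<and> distinct (root v # xs)" for v
    using root[of v] unfolding rtranclp_eq_rtrancl_path by (meson rtrancl_path_distinct)
  then obtain xs where xs: "\<And>v. rtrancl_path R (root v) (xs v) v" "\<And>v. distinct (root v # xs v)"
    by metis
  define P where "P = (\<lambda>v. root v # xs v)"
  have "P v \<noteq> [] \<and> last (P v) = v \<and> set (P v) \<subseteq> V \<and> successively R (P v) \<and> length (P v) \<le> card V" if v: "v \<in> V" for v
  proof -
    have 1: "set (P v) \<subseteq> V" using setV[OF xs(1)] startV[OF xs(1) v] by (auto simp: P_def)
    have "length (P v) = card (set (P v))" using xs(2)[of v] distinct_card[of "P v"] by (simp add: P_def)
    then have "length (P v) \<le> card V" using card_mono[OF fin 1] by simp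
    then show ?thesis using 1 path[OF xs(1)[of v]] unfolding P_def by blast
  qed
  moreover have "hd (P u) = hd (P v)" if "R u v" for u v
  proof -
    have "R\<^sup>*\<^sup>* y u \<longleftrightarrow> R\<^sup>*\<^sup>* y v" for y
      using that sym[OF that] by (meson rtranclp.rtrancl_into_rtrancl)
    then show ?thesis by (simp add: P_def root_def)
  qed
  ultimately show ?thesis by blast
qed

definition homologous :: "'a topology \<Rightarrow> 'a real_chain \<Rightarrow> 'a real_chain \<Rightarrow> bool" where
  "homologous X a b \<longleftrightarrow> a - b \<in> real_boundaries 1 X"

lemma homologous_refl [simp]: "homologous X a a"
  using rc_subspaceD(1)[OF rc_subspace_real_boundaries] by (simp add: homologous_def)

lemma homologous_sym: "homologous X a b \<Longrightarrow> homologous X b a"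
  using rc_subspaceD(4)[OF rc_subspace_real_boundaries, of "a - b"] by (simp add: homologous_def)

lemma homologous_add: "homologous X a b \<Longrightarrow> homologous X a' b' \<Longrightarrow> homologous X (a + a') (b + b')"
  using rc_subspaceD(2)[OF rc_subspace_real_boundaries, of "a - b" 1 X "a' - b'"]
  by (simp add: homologous_def algebra_simps)

lemma homologous_trans [trans]: "homologous X a b \<Longrightarrow> homologous X b c \<Longrightarrow> homologous X a c"
  using rc_subspaceD(2)[OF rc_subspace_real_boundaries, of "a - b" 1 X "b - c"]
  by (simp add: homologous_def)

lemma homologous_diff: "homologous X a b \<Longrightarrow> homologous X a' b' \<Longrightarrow> homologous X (a - a') (b - b')"
  using rc_subspaceD(5)[OF rc_subspace_real_boundaries, of "a - b" 1 X "a' - b'"]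
  by (simp add: homologous_def algebra_simps)

lemma homologous_scale: "homologous X a b \<Longrightarrow> homologous X (rc_scale r a) (rc_scale r b)"
  using rc_subspaceD(3)[OF rc_subspace_real_boundaries, of "a - b" 1 X r]
  by (simp add: homologous_def rc_scale_distrib)

lemma homologous_sum: "(\<And>i. i \<in> I \<Longrightarrow> homologous X (g i) (h i)) \<Longrightarrow> homologous X (sum g I) (sum h I)"
  by (induction I rule: infinite_finite_induct) (auto intro: homologous_add)

lemma homologous_chain_map:
  "homologous X a b \<Longrightarrow> continuous_map X Y f \<Longrightarrow> homologous Y (real_chain_map 1 f a) (real_chain_map 1 f b)"
  using real_chain_map_boundaries[of "a - b" 1 X Y f] by (simp add: homologous_def real_chain_map_linear)

text \<open>\<open>K\<close> will be \<open>UNIV\<close> or \<int>. The bound \<open>l\<close> on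
  the sum of absolute values measures the size of a class with respect to \<open>S\<close>; the
  value \<infinity> imposes no bound.\<close>

definition combination :: "'a topology \<Rightarrow> 'a real_chain set \<Rightarrow> real set \<Rightarrow> ereal \<Rightarrow> 'a real_chain \<Rightarrow> bool" where
  "combination X S K l c \<longleftrightarrow> (\<exists>a. (\<forall>s. a s \<in> K) \<and> ereal (\<Sum>s\<in>S. \<bar>a s\<bar>) \<le> l \<and> homologous X c (\<Sum>s\<in>S. rc_scale (a s) s))"

definition subring_set :: "real set \<Rightarrow> bool" where
  "subring_set K \<longleftrightarrow> 0 \<in> K \<and> 1 \<in> K \<and> (\<forall>x\<in>K. \<forall>y\<in>K. x + y \<in> K \<and> x - y \<in> K \<and> x * y \<in> K)"

lemma subring_UNIV_Ints: "subring_set UNIV" "subring_set \<int>"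
  by (auto simp: subring_set_def)

lemma combination_homologous: "combination X S K l c \<Longrightarrow> homologous X c' c \<Longrightarrow> combination X S K l c'"
  unfolding combination_def using homologous_trans by blast

lemma combination_0: "subring_set K \<Longrightarrow> 0 \<le> l \<Longrightarrow> combination X S K l 0"
  unfolding combination_def by (rule exI[of _ "\<lambda>_. 0"]) (auto simp: subring_set_def zero_ereal_def)

lemma combination_basic:
  assumes "subring_set K" "finite S" "s \<in> S"
  shows "combination X S K 1 s"
proof -
  let ?a = "\<lambda>t. if t = s then 1 else (0::real)"
  have "rc_scale (?a t) t = (if t = s then s else 0)" for t by simp
  then have "(\<Sum>t\<in>S. rc_scale (?a t) t) = s"
    by (simp only: sum.delta[OF assms(2)] assms(3) if_True)
  moreover have "\<bar>?a t\<bar> = (if t = s then 1 else 0)" for t by simp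
  then have "(\<Sum>t\<in>S. \<bar>?a t\<bar>) = 1"
    by (simp only: sum.delta[OF assms(2)] assms(3) if_True)
  ultimately show ?thesis
    using assms unfolding combination_def
    by (intro exI[of _ ?a]) (auto simp: subring_set_def one_ereal_def)
qed

lemma combination_add:
  assumes K: "subring_set K" and c: "combination X S K l c" and c': "combination X S K l' c'"
  shows "combination X S K (l + l') (c + c')"
proof -
  obtain a where a: "\<forall>s. a s \<in> K" "ereal (\<Sum>s\<in>S. \<bar>a s\<bar>) \<le> l" "homologous X c (\<Sum>s\<in>S. rc_scale (a s) s)"
    using c unfolding combination_def by blast
  obtain a' where a': "\<forall>s. a' s \<in> K" "ereal (\<Sum>s\<in>S. \<bar>a' s\<bar>) \<le> l'" "homologous X c' (\<Sum>s\<in>S. rc_scale (a' s) s)"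
    using c' unfolding combination_def by blast
  have "(\<Sum>s\<in>S. \<bar>a s + a' s\<bar>) \<le> (\<Sum>s\<in>S. \<bar>a s\<bar>) + (\<Sum>s\<in>S. \<bar>a' s\<bar>)"
    unfolding sum.distrib[symmetric] by (intro sum_mono abs_triangle_ineq)
  then have "ereal (\<Sum>s\<in>S. \<bar>a s + a' s\<bar>) \<le> ereal (\<Sum>s\<in>S. \<bar>a s\<bar>) + ereal (\<Sum>s\<in>S. \<bar>a' s\<bar>)"
    by simp
  also have "\<dots> \<le> l + l'" by (intro add_mono a(2) a'(2))
  finally have "ereal (\<Sum>s\<in>S. \<bar>a s + a' s\<bar>) \<le> l + l'" .
  moreover have "\<forall>s. a s + a' s \<in> K" using K a(1) a'(1) by (simp add: subring_set_def)
  moreover have "homologous X (c + c') (\<Sum>s\<in>S. rc_scale (a s + a' s) s)"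
    using homologous_add[OF a(3) a'(3)] by (simp add: rc_scale_distrib(2) sum.distrib)
  ultimately show ?thesis
    unfolding combination_def by (intro exI[of _ "\<lambda>s. a s + a' s"] conjI)
qed

lemma combination_uminus:
  assumes K: "subring_set K" and c: "combination X S K l c"
  shows "combination X S K l (- c)"
proof -
  obtain a where a: "\<forall>s. a s \<in> K" "ereal (\<Sum>s\<in>S. \<bar>a s\<bar>) \<le> l" "homologous X c (\<Sum>s\<in>S. rc_scale (a s) s)"
    using c unfolding combination_def by blast
  have "- x \<in> K" if "x \<in> K" for x
    using K that unfolding subring_set_def by (metis diff_0)
  then show ?thesis
    using a homologous_diff[OF homologous_refl[of X 0] a(3)] unfolding combination_def
    by (intro exI[of _ "\<lambda>s. - a s"]) (auto simp: rc_scale_distrib sum_negf)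
qed

lemma combination_diff:
  "subring_set K \<Longrightarrow> combination X S K l c \<Longrightarrow> combination X S K l' c' \<Longrightarrow> combination X S K (l + l') (c - c')"
  using combination_add[of K X S l c l' "- c'"] combination_uminus[of K X S l' c'] by simp

lemma combination_scale:
  assumes K: "subring_set K" and c: "combination X S K \<infinity> c" and r: "r \<in> K"
  shows "combination X S K \<infinity> (rc_scale r c)"
proof -
  obtain a where a: "\<forall>s. a s \<in> K" "homologous X c (\<Sum>s\<in>S. rc_scale (a s) s)"
    using c unfolding combination_def by blast
  then show ?thesis
    using r K homologous_scale[OF a(2), of r] unfolding combination_def
    by (intro exI[of _ "\<lambda>s. r * a s"]) (auto simp: rc_scale_sum subring_set_def)
qed

lemma combination_mono: "combination X S K l c \<Longrightarrow> l \<le> l' \<Longrightarrow> combination X S K l' c"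
  unfolding combination_def using order_trans by blast

lemma combination_sum:
  assumes K: "subring_set K" and "\<And>i. i \<in> I \<Longrightarrow> combination X S K \<infinity> (g i)"
  shows "combination X S K \<infinity> (sum g I)"
  using assms(2)
proof (induction I rule: infinite_finite_induct)
  case (insert i I)
  then show ?case using combination_add[OF K, of X S \<infinity> "g i" \<infinity> "sum g I"] by auto
qed (auto intro: combination_0[OF K])

text \<open>Entries may repeat; their coefficients then add up, and the sum of absolute values is
  still at most the length.\<close>

lemma combination_sum_list:
  assumes K: "subring_set K" "finite S" and "set L \<subseteq> S"
  shows "combination X S K (ereal (real (length L))) (sum_list L)"
  using assms(3)
proof (induction L)
  case Nil
  then show ?case using combination_0[OF K(1) order_refl] by (simp add: zero_ereal_def)
next
  case (Cons s L)
  then have "combination X S K (1 + ereal (real (length L))) (s + sum_list L)"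
    by (intro combination_add combination_basic K) auto
  then show ?case by (simp add: one_ereal_def add.commute)
qed

subsection \<open>Nets\<close>

text \<open>The data occur twice: for a fixed net measured by \<open>d\<close>, and for a spanning
  set measured along the first \<open>n\<close> iterates. \<open>pr\<close> moves a point to a
  nearby vertex, \<open>Rel\<close> is closeness of points of \<open>M\<close>, and \<open>R\<close>
  is adjacency of vertices. Related points have adjacent vertices, and all distances involved stay
  below \<open>\<eta>\<close>.\<close>

locale net = lc_system M d f for M :: "'a set" and d f +
  fixes \<eta> E and V :: "'a set" and R :: "'a \<Rightarrow> 'a \<Rightarrow> bool" and P :: "'a \<Rightarrow> 'a list" and pr :: "'a \<Rightarrow> 'a"
    and Rel :: "'a \<Rightarrow> 'a \<Rightarrow> bool"
  assumes edges: "edge_system \<eta> E"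
    and finV: "finite V" and VM: "V \<subseteq> M"
    and R: "R u v \<Longrightarrow> u \<in> V \<and> v \<in> V \<and> d u v < \<eta>"
    and P: "v \<in> V \<Longrightarrow> P v \<noteq> [] \<and> last (P v) = v \<and> set (P v) \<subseteq> V \<and> successively R (P v) \<and> length (P v) \<le> card V"
    and hdP: "R u v \<Longrightarrow> hd (P u) = hd (P v)"
    and pr: "x \<in> M \<Longrightarrow> pr x \<in> V"
    and Rel: "Rel x y \<Longrightarrow> x \<in> M \<Longrightarrow> y \<in> M \<Longrightarrow>
      d x y < \<eta> \<and> d x (pr x) < \<eta> \<and> d x (pr y) < \<eta> \<and> d y (pr y) < \<eta> \<and> R (pr x) (pr y)"
    and Rel_open: "x \<in> M \<Longrightarrow> \<exists>G. openin mtopology G \<and> x \<in> G \<and> (\<forall>y\<in>G. \<forall>z\<in>G. Rel y z)"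
begin

abbreviation hom_eq (infix "\<approx>\<^sub>h" 50) where "a \<approx>\<^sub>h b \<equiv> homologous mtopology a b"


lemma edge:
  assumes "x \<in> M" "y \<in> M" "d x y < \<eta>"
  shows "E x y \<in> real_chains 1 mtopology" "integral_chain (E x y)"
    "real_boundary 1 (E x y) = vertex_chain y - vertex_chain x"
proof -
  have "\<forall>x\<in>M. \<forall>y\<in>M. d x y < \<eta> \<longrightarrow> E x y \<in> real_chains 1 mtopology \<and> integral_chain (E x y) \<and>
       real_boundary 1 (E x y) = vertex_chain y - vertex_chain x"
    using edges unfolding edge_system_def by (elim conjE)
  with assms show "E x y \<in> real_chains 1 mtopology" "integral_chain (E x y)"
    "real_boundary 1 (E x y) = vertex_chain y - vertex_chain x" by blast+
qed

lemma edge_triangle: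
  assumes "x \<in> M" "y \<in> M" "z \<in> M" "d x y < \<eta>" "d y z < \<eta>" "d x z < \<eta>"
  shows "E x y + E y z \<approx>\<^sub>h E x z"
proof -
  have "\<forall>x\<in>M. \<forall>y\<in>M. \<forall>z\<in>M. d x y < \<eta> \<and> d y z < \<eta> \<and> d x z < \<eta> \<longrightarrow>
       E x y + E y z - E x z \<in> real_boundaries 1 mtopology"
    using edges unfolding edge_system_def by (elim conjE)
  with assms show ?thesis unfolding homologous_def by blast
qed

lemma edge_map:
  assumes "x \<in> M" "y \<in> M" "d x y < \<eta>" "d (f x) (f y) < \<eta>"
  shows "real_chain_map 1 f (E x y) \<approx>\<^sub>h E (f x) (f y)"
proof -
  have "\<forall>x\<in>M. \<forall>y\<in>M. d x y < \<eta> \<and> d (f x) (f y) < \<eta> \<longrightarrow>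
       real_chain_map 1 f (E x y) - E (f x) (f y) \<in> real_boundaries 1 mtopology"
    using edges unfolding edge_system_def by (elim conjE)
  with assms show ?thesis unfolding homologous_def by blast
qed

text \<open>From the root to \<open>u\<close>, across the edge, and back from \<open>v\<close> to
  the root, which is the same one by \<open>hdP\<close>.\<close>

definition loop :: "'a \<Rightarrow> 'a \<Rightarrow> 'a real_chain" where
  "loop u v = walk_sum E (P u) + E u v - walk_sum E (P v)"

definition loops :: "'a real_chain set" where "loops = (\<lambda>(u, v). loop u v) ` {(u, v). R u v}"

text \<open>A chain from \<open>x\<close> through its vertex \<open>pr x\<close> back to the root.
  Tails are the correction that turns an edge into a loop; they cancel on cycles.\<close>

definition tail :: "'a \<Rightarrow> 'a real_chain" where "tail x = E x (pr x) - walk_sum E (P (pr x))"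

lemma finite_loops: "finite loops"
  unfolding loops_def
  by (rule finite_imageI, rule finite_subset[of _ "V \<times> V"]) (use R finV in auto)

lemma loop_in: "R u v \<Longrightarrow> loop u v \<in> loops"
  by (auto simp: loops_def)

text \<open>Two triangles share the diagonal from \<open>x\<close> to \<open>pr y\<close>: one
  passes through \<open>pr x\<close>, the other through \<open>y\<close>. Comparing them replaces
  \<open>E x y\<close> by the edge between the vertices, up to the tails.\<close>

lemma edge_reduction:
  assumes "Rel x y" "x \<in> M" "y \<in> M"
  shows "E x y \<approx>\<^sub>h tail x - tail y + loop (pr x) (pr y)"
proof -
  note r = Rel[OF assms]
  have M: "pr x \<in> M" "pr y \<in> M" using pr assms VM by auto
  have "E x (pr x) + E (pr x) (pr y) \<approx>\<^sub>h E x (pr y)"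
    using r M assms R by (intro edge_triangle) auto
  then have "E x (pr x) + E (pr x) (pr y) - E y (pr y) \<approx>\<^sub>h E x (pr y) - E y (pr y)"
    by (intro homologous_diff) auto
  also have "E x (pr y) - E y (pr y) \<approx>\<^sub>h E x y"
  proof -
    have "E x y + E y (pr y) \<approx>\<^sub>h E x (pr y)" using r M assms by (intro edge_triangle) auto
    from homologous_diff[OF this homologous_refl[of _ "E y (pr y)"]]
    have "E x y \<approx>\<^sub>h E x (pr y) - E y (pr y)" by simp
    then show ?thesis by (rule homologous_sym)
  qed
  finally have "tail x - tail y + loop (pr x) (pr y) \<approx>\<^sub>h E x y"
    by (simp add: tail_def loop_def algebra_simps)
  then show ?thesis by (rule homologous_sym)
qed

text \<open>The tails of consecutive points telescope, so a walk costs one loop per edge and two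
  tails at its ends.\<close>

lemma walk_reduction:
  assumes "successively Rel ps" "ps \<noteq> []" "set ps \<subseteq> M"
  shows "\<exists>L. set L \<subseteq> loops \<and> Suc (length L) = length ps \<and> walk_sum E ps \<approx>\<^sub>h tail (hd ps) - tail (last ps) + sum_list L"
  using assms
proof (induction ps rule: induct_list012)
  case (3 x y zs)
  have xy: "Rel x y" "x \<in> M" "y \<in> M" using 3 by (auto simp: successively_Cons)
  obtain L where L: "set L \<subseteq> loops" "Suc (length L) = length (y # zs)"
    "walk_sum E (y # zs) \<approx>\<^sub>h tail y - tail (last (y # zs)) + sum_list L"
    using 3 by (auto simp: successively_Cons)
  have "E x y + walk_sum E (y # zs) \<approx>\<^sub>h (tail x - tail y + loop (pr x) (pr y)) + (tail y - tail (last (y # zs)) + sum_list L)"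
    by (rule homologous_add[OF edge_reduction[OF xy] L(3)])
  also have "\<dots> = tail (hd (x # y # zs)) - tail (last (x # y # zs)) + sum_list (loop (pr x) (pr y) # L)"
    by simp
  finally show ?case
    using L loop_in Rel[OF xy] by (intro exI[of _ "loop (pr x) (pr y) # L"]) auto
qed (auto intro!: exI[of _ "[]"])

lemma walk_chain:
  assumes "successively (\<lambda>x y. d x y < \<eta>) ps" "ps \<noteq> []" "set ps \<subseteq> M"
  shows "walk_sum E ps \<in> real_chains 1 mtopology \<and> integral_chain (walk_sum E ps) \<and>
    real_boundary 1 (walk_sum E ps) = vertex_chain (last ps) - vertex_chain (hd ps)"
  using assms
proof (induction ps rule: induct_list012)
  case (3 x y zs)
  have xy: "x \<in> M" "y \<in> M" "d x y < \<eta>" using 3 by (auto simp: successively_Cons)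
  have "successively (\<lambda>x y. d x y < \<eta>) (y # zs)" "set (y # zs) \<subseteq> M"
    using 3(3,5) by (auto simp: successively_Cons)
  from 3(2)[OF this(1) _ this(2)]
  have IH: "walk_sum E (y # zs) \<in> real_chains 1 mtopology" "integral_chain (walk_sum E (y # zs))"
    "real_boundary 1 (walk_sum E (y # zs)) = vertex_chain (last (y # zs)) - vertex_chain y"
    by simp_all
  have w: "walk_sum E (x # y # zs) = E x y + walk_sum E (y # zs)" by simp
  have "integral_chain (E x y + walk_sum E (y # zs))"
    using edge(2)[OF xy] IH(2) unfolding integral_chain_def lookup_add by (intro allI Ints_add) auto
  moreover have "E x y + walk_sum E (y # zs) \<in> real_chains 1 mtopology"
    by (rule rc_subspaceD(2)[OF rc_subspace_real_chains edge(1)[OF xy] IH(1)])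
  moreover have "real_boundary 1 (E x y + walk_sum E (y # zs)) = vertex_chain (last (x # y # zs)) - vertex_chain x"
    unfolding real_boundary_linear edge(3)[OF xy] IH(3) by simp
  ultimately show ?case unfolding w list.sel by blast
qed (auto simp: rc_subspaceD(1)[OF rc_subspace_real_chains] integral_chain_def real_boundary_linear)

lemma P_near: "v \<in> V \<Longrightarrow> successively (\<lambda>x y. d x y < \<eta>) (P v)"
  by (rule successively_mono[of R]) (use P R in auto)

lemma loops_cycles:
  assumes "s \<in> loops"
  shows "s \<in> real_cycles 1 mtopology" "integral_chain s"
proof -
  obtain u v where uv: "R u v" "s = loop u v" using assms by (auto simp: loops_def)
  have V: "u \<in> V" "v \<in> V" "d u v < \<eta>" "u \<in> M" "v \<in> M" using R[OF uv(1)] VM by auto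
  note pu = walk_chain[OF P_near[OF V(1)]] and pv = walk_chain[OF P_near[OF V(2)]]
  have "set (P u) \<subseteq> M" "set (P v) \<subseteq> M" using P V VM by blast+
  with pu pv P V have *: "walk_sum E (P u) \<in> real_chains 1 mtopology" "walk_sum E (P v) \<in> real_chains 1 mtopology"
    "integral_chain (walk_sum E (P u))" "integral_chain (walk_sum E (P v))"
    "real_boundary 1 (walk_sum E (P u)) = vertex_chain u - vertex_chain (hd (P u))"
    "real_boundary 1 (walk_sum E (P v)) = vertex_chain v - vertex_chain (hd (P v))" by auto
  show "s \<in> real_cycles 1 mtopology"
    using * edge(1,3)[OF V(4,5,3)] hdP[OF uv(1)] unfolding uv(2) loop_def real_cycles_def
    by (auto simp: real_boundary_linear intro!: rc_subspaceD(2,5)[OF rc_subspace_real_chains])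
  show "integral_chain s"
    using *(3,4) edge(2)[OF V(4,5,3)] unfolding uv(2) loop_def
    by (auto simp: integral_chain_def lookup_add lookup_minus)
qed

text \<open>A fine subdivision turns each simplex into the tail of its source minus the tail of its
  target plus loops. Summed over \<open>c\<close>, the tails depend only on the boundary of
  \<open>c\<close> and cancel. The coefficients of the loops are sums of coefficients of
  \<open>c\<close>, so they stay in \<open>K\<close>.\<close>

theorem cycle_combination:
  assumes c: "c \<in> real_cycles 1 mtopology" and K: "subring_set K" and cK: "\<And>\<sigma>. Poly_Mapping.lookup c \<sigma> \<in> K"
  shows "combination mtopology loops K \<infinity> c"
proof -
  define Q where "Q = (\<lambda>\<sigma> N p. p 0 = source \<sigma> \<and> p N = target \<sigma> \<and> (\<forall>j\<le>N. p j \<in> M) \<and> (\<forall>j<N. Rel (p j) (p (Suc j))) \<and>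
         Poly_Mapping.single \<sigma> 1 \<approx>\<^sub>h (\<Sum>j<N. E (p j) (p (Suc j))))"
  have ex: "\<exists>N p. Q \<sigma> N p" if "singular_simplex 1 mtopology \<sigma>" for \<sigma>
  proof -
    have "\<forall>x\<in>M. \<exists>G. openin mtopology G \<and> x \<in> G \<and> (\<forall>y\<in>G. \<forall>z\<in>G. Rel y z)"
      using Rel_open by blast
    moreover have "\<forall>y\<in>M. \<forall>z\<in>M. Rel y z \<longrightarrow> d y z < \<eta>" using Rel by blast
    moreover have "\<forall>\<sigma> R. singular_simplex 1 mtopology \<sigma> \<and>
       (\<forall>x\<in>M. \<exists>G. openin mtopology G \<and> x \<in> G \<and> (\<forall>y\<in>G. \<forall>z\<in>G. R y z)) \<and>
       (\<forall>y\<in>M. \<forall>z\<in>M. R y z \<longrightarrow> d y z < \<eta>) \<longrightarrow>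
       (\<exists>N p. p 0 = source \<sigma> \<and> p N = target \<sigma> \<and> (\<forall>j\<le>N. p j \<in> M) \<and> (\<forall>j<N. R (p j) (p (Suc j))) \<and>
         Poly_Mapping.single \<sigma> 1 - (\<Sum>j<N. E (p j) (p (Suc j))) \<in> real_boundaries 1 mtopology)"
      using edges unfolding edge_system_def by (elim conjE)
    ultimately show ?thesis
      using that unfolding Q_def homologous_def by simp
  qed
  have "\<forall>\<sigma>. \<exists>N. \<exists>p. singular_simplex 1 mtopology \<sigma> \<longrightarrow> Q \<sigma> N p"
    using ex by blast
  from choice[OF this] obtain N where "\<forall>\<sigma>. \<exists>p. singular_simplex 1 mtopology \<sigma> \<longrightarrow> Q \<sigma> (N \<sigma>) p" ..
  from choice[OF this] obtain p where "\<forall>\<sigma>. singular_simplex 1 mtopology \<sigma> \<longrightarrow> Q \<sigma> (N \<sigma>) (p \<sigma>)" ..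
  then have Np: "p \<sigma> 0 = source \<sigma> \<and> p \<sigma> (N \<sigma>) = target \<sigma> \<and>
     (\<forall>j\<le>N \<sigma>. p \<sigma> j \<in> M) \<and> (\<forall>j<N \<sigma>. Rel (p \<sigma> j) (p \<sigma> (Suc j))) \<and>
         Poly_Mapping.single \<sigma> 1 \<approx>\<^sub>h (\<Sum>j<N \<sigma>. E (p \<sigma> j) (p \<sigma> (Suc j)))"
    if "singular_simplex 1 mtopology \<sigma>" for \<sigma>
    using that unfolding Q_def by blast
  define l where "l = (\<lambda>\<sigma>. \<Sum>j<N \<sigma>. loop (pr (p \<sigma> j)) (pr (p \<sigma> (Suc j))))"
  have simplex: "Poly_Mapping.single \<sigma> 1 \<approx>\<^sub>h tail (source \<sigma>) - tail (target \<sigma>) + l \<sigma>"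
    if \<sigma>: "singular_simplex 1 mtopology \<sigma>" for \<sigma>
  proof -
    note n = Np[OF \<sigma>]
    have "(\<Sum>j<N \<sigma>. E (p \<sigma> j) (p \<sigma> (Suc j))) \<approx>\<^sub>h
        (\<Sum>j<N \<sigma>. tail (p \<sigma> j) - tail (p \<sigma> (Suc j)) + loop (pr (p \<sigma> j)) (pr (p \<sigma> (Suc j))))"
      using n by (intro homologous_sum edge_reduction) auto
    also have "\<dots> = tail (source \<sigma>) - tail (target \<sigma>) + l \<sigma>"
      using n by (simp add: sum.distrib l_def sum_lessThan_telescope'[of "\<lambda>j. tail (p \<sigma> j)" "N \<sigma>"])
    finally show ?thesis using n homologous_trans by blast
  qed
  have keys: "singular_simplex 1 mtopology \<sigma>" if "\<sigma> \<in> Poly_Mapping.keys c" for \<sigma>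
    using c that by (auto simp: real_cycles_def real_chains_def)
  \<comment> \<open>Evaluating a 0-simplex at its only point recovers the vertex. The linear
    extension of \<open>?h\<close> sends the boundary of \<open>c\<close>, which is 0, to the sum of
    the differences of tails.\<close>
  let ?h = "\<lambda>\<tau>. tail (\<tau> (simplex_vertex 0))"
  have "rc_extend (\<lambda>\<sigma>. tail (target \<sigma>) - tail (source \<sigma>)) c = rc_extend ?h (real_boundary 1 c)"
  proof -
    have "rc_extend ?h (real_of_chain (chain_boundary 1 (frag_of \<sigma>))) = tail (target \<sigma>) - tail (source \<sigma>)" for \<sigma>
      unfolding chain_boundary_1 using simplex_vertex_in[of 0 0]
      by (simp add: real_of_chain_linear rc_extend_diff point_simplex_def)
    moreover have "real_boundary 1 c = rc_extend (\<lambda>\<sigma>. real_of_chain (chain_boundary 1 (frag_of \<sigma>))) c"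
      by (rule real_boundary_eq_extend) simp
    ultimately show ?thesis by (simp only: rc_extend_compose)
  qed
  also have "real_boundary 1 c = 0" using c by (simp add: real_cycles_def)
  finally have 0: "rc_extend (\<lambda>\<sigma>. tail (source \<sigma>) - tail (target \<sigma>)) c = 0"
    using rc_extend_diff_fun[of "\<lambda>\<sigma>. tail (target \<sigma>)" "\<lambda>\<sigma>. tail (source \<sigma>)" c]
      rc_extend_diff_fun[of "\<lambda>\<sigma>. tail (source \<sigma>)" "\<lambda>\<sigma>. tail (target \<sigma>)" c] by simp
  have "c = (\<Sum>\<sigma>\<in>Poly_Mapping.keys c. rc_scale (Poly_Mapping.lookup c \<sigma>) (Poly_Mapping.single \<sigma> 1))"
    using rc_extend_single_fun[of c] by (simp add: rc_extend_def)
  also have "\<dots> \<approx>\<^sub>h (\<Sum>\<sigma>\<in>Poly_Mapping.keys c. rc_scale (Poly_Mapping.lookup c \<sigma>) (tail (source \<sigma>) - tail (target \<sigma>) + l \<sigma>))"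
    by (intro homologous_sum homologous_scale simplex keys)
  also have "\<dots> = (\<Sum>\<sigma>\<in>Poly_Mapping.keys c. rc_scale (Poly_Mapping.lookup c \<sigma>) (l \<sigma>))"
    using 0 by (simp add: rc_extend_def rc_scale_distrib(1) sum.distrib)
  finally have h: "c \<approx>\<^sub>h (\<Sum>\<sigma>\<in>Poly_Mapping.keys c. rc_scale (Poly_Mapping.lookup c \<sigma>) (l \<sigma>))" .
  have "combination mtopology loops K \<infinity> (\<Sum>\<sigma>\<in>Poly_Mapping.keys c. rc_scale (Poly_Mapping.lookup c \<sigma>) (l \<sigma>))"
  proof (intro combination_sum[OF K] combination_scale[OF K])
    fix \<sigma> assume "\<sigma> \<in> Poly_Mapping.keys c"
    then have n: "(\<forall>j\<le>N \<sigma>. p \<sigma> j \<in> M)" "(\<forall>j<N \<sigma>. Rel (p \<sigma> j) (p \<sigma> (Suc j)))" using Np keys by auto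
    show "combination mtopology loops K \<infinity> (l \<sigma>)"
      unfolding l_def
    proof (rule combination_sum[OF K])
      fix j assume "j \<in> {..<N \<sigma>}"
      then have "R (pr (p \<sigma> j)) (pr (p \<sigma> (Suc j)))" using Rel n by auto
      then show "combination mtopology loops K \<infinity> (loop (pr (p \<sigma> j)) (pr (p \<sigma> (Suc j))))"
        by (intro combination_mono[OF combination_basic[OF K finite_loops loop_in]]) auto
    qed
  qed (use cK in auto)
  then show ?thesis by (rule combination_homologous[OF _ h])
qed

lemma walk_map:
  assumes "successively (\<lambda>x y. d x y < \<eta> \<and> d (f x) (f y) < \<eta>) ps" "set ps \<subseteq> M"
  shows "real_chain_map 1 f (walk_sum E ps) \<approx>\<^sub>h walk_sum E (map f ps)"
  using assms
proof (induction ps rule: induct_list012)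
  case (3 x y zs)
  then have "real_chain_map 1 f (E x y) \<approx>\<^sub>h E (f x) (f y)"
    by (intro edge_map) (auto simp: successively_Cons)
  moreover have "real_chain_map 1 f (walk_sum E (y # zs)) \<approx>\<^sub>h walk_sum E (map f (y # zs))"
    using 3 by (auto simp: successively_Cons)
  ultimately show ?case
    using homologous_add by (simp add: real_chain_map_linear)
qed (auto simp: real_chain_map_linear)

lemma f_pow_M: "x \<in> M \<Longrightarrow> (f ^^ i) x \<in> M"
  by (induction i) (auto simp: f_M)

text \<open>Images of edges are replaced by edges after every single application of
  \<open>f\<close>, so closeness is required at all times up to \<open>i\<close>.\<close>

lemma walk_map_pow:
  assumes "set ps \<subseteq> M" "\<And>j. j \<le> i \<Longrightarrow> successively (\<lambda>x y. d x y < \<eta>) (map (f ^^ j) ps)"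
  shows "(real_chain_map 1 f ^^ i) (walk_sum E ps) \<approx>\<^sub>h walk_sum E (map (f ^^ i) ps)"
  using assms(2)
proof (induction i)
  case 0
  then show ?case by simp
next
  case (Suc i)
  have "(real_chain_map 1 f ^^ i) (walk_sum E ps) \<approx>\<^sub>h walk_sum E (map (f ^^ i) ps)"
    using Suc by simp
  then have "real_chain_map 1 f ((real_chain_map 1 f ^^ i) (walk_sum E ps)) \<approx>\<^sub>h real_chain_map 1 f (walk_sum E (map (f ^^ i) ps))"
    by (rule homologous_chain_map[OF _ cont])
  also have "real_chain_map 1 f (walk_sum E (map (f ^^ i) ps)) \<approx>\<^sub>h walk_sum E (map f (map (f ^^ i) ps))"
  proof (rule walk_map)
    show "set (map (f ^^ i) ps) \<subseteq> M" using assms(1) f_pow_M by auto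
    have "successively (\<lambda>x y. d ((f ^^ i) x) ((f ^^ i) y) < \<eta>) ps"
      "successively (\<lambda>x y. d ((f ^^ Suc i) x) ((f ^^ Suc i) y) < \<eta>) ps"
      using Suc.prems[of i] Suc.prems[of "Suc i"] by (auto simp: successively_map)
    then show "successively (\<lambda>x y. d x y < \<eta> \<and> d (f x) (f y) < \<eta>) (map (f ^^ i) ps)"
      by (auto simp: successively_map successively_conv_nth)
  qed
  finally show ?case by (simp add: comp_def)
qed

end

context lc_system
begin

lemma net_exists:
  assumes "edge_system \<eta> E" and fin: "finite V" and VM: "V \<subseteq> M" and sym: "\<And>u v. R u v \<Longrightarrow> R v u"
    and R: "\<And>u v. R u v \<Longrightarrow> u \<in> V \<and> v \<in> V \<and> d u v < \<eta>"
    and "\<And>x. x \<in> M \<Longrightarrow> pr x \<in> V"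
    and "\<And>x y. Rel x y \<Longrightarrow> x \<in> M \<Longrightarrow> y \<in> M \<Longrightarrow>
      d x y < \<eta> \<and> d x (pr x) < \<eta> \<and> d x (pr y) < \<eta> \<and> d y (pr y) < \<eta> \<and> R (pr x) (pr y)"
    and "\<And>x. x \<in> M \<Longrightarrow> \<exists>G. openin mtopology G \<and> x \<in> G \<and> (\<forall>y\<in>G. \<forall>z\<in>G. Rel y z)"
  shows "\<exists>P. net M d f \<eta> E V R P pr Rel"
proof -
  have "\<exists>P. (\<forall>v\<in>V. P v \<noteq> [] \<and> last (P v) = v \<and> set (P v) \<subseteq> V \<and> successively R (P v) \<and> length (P v) \<le> card V)
    \<and> (\<forall>u v. R u v \<longrightarrow> hd (P u) = hd (P v))"
    by (rule tree_paths_exist[OF fin]) (use sym R in auto)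
  then obtain P where P: "\<forall>v\<in>V. P v \<noteq> [] \<and> last (P v) = v \<and> set (P v) \<subseteq> V \<and> successively R (P v) \<and> length (P v) \<le> card V"
    "\<forall>u v. R u v \<longrightarrow> hd (P u) = hd (P v)" by blast
  have "net_axioms M d f \<eta> E V R P pr Rel"
  proof (rule net_axioms.intro)
    show "edge_system \<eta> E" "finite V" "V \<subseteq> M" by fact+
    show "u \<in> V \<and> v \<in> V \<and> d u v < \<eta>" if "R u v" for u v by (rule R[OF that])
    show "P v \<noteq> [] \<and> last (P v) = v \<and> set (P v) \<subseteq> V \<and> successively R (P v) \<and> length (P v) \<le> card V" if "v \<in> V" for v
      using P(1) that by (rule bspec)
    show "hd (P u) = hd (P v)" if "R u v" for u v using P(2) that by blast
  qed (fact assms)+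
  then show ?thesis
    by (intro exI[of _ P] net.intro lc_system_axioms)
qed

lemma continuous_f_pow: "continuous_map mtopology mtopology (f ^^ i)"
proof (induction i)
  case (Suc i)
  then show ?case unfolding funpow.simps by (rule continuous_map_compose[OF _ cont])
qed simp

lemma f_pow_in: "x \<in> M \<Longrightarrow> (f ^^ i) x \<in> M"
  using continuous_f_pow[of i] by (auto simp: continuous_map_def)

text \<open>Only finitely many iterates are involved and each is continuous. This allows simplices
  to be subdivided at a scale measured along all of them.\<close>

lemma open_dyn_ball:
  assumes x: "x \<in> M" and e: "e > 0"
  shows "\<exists>G. openin mtopology G \<and> x \<in> G \<and> (\<forall>y\<in>G. \<forall>z\<in>G. \<forall>i\<le>n. d ((f ^^ i) y) ((f ^^ i) z) < e)"
proof -
  let ?G = "\<Inter>i\<in>{..n}. {y \<in> topspace mtopology. (f ^^ i) y \<in> mball ((f ^^ i) x) (e / 2)}"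
  have oG: "openin mtopology ?G"
    by (intro openin_INT2 openin_continuous_map_preimage[OF continuous_f_pow openin_mball]) auto
  have xG: "x \<in> ?G" using x e f_pow_in by auto
  have dG: "d ((f ^^ i) y) ((f ^^ i) z) < e" if "y \<in> ?G" "z \<in> ?G" "i \<le> n" for y z i
  proof -
    have "(f ^^ i) y \<in> mball ((f ^^ i) x) (e / 2)" "(f ^^ i) z \<in> mball ((f ^^ i) x) (e / 2)"
      using that by auto
    then show ?thesis
      using triangle[of "(f ^^ i) y" "(f ^^ i) x" "(f ^^ i) z"] commute[of "(f ^^ i) x" "(f ^^ i) y"] by auto
  qed
  show ?thesis
    by (intro exI[of _ ?G] conjI ballI allI impI oG xG) (rule dG)
qed

lemma finite_net_exists:
  assumes "e > 0"
  shows "\<exists>F. finite F \<and> F \<subseteq> M \<and> (\<forall>y\<in>M. \<exists>x\<in>F. \<forall>i\<le>n. d ((f ^^ i) x) ((f ^^ i) y) \<le> e)"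
proof -
  have "\<forall>x\<in>M. \<exists>G. openin mtopology G \<and> x \<in> G \<and> (\<forall>y\<in>G. \<forall>z\<in>G. \<forall>i\<le>n. d ((f ^^ i) y) ((f ^^ i) z) < e)"
    using open_dyn_ball[OF _ assms] by blast
  from bchoice[OF this] obtain G where G: "\<forall>x\<in>M. openin mtopology (G x) \<and> x \<in> G x \<and>
      (\<forall>y\<in>G x. \<forall>z\<in>G x. \<forall>i\<le>n. d ((f ^^ i) y) ((f ^^ i) z) < e)"
    ..
  have "compactin mtopology M" using compact by (simp add: compact_space_def)
  moreover have "\<forall>U\<in>G ` M. openin mtopology U" "M \<subseteq> \<Union>(G ` M)" using G by auto
  ultimately obtain \<F> where F: "finite \<F>" "\<F> \<subseteq> G ` M" "M \<subseteq> \<Union>\<F>"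
    unfolding compactin_def by meson
  then obtain A where A: "finite A" "A \<subseteq> M" "\<F> = G ` A" by (meson finite_subset_image)
  have "\<exists>x\<in>A. \<forall>i\<le>n. d ((f ^^ i) x) ((f ^^ i) y) \<le> e" if "y \<in> M" for y
  proof -
    obtain x where x: "x \<in> A" "y \<in> G x" using F(3) A(3) \<open>y \<in> M\<close> by auto
    then have "x \<in> M" using A by auto
    then have "\<forall>i\<le>n. d ((f ^^ i) x) ((f ^^ i) y) < e" using G x by blast
    then show ?thesis using x by (intro bexI[of _ x]) (auto intro: less_imp_le)
  qed
  then show ?thesis using A by blast
qed

text \<open>The shadowing argument: a loop of edges that are short for the metric \<open>d\<^sub>n\<close> is mapped by
  \<open>f\<^sup>i\<close>, \<open>i \<le> n\<close>, to a loop of short edges of the same length, hence homologous to a combination of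
  boundedly many loops of a fixed net. A spanning tree makes all loops shorter than twice the
  number of vertices.\<close>

theorem spanning_set_homology_bound:
  "\<exists>S \<epsilon>. \<epsilon> > 0 \<and> finite S \<and> (\<forall>s\<in>S. s \<in> real_cycles 1 mtopology \<and> integral_chain s) \<and>
    (\<forall>c\<in>real_cycles 1 mtopology. combination mtopology S UNIV \<infinity> c) \<and>
    (\<forall>c\<in>real_cycles 1 mtopology. integral_chain c \<longrightarrow> combination mtopology S \<int> \<infinity> c) \<and>
    (\<forall>n A. finite A \<and> A \<subseteq> M \<and> (\<forall>y\<in>M. \<exists>x\<in>A. \<forall>i\<le>n. d ((f ^^ i) x) ((f ^^ i) y) \<le> \<epsilon>) \<longrightarrow>
      (\<exists>Z. finite Z \<and> (\<forall>z\<in>Z. z \<in> real_cycles 1 mtopology \<and> integral_chain z) \<and>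
        (\<forall>c\<in>real_cycles 1 mtopology. combination mtopology Z UNIV \<infinity> c) \<and>
        (\<forall>z\<in>Z. \<forall>i\<le>n. combination mtopology S UNIV (ereal (2 * real (card A))) ((real_chain_map 1 f ^^ i) z))))"
proof -
  obtain \<eta> E where es: "edge_system \<eta> E" using edge_system_exists by blast
  have \<eta>: "\<eta> > 0" using es by (simp add: edge_system_def)
  \<comment> \<open>Projecting to a net adds \<open>2 * \<epsilon>\<close> to a distance:
    \<open>\<epsilon>\<close> for close points, \<open>3 * \<epsilon>\<close> for adjacent vertices
    of \<open>A\<close>, \<open>5 * \<epsilon>\<close> for adjacent vertices of \<open>F\<close>.
    All remain below \<open>\<eta>\<close>.\<close>
  define \<epsilon> where "\<epsilon> = \<eta> / 8"
  have \<epsilon>: "\<epsilon> > 0" "8 * \<epsilon> = \<eta>" using \<eta> by (auto simp: \<epsilon>_def)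
  obtain F where F: "finite F" "F \<subseteq> M" "\<forall>y\<in>M. \<exists>x\<in>F. \<forall>i\<le>0::nat. d ((f ^^ i) x) ((f ^^ i) y) \<le> \<epsilon>"
    using finite_net_exists[OF \<epsilon>(1), of 0] by blast
  define pr0 where "pr0 = (\<lambda>y. SOME x. x \<in> F \<and> d x y \<le> \<epsilon>)"
  have pr0: "pr0 y \<in> F \<and> d (pr0 y) y \<le> \<epsilon>" if "y \<in> M" for y
    unfolding pr0_def by (rule someI_ex) (use F(3) that in auto)
  define R0 where "R0 = (\<lambda>u v. u \<in> F \<and> v \<in> F \<and> d u v < 5 * \<epsilon>)"
  have "\<exists>P0. net M d f \<eta> E F R0 P0 pr0 (\<lambda>x y. d x y < 3 * \<epsilon>)"
  proof (rule net_exists[OF es F(1,2)])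
    show "R0 v u" if "R0 u v" for u v using that commute[of u v] by (auto simp: R0_def)
    show "u \<in> F \<and> v \<in> F \<and> d u v < \<eta>" if "R0 u v" for u v using that \<epsilon> by (auto simp: R0_def)
    show "pr0 x \<in> F" if "x \<in> M" for x using pr0[OF that] by simp
    show "d x y < \<eta> \<and> d x (pr0 x) < \<eta> \<and> d x (pr0 y) < \<eta> \<and> d y (pr0 y) < \<eta> \<and> R0 (pr0 x) (pr0 y)"
      if xy: "d x y < 3 * \<epsilon>" "x \<in> M" "y \<in> M" for x y
    proof -
      have p: "pr0 x \<in> M" "pr0 y \<in> M" using pr0 xy F(2) by auto
      have q: "d x (pr0 x) \<le> \<epsilon>" "d y (pr0 y) \<le> \<epsilon>" "d (pr0 x) x \<le> \<epsilon>"
        using pr0[OF xy(2)] pr0[OF xy(3)] commute[of x "pr0 x"] commute[of y "pr0 y"] by auto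
      have "d x (pr0 y) \<le> d x y + d y (pr0 y)" "d (pr0 x) (pr0 y) \<le> d (pr0 x) x + d x (pr0 y)"
        using p xy by (auto intro!: triangle)
      then have "d x (pr0 y) < 4 * \<epsilon>" "d (pr0 x) (pr0 y) < 5 * \<epsilon>" using q xy(1) by linarith+
      then show ?thesis using q xy \<epsilon> pr0 by (auto simp: R0_def)
    qed
    show "\<exists>G. openin mtopology G \<and> x \<in> G \<and> (\<forall>y\<in>G. \<forall>z\<in>G. d y z < 3 * \<epsilon>)" if "x \<in> M" for x
      using open_dyn_ball[OF that, of "3 * \<epsilon>" 0] \<epsilon> by auto
  qed
  then obtain P0 where "net M d f \<eta> E F R0 P0 pr0 (\<lambda>x y. d x y < 3 * \<epsilon>)" ..
  then interpret N0: net M d f \<eta> E F R0 P0 pr0 "\<lambda>x y. d x y < 3 * \<epsilon>" .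
  have main: "\<exists>Z. finite Z \<and> (\<forall>z\<in>Z. z \<in> real_cycles 1 mtopology \<and> integral_chain z) \<and>
        (\<forall>c\<in>real_cycles 1 mtopology. combination mtopology Z UNIV \<infinity> c) \<and>
        (\<forall>z\<in>Z. \<forall>i\<le>n. combination mtopology N0.loops UNIV (ereal (2 * real (card A))) ((real_chain_map 1 f ^^ i) z))"
    if A: "finite A" "A \<subseteq> M" "\<forall>y\<in>M. \<exists>x\<in>A. \<forall>i\<le>n. d ((f ^^ i) x) ((f ^^ i) y) \<le> \<epsilon>" for n A
  proof -
    define pr where "pr = (\<lambda>y. SOME x. x \<in> A \<and> (\<forall>i\<le>n. d ((f ^^ i) x) ((f ^^ i) y) \<le> \<epsilon>))"
    have pr: "pr y \<in> A \<and> (\<forall>i\<le>n. d ((f ^^ i) (pr y)) ((f ^^ i) y) \<le> \<epsilon>)" if "y \<in> M" for y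
      unfolding pr_def by (rule someI_ex) (use A(3) that in auto)
    \<comment> \<open>\<open>3 * \<epsilon>\<close> is exactly the closeness used by the fixed net,
      so at every time \<open>i \<le> n\<close> the image of an edge of \<open>A\<close> can be
      reduced there.\<close>
    define R where "R = (\<lambda>u v. u \<in> A \<and> v \<in> A \<and> (\<forall>i\<le>n. d ((f ^^ i) u) ((f ^^ i) v) < 3 * \<epsilon>))"
    define Rel where "Rel = (\<lambda>x y. \<forall>i\<le>n. d ((f ^^ i) x) ((f ^^ i) y) < \<epsilon>)"
    have "\<exists>P. net M d f \<eta> E A R P pr Rel"
    proof (rule net_exists[OF es A(1,2)])
      show "R v u" if "R u v" for u v using that commute by (simp add: R_def)
      show "u \<in> A \<and> v \<in> A \<and> d u v < \<eta>" if "R u v" for u v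
      proof -
        have "d ((f ^^ 0) u) ((f ^^ 0) v) < 3 * \<epsilon>" using that unfolding R_def by blast
        then show ?thesis using that \<epsilon> by (auto simp: R_def)
      qed
      show "pr x \<in> A" if "x \<in> M" for x using pr[OF that] by simp
      show "d x y < \<eta> \<and> d x (pr x) < \<eta> \<and> d x (pr y) < \<eta> \<and> d y (pr y) < \<eta> \<and> R (pr x) (pr y)"
        if xy: "Rel x y" "x \<in> M" "y \<in> M" for x y
      proof -
        have p: "pr x \<in> M" "pr y \<in> M" using pr xy A(2) by auto
        have *: "d ((f ^^ i) x) ((f ^^ i) (pr x)) \<le> \<epsilon> \<and> d ((f ^^ i) y) ((f ^^ i) (pr y)) \<le> \<epsilon> \<and>
            d ((f ^^ i) x) ((f ^^ i) y) < \<epsilon> \<and> d ((f ^^ i) x) ((f ^^ i) (pr y)) < 2 * \<epsilon> \<and>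
            d ((f ^^ i) (pr x)) ((f ^^ i) (pr y)) < 3 * \<epsilon>" if "i \<le> n" for i
        proof -
          have q: "d ((f ^^ i) x) ((f ^^ i) (pr x)) \<le> \<epsilon>" "d ((f ^^ i) y) ((f ^^ i) (pr y)) \<le> \<epsilon>"
            "d ((f ^^ i) (pr x)) ((f ^^ i) x) \<le> \<epsilon>" "d ((f ^^ i) x) ((f ^^ i) y) < \<epsilon>"
            using pr[OF xy(2)] pr[OF xy(3)] xy(1)[unfolded Rel_def] that
              commute[of "(f ^^ i) x" "(f ^^ i) (pr x)"] commute[of "(f ^^ i) y" "(f ^^ i) (pr y)"]
            by simp_all
          moreover have "d ((f ^^ i) x) ((f ^^ i) (pr y)) \<le> d ((f ^^ i) x) ((f ^^ i) y) + d ((f ^^ i) y) ((f ^^ i) (pr y))"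
            "d ((f ^^ i) (pr x)) ((f ^^ i) (pr y)) \<le> d ((f ^^ i) (pr x)) ((f ^^ i) x) + d ((f ^^ i) x) ((f ^^ i) (pr y))"
            using p xy f_pow_in by (auto intro!: triangle)
          ultimately show ?thesis by linarith
        qed
        have "R (pr x) (pr y)" using * pr xy by (auto simp: R_def)
        then show ?thesis using *[of 0] \<epsilon> by auto
      qed
      show "\<exists>G. openin mtopology G \<and> x \<in> G \<and> (\<forall>y\<in>G. \<forall>z\<in>G. Rel y z)" if "x \<in> M" for x
        unfolding Rel_def by (rule open_dyn_ball[OF that \<epsilon>(1)])
    qed
    then obtain P where "net M d f \<eta> E A R P pr Rel" ..
    then interpret N1: net M d f \<eta> E A R P pr Rel .
    \<comment> \<open>The image of a walk is homologous to the walk through the image points, for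
      which the fixed net spends one loop per edge.\<close>
    have reduce: "\<exists>L. set L \<subseteq> N0.loops \<and> Suc (length L) = length ps \<and>
        homologous mtopology ((real_chain_map 1 f ^^ i) (walk_sum E ps))
          (N0.tail ((f ^^ i) (hd ps)) - N0.tail ((f ^^ i) (last ps)) + sum_list L)"
      if ps: "successively R ps" "ps \<noteq> []" "set ps \<subseteq> A" and i: "i \<le> n" for ps i
    proof -
      have sM: "set ps \<subseteq> M" using ps A by auto
      have s: "successively (\<lambda>x y. d x y < 3 * \<epsilon>) (map (f ^^ j) ps)" if "j \<le> n" for j
        unfolding successively_map by (rule successively_mono[OF ps(1)]) (use that in \<open>auto simp: R_def\<close>)
      have "successively (\<lambda>x y. d x y < \<eta>) (map (f ^^ j) ps)" if "j \<le> i" for j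
        by (rule successively_mono[OF s]) (use that i \<epsilon> in auto)
      then have 1: "homologous mtopology ((real_chain_map 1 f ^^ i) (walk_sum E ps)) (walk_sum E (map (f ^^ i) ps))"
        by (rule N0.walk_map_pow[OF sM])
      have "set (map (f ^^ i) ps) \<subseteq> M" using sM f_pow_in by auto
      then obtain L where L: "set L \<subseteq> N0.loops" "Suc (length L) = length (map (f ^^ i) ps)"
        "homologous mtopology (walk_sum E (map (f ^^ i) ps))
          (N0.tail (hd (map (f ^^ i) ps)) - N0.tail (last (map (f ^^ i) ps)) + sum_list L)"
        using N0.walk_reduction[OF s[OF i]] ps(2) by auto
      show ?thesis
        using L homologous_trans[OF 1 L(3)] ps(2) by (intro exI[of _ L]) (auto simp: hd_map last_map)
    qed
    have lin: "(real_chain_map 1 f ^^ i) (a + b - c) = (real_chain_map 1 f ^^ i) a + (real_chain_map 1 f ^^ i) b - (real_chain_map 1 f ^^ i) c"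
      for i and a b c :: "'a real_chain"
      by (induction i) (auto simp: real_chain_map_linear)
    have bound: "combination mtopology N0.loops UNIV (ereal (2 * real (card A))) ((real_chain_map 1 f ^^ i) z)"
      if z: "z \<in> N1.loops" and i: "i \<le> n" for z i
    proof -
      obtain u v where uv: "R u v" "z = N1.loop u v" using z by (auto simp: N1.loops_def)
      have A': "u \<in> A" "v \<in> A" using uv by (auto simp: R_def)
      have hd: "hd (P u) = hd (P v)" by (rule N1.hdP[OF uv(1)])
      note Pu = N1.P[OF A'(1)] and Pv = N1.P[OF A'(2)]
      obtain L1 where L1: "set L1 \<subseteq> N0.loops" "Suc (length L1) = length (P u)"
        "homologous mtopology ((real_chain_map 1 f ^^ i) (walk_sum E (P u)))
          (N0.tail ((f ^^ i) (hd (P u))) - N0.tail ((f ^^ i) u) + sum_list L1)"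
        using reduce[of "P u" i] Pu i by auto
      obtain L2 where L2: "set L2 \<subseteq> N0.loops" "Suc (length L2) = length (P v)"
        "homologous mtopology ((real_chain_map 1 f ^^ i) (walk_sum E (P v)))
          (N0.tail ((f ^^ i) (hd (P v))) - N0.tail ((f ^^ i) v) + sum_list L2)"
        using reduce[of "P v" i] Pv i by auto
      obtain L3 where L3: "set L3 \<subseteq> N0.loops" "Suc (length L3) = length [u, v]"
        "homologous mtopology ((real_chain_map 1 f ^^ i) (E u v))
          (N0.tail ((f ^^ i) u) - N0.tail ((f ^^ i) v) + sum_list L3)"
        using reduce[of "[u, v]" i] uv(1) A' i by auto
      \<comment> \<open>All tails cancel: both paths start at the same root, and the edge joins
        their ends.\<close>
      have "homologous mtopology ((real_chain_map 1 f ^^ i) z) (sum_list L1 + sum_list L3 - sum_list L2)"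
        using homologous_diff[OF homologous_add[OF L1(3) L3(3)] L2(3)]
        unfolding uv(2) N1.loop_def lin by (simp add: hd)
      moreover have "combination mtopology N0.loops UNIV (ereal (real (length L1)) + ereal (real (length L3)) + ereal (real (length L2)))
          (sum_list L1 + sum_list L3 - sum_list L2)"
        using L1 L2 L3 N0.finite_loops
        by (intro combination_diff combination_add combination_sum_list subring_UNIV_Ints)
      \<comment> \<open>A path with at most \<open>card A\<close> vertices has at most
        \<open>card A - 1\<close> edges, and the edge from \<open>u\<close> to \<open>v\<close> adds
        one.\<close>
      moreover have "length L1 + length L3 + length L2 \<le> 2 * card A"
        using L1 L2 L3 Pu Pv by simp
      then have "ereal (real (length L1)) + ereal (real (length L3)) + ereal (real (length L2)) \<le> ereal (2 * real (card A))"
        by simp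
      ultimately show ?thesis
        by (meson combination_homologous combination_mono)
    qed
    show ?thesis
      using N1.finite_loops N1.loops_cycles N1.cycle_combination[OF _ subring_UNIV_Ints(1)] bound
      by (intro exI[of _ N1.loops]) auto
  qed
  show ?thesis
  proof (rule exI[of _ N0.loops], rule exI[of _ \<epsilon>], intro conjI)
    show "\<epsilon> > 0" by (rule \<epsilon>(1))
    show "finite N0.loops" by (rule N0.finite_loops)
    show "\<forall>s\<in>N0.loops. s \<in> real_cycles 1 mtopology \<and> integral_chain s"
      using N0.loops_cycles by blast
    show "\<forall>c\<in>real_cycles 1 mtopology. combination mtopology N0.loops UNIV \<infinity> c"
      using N0.cycle_combination[OF _ subring_UNIV_Ints(1)] by simp
    show "\<forall>c\<in>real_cycles 1 mtopology. integral_chain c \<longrightarrow> combination mtopology N0.loops \<int> \<infinity> c"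
      using N0.cycle_combination[OF _ subring_UNIV_Ints(2)] by (auto simp: integral_chain_def)
  qed (use main in blast)
qed

end

subsection \<open>Real homology as a vector space\<close>

declare One_nat_def [simp del]

abbreviation (input) h_class :: "'a topology \<Rightarrow> 'a real_chain \<Rightarrow> 'a real_chain set" where
  "h_class X c \<equiv> real_homology_class 1 X c"

lemma real_homology_class_eq_iff: "h_class X a = h_class X b \<longleftrightarrow> a - b \<in> real_boundaries 1 X"
proof
  note B = rc_subspaceD[OF rc_subspace_real_boundaries]
  assume "h_class X a = h_class X b"
  moreover have "a + 0 \<in> h_class X a" unfolding real_homology_class_def using B(1) by (rule imageI)
  ultimately show "a - b \<in> real_boundaries 1 X" by (auto simp: real_homology_class_def)
next
  note B = rc_subspaceD[OF rc_subspace_real_boundaries]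
  assume ab: "a - b \<in> real_boundaries 1 X"
  show "h_class X a = h_class X b"
    unfolding real_homology_class_def
  proof safe
    fix c assume c: "c \<in> real_boundaries 1 X"
    show "a + c \<in> (+) b ` real_boundaries 1 X"
      by (rule image_eqI[of _ _ "(a - b) + c"]) (simp, rule B(2)[OF ab c])
    show "b + c \<in> (+) a ` real_boundaries 1 X"
      by (rule image_eqI[of _ _ "c - (a - b)"]) (simp, rule B(5)[OF c ab])
  qed
qed

lemma in_real_homology_class: "a \<in> h_class X c \<longleftrightarrow> a - c \<in> real_boundaries 1 X"
  unfolding real_homology_class_def by (auto intro!: image_eqI[of a _ "a - c"])

lemma real_homology_class_self: "c \<in> h_class X c"
  unfolding in_real_homology_class using rc_subspaceD(1)[OF rc_subspace_real_boundaries] by simp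

text \<open>Addition of classes is a union over representatives; all members of the union are the
  same class, so it collapses.\<close>

lemma real_homology_add:
  "h_class X a \<oplus>\<^bsub>real_homology 1 X\<^esub> h_class X b = h_class X (a + b)"
proof -
  note B = rc_subspaceD[OF rc_subspace_real_boundaries]
  have "h_class X (a' + b') = h_class X (a + b)" if "a' \<in> h_class X a" "b' \<in> h_class X b" for a' b'
    using B(2)[of "a' - a" 1 X "b' - b"] that
    by (simp only: real_homology_class_eq_iff in_real_homology_class) (simp add: algebra_simps)
  then have "(\<Union>a'\<in>h_class X a. \<Union>b'\<in>h_class X b. h_class X (a' + b'))
      = (\<Union>a'\<in>h_class X a. \<Union>b'\<in>h_class X b. h_class X (a + b))"
    by (intro SUP_cong refl)
  then show ?thesis
    using real_homology_class_self[of a X] real_homology_class_self[of b X]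
    by (auto simp: real_homology_def)
qed

lemma real_homology_smult:
  "r \<odot>\<^bsub>real_homology 1 X\<^esub> h_class X a = h_class X (rc_scale r a)"
proof -
  note B = rc_subspaceD[OF rc_subspace_real_boundaries]
  have "h_class X (rc_scale r a') = h_class X (rc_scale r a)" if "a' \<in> h_class X a" for a'
    using B(3)[of "a' - a" 1 X r] that
    by (simp only: real_homology_class_eq_iff in_real_homology_class rc_scale_distrib)
  then have "(\<Union>a'\<in>h_class X a. h_class X (rc_scale r a')) = (\<Union>a'\<in>h_class X a. h_class X (rc_scale r a))"
    by (intro SUP_cong refl)
  then show ?thesis
    using real_homology_class_self[of a X] by (auto simp: real_homology_def)
qed

lemma real_homology_carrier_zero:
  "carrier (real_homology 1 X) = h_class X ` real_cycles 1 X"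
  "\<zero>\<^bsub>real_homology 1 X\<^esub> = h_class X 0"
  by (simp_all add: real_homology_def)

lemma real_hom_induced_class:
  assumes "continuous_map X X f"
  shows "real_hom_induced 1 X f (h_class X c) = h_class X (real_chain_map 1 f c)"
proof -
  have "h_class X (real_chain_map 1 f a) = h_class X (real_chain_map 1 f c)" if "a \<in> h_class X c" for a
    using real_chain_map_boundaries[of "a - c" 1 X X f] that assms
    by (simp only: real_homology_class_eq_iff in_real_homology_class real_chain_map_linear)
  then show ?thesis
    using real_homology_class_self[of c X] unfolding real_hom_induced_def by blast
qed

lemma vectorspace_real_homology: "vectorspace class_ring (real_homology 1 X)"
proof -
  let ?V = "real_homology 1 X"
  note Z = rc_subspaceD[OF rc_subspace_real_cycles[of 1 X]]
  note ops = real_homology_add real_homology_smult real_homology_carrier_zero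
  have "abelian_group ?V"
  proof (rule abelian_groupI)
    show "x \<oplus>\<^bsub>?V\<^esub> y \<in> carrier ?V" if "x \<in> carrier ?V" "y \<in> carrier ?V" for x y
      using that Z(2) by (auto simp: ops simp del: One_nat_def)
    show "\<zero>\<^bsub>?V\<^esub> \<in> carrier ?V" using Z(1) by (auto simp: ops simp del: One_nat_def)
    show "(x \<oplus>\<^bsub>?V\<^esub> y) \<oplus>\<^bsub>?V\<^esub> z = x \<oplus>\<^bsub>?V\<^esub> (y \<oplus>\<^bsub>?V\<^esub> z)"
      if "x \<in> carrier ?V" "y \<in> carrier ?V" "z \<in> carrier ?V" for x y z
      using that by (auto simp: ops add.assoc simp del: One_nat_def)
    show "x \<oplus>\<^bsub>?V\<^esub> y = y \<oplus>\<^bsub>?V\<^esub> x" if "x \<in> carrier ?V" "y \<in> carrier ?V" for x y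
      using that by (auto simp: ops add.commute simp del: One_nat_def)
    show "\<zero>\<^bsub>?V\<^esub> \<oplus>\<^bsub>?V\<^esub> x = x" if "x \<in> carrier ?V" for x
      using that by (auto simp: ops simp del: One_nat_def)
    show "\<exists>y\<in>carrier ?V. y \<oplus>\<^bsub>?V\<^esub> x = \<zero>\<^bsub>?V\<^esub>" if "x \<in> carrier ?V" for x
    proof -
      obtain c where c: "c \<in> real_cycles 1 X" "x = h_class X c" using \<open>x \<in> carrier ?V\<close> by (auto simp: ops simp del: One_nat_def)
      show ?thesis
        by (rule bexI[of _ "h_class X (- c)"]) (use c Z(4) in \<open>simp_all add: ops del: One_nat_def\<close>)
    qed
  qed
  then have "module class_ring ?V"
  proof (intro moduleI)
    show "cring (class_ring :: real ring)"
      using VS_Connect.class_field unfolding field_def domain_def by auto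
  qed (use Z(3) in \<open>auto simp: ops rc_scale_distrib simp del: One_nat_def\<close>)
  then show ?thesis
    unfolding vectorspace_def using VS_Connect.class_field by auto
qed

lemma mat_mult_unit_vec_index:
  fixes A :: "'b::semiring_1 mat"
  assumes "A \<in> carrier_mat m n" "i < m" "j < n"
  shows "(A *\<^sub>v unit_vec n j) $ i = A $$ (i, j)"
  using assms by simp

text \<open>The basis is kept as a list of cycles, with independence and spanning modulo boundaries.
  Coordinates are then functions of cycles, and integrality of chains stays visible.\<close>

locale homology_basis =
  fixes X :: "'a topology" and f :: "'a \<Rightarrow> 'a" and bs :: "'a real_chain list"
  assumes bs_cycles: "set bs \<subseteq> real_cycles 1 X"
    and indep: "\<And>a i. (\<Sum>i<length bs. rc_scale (a i) (bs ! i)) \<in> real_boundaries 1 X \<Longrightarrow> i < length bs \<Longrightarrow> a i = 0"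
    and spanning: "\<And>c. c \<in> real_cycles 1 X \<Longrightarrow> \<exists>a. c - (\<Sum>i<length bs. rc_scale (a i) (bs ! i)) \<in> real_boundaries 1 X"
    and cont: "continuous_map X X f"
begin

abbreviation "r \<equiv> length bs"
abbreviation "H \<equiv> real_homology 1 X"

definition coords :: "'a real_chain \<Rightarrow> real vec" where
  "coords c = vec r (SOME a. c - (\<Sum>i<r. rc_scale (a i) (bs ! i)) \<in> real_boundaries 1 X)"

lemma coords_carrier [simp]: "coords c \<in> carrier_vec r" "dim_vec (coords c) = r"
  by (simp_all add: coords_def)

lemma coords_decomposition:
  assumes "c \<in> real_cycles 1 X"
  shows "c - (\<Sum>i<r. rc_scale (coords c $ i) (bs ! i)) \<in> real_boundaries 1 X"
proof -
  let ?a = "SOME a. c - (\<Sum>i<r. rc_scale (a i) (bs ! i)) \<in> real_boundaries 1 X"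
  have "c - (\<Sum>i<r. rc_scale (?a i) (bs ! i)) \<in> real_boundaries 1 X"
    by (rule someI_ex[OF spanning[OF assms]])
  moreover have "(\<Sum>i<r. rc_scale (coords c $ i) (bs ! i)) = (\<Sum>i<r. rc_scale (?a i) (bs ! i))"
    by (rule sum.cong) (auto simp: coords_def)
  ultimately show ?thesis by simp
qed

lemma coords_eqI:
  assumes c: "c \<in> real_cycles 1 X" and a: "c - (\<Sum>i<r. rc_scale (a i) (bs ! i)) \<in> real_boundaries 1 X"
  shows "coords c = vec r a"
proof (rule eq_vecI)
  fix i assume "i < dim_vec (vec r a)"
  then have i: "i < r" by simp
  have "(c - (\<Sum>i<r. rc_scale (coords c $ i) (bs ! i))) - (c - (\<Sum>i<r. rc_scale (a i) (bs ! i))) \<in> real_boundaries 1 X"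
    by (rule rc_subspaceD(5)[OF rc_subspace_real_boundaries coords_decomposition[OF c] a])
  then have "(\<Sum>i<r. rc_scale (a i - coords c $ i) (bs ! i)) \<in> real_boundaries 1 X"
    by (simp add: rc_scale_distrib sum_subtractf)
  from indep[OF this i] show "coords c $ i = vec r a $ i" using i by simp
qed simp

lemma coords_add:
  assumes "a \<in> real_cycles 1 X" "b \<in> real_cycles 1 X"
  shows "coords (a + b) = coords a + coords b"
proof -
  have "(a - (\<Sum>i<r. rc_scale (coords a $ i) (bs ! i))) + (b - (\<Sum>i<r. rc_scale (coords b $ i) (bs ! i))) \<in> real_boundaries 1 X"
    by (intro rc_subspaceD(2)[OF rc_subspace_real_boundaries] coords_decomposition assms)
  then have "a + b - (\<Sum>i<r. rc_scale (coords a $ i + coords b $ i) (bs ! i)) \<in> real_boundaries 1 X"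
    by (simp add: rc_scale_distrib(2) sum.distrib algebra_simps)
  from coords_eqI[OF rc_subspaceD(2)[OF rc_subspace_real_cycles assms] this] show ?thesis
    by (auto intro!: eq_vecI)
qed

lemma coords_scale:
  assumes "a \<in> real_cycles 1 X"
  shows "coords (rc_scale s a) = s \<cdot>\<^sub>v coords a"
proof -
  have "rc_scale s (a - (\<Sum>i<r. rc_scale (coords a $ i) (bs ! i))) \<in> real_boundaries 1 X"
    by (intro rc_subspaceD(3)[OF rc_subspace_real_boundaries] coords_decomposition assms)
  then have "rc_scale s a - (\<Sum>i<r. rc_scale (s * coords a $ i) (bs ! i)) \<in> real_boundaries 1 X"
    by (simp add: rc_scale_distrib(3) rc_scale_sum)
  from coords_eqI[OF rc_subspaceD(3)[OF rc_subspace_real_cycles assms] this] show ?thesis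
    by (auto intro!: eq_vecI)
qed

lemma coords_eq_iff:
  assumes "a \<in> real_cycles 1 X" "b \<in> real_cycles 1 X"
  shows "coords a = coords b \<longleftrightarrow> a - b \<in> real_boundaries 1 X"
proof
  assume "coords a = coords b"
  then show "a - b \<in> real_boundaries 1 X"
    using rc_subspaceD(5)[OF rc_subspace_real_boundaries coords_decomposition[OF assms(1)] coords_decomposition[OF assms(2)]]
    by simp
next
  assume "a - b \<in> real_boundaries 1 X"
  from rc_subspaceD(2)[OF rc_subspace_real_boundaries this coords_decomposition[OF assms(2)]]
  have "a - (\<Sum>i<r. rc_scale (coords b $ i) (bs ! i)) \<in> real_boundaries 1 X" by simp
  from coords_eqI[OF assms(1) this] show "coords a = coords b" by (auto intro!: eq_vecI)
qed

lemma coords_0: "coords 0 = 0\<^sub>v r"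
proof -
  have "0 - (\<Sum>i<r. rc_scale 0 (bs ! i)) \<in> real_boundaries 1 X"
    using rc_subspaceD(1)[OF rc_subspace_real_boundaries] by simp
  from coords_eqI[OF rc_subspaceD(1)[OF rc_subspace_real_cycles] this] show ?thesis
    by (auto intro!: eq_vecI)
qed

lemma coords_sum:
  assumes "\<And>i. i \<in> I \<Longrightarrow> g i \<in> real_cycles 1 X" and l: "l < r"
  shows "coords (\<Sum>i\<in>I. rc_scale (a i) (g i)) $ l = (\<Sum>i\<in>I. a i * coords (g i) $ l)"
  using assms(1)
proof (induction I rule: infinite_finite_induct)
  case (insert i I)
  have 1: "rc_scale (a i) (g i) \<in> real_cycles 1 X" "(\<Sum>i\<in>I. rc_scale (a i) (g i)) \<in> real_cycles 1 X"
    using insert.prems by (auto intro!: rc_subspaceD(3)[OF rc_subspace_real_cycles] rc_subspace_sum[OF rc_subspace_real_cycles])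
  have "coords (g i) $ l * a i = (a i \<cdot>\<^sub>v coords (g i)) $ l" using l by simp
  then show ?case
    using insert l by (simp add: coords_add[OF 1] coords_scale)
qed (use l in \<open>simp_all add: coords_0\<close>)

lemma bs_in: "i < r \<Longrightarrow> bs ! i \<in> real_cycles 1 X"
  using bs_cycles nth_mem by blast

lemma coords_bs:
  assumes "i < r"
  shows "coords (bs ! i) = unit_vec r i"
proof -
  have "(\<Sum>j<r. rc_scale (if j = i then 1 else 0) (bs ! j)) = (\<Sum>j<r. if j = i then bs ! i else 0)"
    by (rule sum.cong) auto
  then have "bs ! i - (\<Sum>j<r. rc_scale (if j = i then 1 else 0) (bs ! j)) \<in> real_boundaries 1 X"
    using assms rc_subspaceD(1)[OF rc_subspace_real_boundaries] by simp
  from coords_eqI[OF bs_in[OF assms] this] show ?thesis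
    using assms by (auto simp: unit_vec_def)
qed

definition fmat :: "real mat" where
  "fmat = mat r r (\<lambda>(i, j). coords (real_chain_map 1 f (bs ! j)) $ i)"

lemma fmat_carrier [simp]: "fmat \<in> carrier_mat r r"
  by (simp add: fmat_def)

lemma f_cycles: "c \<in> real_cycles 1 X \<Longrightarrow> real_chain_map 1 f c \<in> real_cycles 1 X"
  using real_chain_map_cycles cont by blast

lemma coords_chain_map:
  assumes c: "c \<in> real_cycles 1 X"
  shows "coords (real_chain_map 1 f c) = fmat *\<^sub>v coords c"
proof (rule eq_vecI)
  fix l assume "l < dim_vec (fmat *\<^sub>v coords c)"
  then have l: "l < r" by (simp add: fmat_def)
  let ?s = "\<Sum>i<r. rc_scale (coords c $ i) (bs ! i)"
  have s: "?s \<in> real_cycles 1 X"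
    by (intro rc_subspace_sum[OF rc_subspace_real_cycles] rc_subspaceD(3)[OF rc_subspace_real_cycles] bs_in) simp
  have "real_chain_map 1 f c - real_chain_map 1 f ?s \<in> real_boundaries 1 X"
    using real_chain_map_boundaries[OF coords_decomposition[OF c] cont] by (simp add: real_chain_map_linear)
  then have "coords (real_chain_map 1 f c) = coords (real_chain_map 1 f ?s)"
    using coords_eq_iff f_cycles c s by blast
  also have "real_chain_map 1 f ?s = (\<Sum>i<r. rc_scale (coords c $ i) (real_chain_map 1 f (bs ! i)))"
    by (simp add: real_chain_map_sum real_chain_map_linear)
  also have "coords \<dots> $ l = (\<Sum>i<r. coords c $ i * coords (real_chain_map 1 f (bs ! i)) $ l)"
    by (rule coords_sum[OF _ l]) (use bs_in f_cycles in auto)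
  also have "\<dots> = (fmat *\<^sub>v coords c) $ l"
    using l by (simp add: fmat_def scalar_prod_def atLeast0LessThan mult.commute)
  finally show "coords (real_chain_map 1 f c) $ l = (fmat *\<^sub>v coords c) $ l" .
qed (simp add: fmat_def)

lemma coords_chain_map_pow:
  assumes c: "c \<in> real_cycles 1 X"
  shows "(real_chain_map 1 f ^^ i) c \<in> real_cycles 1 X \<and> coords ((real_chain_map 1 f ^^ i) c) = fmat ^\<^sub>m i *\<^sub>v coords c"
proof (induction i)
  case 0
  then show ?case using c by (simp add: fmat_def one_mult_mat_vec[of _ r] carrier_matD[OF fmat_carrier])
next
  case (Suc i)
  have p: "fmat ^\<^sub>m i \<in> carrier_mat r r" by simp
  have "fmat ^\<^sub>m i * fmat = fmat * fmat ^\<^sub>m i"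
    using pow_mat_add[OF fmat_carrier, of 1 i] by (simp add: One_nat_def)
  then have "fmat ^\<^sub>m Suc i *\<^sub>v coords c = fmat *\<^sub>v (fmat ^\<^sub>m i *\<^sub>v coords c)"
    using assoc_mult_mat_vec[OF fmat_carrier p coords_carrier(1)] by simp
  moreover have "coords (real_chain_map 1 f ((real_chain_map 1 f ^^ i) c)) = fmat *\<^sub>v coords ((real_chain_map 1 f ^^ i) c)"
    using Suc by (intro coords_chain_map) simp
  ultimately show ?case using Suc f_cycles by (simp add: comp_def del: pow_mat.simps)
qed

subsubsection \<open>Matrices of the induced map\<close>

interpretation V: vectorspace class_ring H
  by (rule vectorspace_real_homology)

definition class_coords :: "'a real_chain set \<Rightarrow> real vec" where
  "class_coords A = coords (SOME c. c \<in> real_cycles 1 X \<and> A = h_class X c)"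

lemma class_coords_class:
  assumes "c \<in> real_cycles 1 X"
  shows "class_coords (h_class X c) = coords c"
proof -
  let ?c = "SOME c'. c' \<in> real_cycles 1 X \<and> h_class X c = h_class X c'"
  have "?c \<in> real_cycles 1 X \<and> h_class X c = h_class X ?c"
    by (rule someI[of _ c]) (use assms in simp)
  then have c: "?c \<in> real_cycles 1 X" "c - ?c \<in> real_boundaries 1 X"
    unfolding real_homology_class_eq_iff by blast+
  then have "coords c = coords ?c" using coords_eq_iff[OF assms c(1)] by blast
  then show ?thesis unfolding class_coords_def by simp
qed

lemma class_coords_carrier [simp]: "class_coords A \<in> carrier_vec r" "dim_vec (class_coords A) = r"
  by (simp_all add: class_coords_def)

lemma H_cases:
  assumes "A \<in> carrier H"
  obtains c where "c \<in> real_cycles 1 X" "A = h_class X c"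
  using assms unfolding real_homology_carrier_zero by blast

lemma class_coords_inj:
  assumes "A \<in> carrier H" "B \<in> carrier H" "class_coords A = class_coords B"
  shows "A = B"
  using assms by (elim H_cases) (simp add: class_coords_class coords_eq_iff real_homology_class_eq_iff del: One_nat_def)

lemma class_coords_add:
  assumes "A \<in> carrier H" "B \<in> carrier H"
  shows "class_coords (A \<oplus>\<^bsub>H\<^esub> B) = class_coords A + class_coords B"
  using assms rc_subspaceD(2)[OF rc_subspace_real_cycles[of 1 X]]
  by (elim H_cases) (simp add: class_coords_class coords_add real_homology_add del: One_nat_def)

lemma class_coords_smult:
  assumes "A \<in> carrier H"
  shows "class_coords (s \<odot>\<^bsub>H\<^esub> A) = s \<cdot>\<^sub>v class_coords A"
  using assms rc_subspaceD(3)[OF rc_subspace_real_cycles[of 1 X]]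
  by (elim H_cases) (simp add: class_coords_class coords_scale real_homology_smult del: One_nat_def)

lemma class_coords_zero: "class_coords \<zero>\<^bsub>H\<^esub> = 0\<^sub>v r"
  using rc_subspaceD(1)[OF rc_subspace_real_cycles[of 1 X]]
  by (simp add: real_homology_carrier_zero class_coords_class coords_0 del: One_nat_def)

lemma class_coords_finsum:
  assumes "finite I" "\<And>i. i \<in> I \<Longrightarrow> g i \<in> carrier H" and l: "l < r"
  shows "class_coords (\<Oplus>\<^bsub>H\<^esub>i\<in>I. a i \<odot>\<^bsub>H\<^esub> g i) $ l = (\<Sum>i\<in>I. a i * class_coords (g i) $ l)"
  using assms(1,2)
proof (induction I rule: finite_induct)
  case empty
  then show ?case using l by (simp add: class_coords_zero)
next
  case (insert i I)
  have 1: "(\<lambda>i. a i \<odot>\<^bsub>H\<^esub> g i) \<in> I \<rightarrow> carrier H" "a i \<odot>\<^bsub>H\<^esub> g i \<in> carrier H"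
    using insert.prems V.smult_closed by auto
  have 2: "(\<Oplus>\<^bsub>H\<^esub>i\<in>insert i I. a i \<odot>\<^bsub>H\<^esub> g i) = a i \<odot>\<^bsub>H\<^esub> g i \<oplus>\<^bsub>H\<^esub> (\<Oplus>\<^bsub>H\<^esub>i\<in>I. a i \<odot>\<^bsub>H\<^esub> g i)"
    by (rule V.finsum_insert[OF insert(1,2) 1])
  have 3: "(\<Oplus>\<^bsub>H\<^esub>i\<in>I. a i \<odot>\<^bsub>H\<^esub> g i) \<in> carrier H" by (rule V.finsum_closed[OF 1(1)])
  show ?case
    unfolding 2 class_coords_add[OF 1(2) 3]
    using insert l by (simp add: class_coords_smult)
qed

lemma class_coords_induced:
  assumes "A \<in> carrier H"
  shows "class_coords (real_hom_induced 1 X f A) = fmat *\<^sub>v class_coords A" "real_hom_induced 1 X f A \<in> carrier H"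
  using assms f_cycles
  by (elim H_cases; simp add: real_hom_induced_class[OF cont] class_coords_class coords_chain_map real_homology_carrier_zero del: One_nat_def)+

lemma classes_in_H: "h_class X ` set bs \<subseteq> carrier H"
  using bs_cycles unfolding real_homology_carrier_zero by blast

lemma zero_in_H: "\<zero>\<^bsub>H\<^esub> \<in> carrier H"
  unfolding real_homology_carrier_zero using rc_subspaceD(1)[OF rc_subspace_real_cycles] by (rule imageI)

lemma distinct_classes: "distinct (map (h_class X) bs)"
proof -
  have "h_class X (bs ! i) \<noteq> h_class X (bs ! j)" if "i < r" "j < r" "i \<noteq> j" for i j
  proof
    assume "h_class X (bs ! i) = h_class X (bs ! j)"
    then have "unit_vec r i = (unit_vec r j :: real vec)"
      using that class_coords_class[OF bs_in] coords_bs by metis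
    then have "(unit_vec r i :: real vec) $ i = unit_vec r j $ i" by simp
    then show False using that by simp
  qed
  then show ?thesis by (auto simp: distinct_conv_nth)
qed

lemma basis_iff_invertible:
  assumes dist: "distinct cs" and cs: "set cs \<subseteq> carrier H"
  defines "P \<equiv> mat r (length cs) (\<lambda>(l, j). class_coords (cs ! j) $ l)"
  shows "V.basis (set cs) \<longleftrightarrow> length cs = r \<and> (\<exists>Q. Q \<in> carrier_mat r r \<and> P * Q = 1\<^sub>m r \<and> Q * P = 1\<^sub>m r)"
proof -
  let ?n = "length cs"
  have P: "P \<in> carrier_mat r ?n" by (simp add: P_def)
  have inj: "inj_on ((!) cs) {..<?n}" using dist by (simp add: inj_on_nth)
  have set_cs: "set cs = (!) cs ` {..<?n}" by (auto simp: set_conv_nth)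
  have lc: "class_coords (V.lincomb a (set cs)) $ l = (P *\<^sub>v vec ?n (\<lambda>j. a (cs ! j))) $ l" if l: "l < r" for a l
  proof -
    have "class_coords (V.lincomb a (set cs)) $ l = (\<Sum>v\<in>set cs. a v * class_coords v $ l)"
      unfolding V.lincomb_def by (rule class_coords_finsum[OF _ _ l]) (use cs in auto)
    also have "\<dots> = (\<Sum>j<?n. a (cs ! j) * class_coords (cs ! j) $ l)"
      unfolding set_cs by (subst sum.reindex[OF inj]) simp
    finally show ?thesis
      using l by (simp add: P_def scalar_prod_def atLeast0LessThan mult.commute)
  qed
  then have lcv: "class_coords (V.lincomb a (set cs)) = P *\<^sub>v vec ?n (\<lambda>j. a (cs ! j))" for a
    by (intro eq_vecI) (auto simp: P_def)
  have lcin: "V.lincomb a (set cs) \<in> carrier H" for a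
    by (rule V.lincomb_closed) (use cs in auto)
  \<comment> \<open>Turns a vector of coefficients into a coefficient function on
    \<open>set cs\<close>; the index is unique because \<open>cs\<close> is distinct.\<close>
  define ind where "ind = (\<lambda>y v. y $ (THE j. j < ?n \<and> cs ! j = v) :: real)"
  have ind: "vec ?n (\<lambda>j. ind y (cs ! j)) = y" if "y \<in> carrier_vec ?n" for y
  proof (rule eq_vecI)
    fix j assume "j < dim_vec y"
    then have j: "j < ?n" using that by simp
    then have "(THE j'. j' < ?n \<and> cs ! j' = cs ! j) = j"
      using dist by (auto simp: nth_eq_iff_index_eq)
    then show "vec ?n (\<lambda>j. ind y (cs ! j)) $ j = y $ j" using j by (simp add: ind_def)
  qed (use that in simp)
  have injective: "\<not> V.lin_dep (set cs) \<longleftrightarrow> (\<forall>y\<in>carrier_vec ?n. P *\<^sub>v y = 0\<^sub>v r \<longrightarrow> y = 0\<^sub>v ?n)"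
  proof
    assume li: "\<not> V.lin_dep (set cs)"
    show "\<forall>y\<in>carrier_vec ?n. P *\<^sub>v y = 0\<^sub>v r \<longrightarrow> y = 0\<^sub>v ?n"
    proof (intro ballI impI)
      fix y assume y: "y \<in> carrier_vec ?n" "P *\<^sub>v y = 0\<^sub>v r"
      have "class_coords (V.lincomb (ind y) (set cs)) = class_coords \<zero>\<^bsub>H\<^esub>"
        unfolding lcv ind[OF y(1)] class_coords_zero by (rule y(2))
      then have "V.lincomb (ind y) (set cs) = \<zero>\<^bsub>H\<^esub>"
        by (intro class_coords_inj lcin zero_in_H)
      then have "ind y v = 0" if "v \<in> set cs" for v
        using li that unfolding V.lin_dep_def by (auto simp: Pi_def)
      then have "vec ?n (\<lambda>j. ind y (cs ! j)) = 0\<^sub>v ?n" by (auto intro!: eq_vecI)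
      then show "y = 0\<^sub>v ?n" using ind[OF y(1)] by simp
    qed
  next
    assume *: "\<forall>y\<in>carrier_vec ?n. P *\<^sub>v y = 0\<^sub>v r \<longrightarrow> y = 0\<^sub>v ?n"
    show "\<not> V.lin_dep (set cs)"
    proof
      assume "V.lin_dep (set cs)"
      from V.finite_lin_dep[OF _ this] cs obtain a v where a: "V.lincomb a (set cs) = \<zero>\<^bsub>H\<^esub>" "v \<in> set cs" "a v \<noteq> 0"
        by auto
      have "P *\<^sub>v vec ?n (\<lambda>j. a (cs ! j)) = 0\<^sub>v r"
        using lcv[of a] a(1) class_coords_zero by simp
      then have "vec ?n (\<lambda>j. a (cs ! j)) = 0\<^sub>v ?n" using * by simp
      moreover obtain j where "j < ?n" "cs ! j = v" using a(2) by (auto simp: in_set_conv_nth)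
      ultimately show False using a(3) by (metis index_vec index_zero_vec(1))
    qed
  qed
  have surjective: "V.span (set cs) = carrier H \<longleftrightarrow> (\<forall>x\<in>carrier_vec r. \<exists>y\<in>carrier_vec ?n. P *\<^sub>v y = x)"
  proof
    assume sp: "V.span (set cs) = carrier H"
    show "\<forall>x\<in>carrier_vec r. \<exists>y\<in>carrier_vec ?n. P *\<^sub>v y = x"
    proof
      fix x :: "real vec" assume x: "x \<in> carrier_vec r"
      let ?c = "\<Sum>i<r. rc_scale (x $ i) (bs ! i)"
      have c: "?c \<in> real_cycles 1 X"
        by (intro rc_subspace_sum[OF rc_subspace_real_cycles] rc_subspaceD(3)[OF rc_subspace_real_cycles] bs_in) simp
      have "coords ?c = vec r (\<lambda>i. x $ i)"
        by (rule coords_eqI[OF c]) (simp add: rc_subspaceD(1)[OF rc_subspace_real_boundaries])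
      then have cx: "coords ?c = x" using x by auto
      have "h_class X ?c \<in> V.span (set cs)" unfolding sp real_homology_carrier_zero using c by (rule imageI)
      then obtain a where "h_class X ?c = V.lincomb a (set cs)"
        using V.finite_span[of "set cs"] cs by auto
      then have "P *\<^sub>v vec ?n (\<lambda>j. a (cs ! j)) = x"
        using lcv[of a] class_coords_class[OF c] cx by metis
      then show "\<exists>y\<in>carrier_vec ?n. P *\<^sub>v y = x" by (intro bexI[of _ "vec ?n (\<lambda>j. a (cs ! j))"]) auto
    qed
  next
    assume *: "\<forall>x\<in>carrier_vec r. \<exists>y\<in>carrier_vec ?n. P *\<^sub>v y = x"
    have "A \<in> V.span (set cs)" if A: "A \<in> carrier H" for A
    proof -
      obtain y where y: "y \<in> carrier_vec ?n" "P *\<^sub>v y = class_coords A" using * class_coords_carrier by blast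
      have "class_coords (V.lincomb (ind y) (set cs)) = class_coords A"
        unfolding lcv ind[OF y(1)] by (rule y(2))
      then have "A = V.lincomb (ind y) (set cs)" using class_coords_inj lcin A by metis
      then show ?thesis using V.finite_span[of "set cs"] cs by (auto simp: Pi_def)
    qed
    then show "V.span (set cs) = carrier H" using V.span_is_subset2[OF cs] by blast
  qed
  show ?thesis
  proof
    assume "V.basis (set cs)"
    then have b: "\<forall>y\<in>carrier_vec ?n. P *\<^sub>v y = 0\<^sub>v r \<longrightarrow> y = 0\<^sub>v ?n" "\<forall>x\<in>carrier_vec r. \<exists>y\<in>carrier_vec ?n. P *\<^sub>v y = x"
      unfolding V.basis_def injective surjective by auto
    then have "\<exists>y. y \<in> carrier_vec ?n \<and> P *\<^sub>v y = unit_vec r i" for i by (metis unit_vec_carrier)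
    then obtain q where q: "\<And>i. q i \<in> carrier_vec ?n" "\<And>i. P *\<^sub>v q i = unit_vec r i" by metis
    define Q where "Q = mat ?n r (\<lambda>(j, i). q i $ j)"
    have Q: "Q \<in> carrier_mat ?n r" by (simp add: Q_def)
    have colQ: "col Q i = q i" if "i < r" for i
      using that q(1)[of i] by (intro eq_vecI) (auto simp: Q_def)
    have PQ: "P * Q = 1\<^sub>m r"
    proof (rule eq_matI)
      fix l i assume "l < dim_row (1\<^sub>m r :: real mat)" "i < dim_col (1\<^sub>m r :: real mat)"
      then have li: "l < r" "i < r" by auto
      have "(P * Q) $$ (l, i) = (P *\<^sub>v col Q i) $ l" using li P Q by simp
      then show "(P * Q) $$ (l, i) = 1\<^sub>m r $$ (l, i)" using li by (simp add: colQ q(2))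
    qed (use P Q in auto)
    have QP: "Q * P = 1\<^sub>m ?n"
    proof -
      have e: "Q *\<^sub>v (P *\<^sub>v y) = y" if y: "y \<in> carrier_vec ?n" for y
      proof -
        have Py: "P *\<^sub>v y \<in> carrier_vec r" by (rule mult_mat_vec_carrier[OF P y])
        have QPy: "Q *\<^sub>v (P *\<^sub>v y) \<in> carrier_vec ?n" by (rule mult_mat_vec_carrier[OF Q Py])
        have "P *\<^sub>v (Q *\<^sub>v (P *\<^sub>v y)) = P *\<^sub>v y"
          using assoc_mult_mat_vec[OF P Q Py] PQ Py by simp
        then have "P *\<^sub>v (Q *\<^sub>v (P *\<^sub>v y) - y) = 0\<^sub>v r"
          using mult_minus_distrib_mat_vec[OF P QPy y] Py by simp
        then have z: "Q *\<^sub>v (P *\<^sub>v y) - y = 0\<^sub>v ?n" using b(1) QPy y by simp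
        show ?thesis
        proof (rule eq_vecI)
          fix i assume "i < dim_vec y"
          then show "(Q *\<^sub>v (P *\<^sub>v y)) $ i = y $ i"
            using arg_cong[OF z, of "\<lambda>v. v $ i"] y QPy by simp
        qed (use carrier_matD(1)[OF Q] y in simp)
      qed
      show ?thesis
      proof (rule eq_matI)
        fix i j assume "i < dim_row (1\<^sub>m ?n :: real mat)" "j < dim_col (1\<^sub>m ?n :: real mat)"
        then have ij: "i < ?n" "j < ?n" by auto
        have "Q * P \<in> carrier_mat ?n ?n" using P Q by simp
        from mat_mult_unit_vec_index[OF this ij]
        have "(Q * P) $$ (i, j) = ((Q * P) *\<^sub>v unit_vec ?n j) $ i" ..
        also have "(Q * P) *\<^sub>v unit_vec ?n j = Q *\<^sub>v (P *\<^sub>v unit_vec ?n j)"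
          by (rule assoc_mult_mat_vec[OF Q P]) simp
        finally show "(Q * P) $$ (i, j) = 1\<^sub>m ?n $$ (i, j)"
          using e[of "unit_vec ?n j"] ij by simp
      qed (use P Q in auto)
    qed
    \<comment> \<open>The traces of \<open>P * Q\<close> and \<open>Q * P\<close> agree, so the two
      bases have the same length.\<close>
    have "real r = (\<Sum>i<r. (P * Q) $$ (i, i))" unfolding PQ by simp
    also have "\<dots> = (\<Sum>i<r. \<Sum>j<?n. P $$ (i, j) * Q $$ (j, i))"
      using P Q by (intro sum.cong) (auto simp: scalar_prod_def atLeast0LessThan)
    also have "\<dots> = (\<Sum>j<?n. \<Sum>i<r. P $$ (i, j) * Q $$ (j, i))" by (rule sum.swap)
    also have "\<dots> = (\<Sum>j<?n. (Q * P) $$ (j, j))"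
      using P Q by (intro sum.cong) (auto simp: scalar_prod_def atLeast0LessThan mult.commute)
    also have "\<dots> = real ?n" unfolding QP by simp
    finally have "?n = r" by simp
    then show "length cs = r \<and> (\<exists>Q. Q \<in> carrier_mat r r \<and> P * Q = 1\<^sub>m r \<and> Q * P = 1\<^sub>m r)"
      using Q PQ QP by auto
  next
    assume "length cs = r \<and> (\<exists>Q. Q \<in> carrier_mat r r \<and> P * Q = 1\<^sub>m r \<and> Q * P = 1\<^sub>m r)"
    then obtain Q where n: "?n = r" and Q: "Q \<in> carrier_mat r r" "P * Q = 1\<^sub>m r" "Q * P = 1\<^sub>m r" by auto
    have P': "P \<in> carrier_mat r r" using P n by simp
    have "y = 0\<^sub>v ?n" if "y \<in> carrier_vec ?n" "P *\<^sub>v y = 0\<^sub>v r" for y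
    proof -
      have "Q *\<^sub>v (P *\<^sub>v y) = y"
        using assoc_mult_mat_vec[OF Q(1) P', of y] Q(3) that n by simp
      then show ?thesis using that Q(1) n by (auto intro!: eq_vecI simp: scalar_prod_def)
    qed
    moreover have "\<exists>y\<in>carrier_vec ?n. P *\<^sub>v y = x" if x: "x \<in> carrier_vec r" for x
      using assoc_mult_mat_vec[OF P' Q(1) x] Q(1,2) x n
      by (intro bexI[of _ "Q *\<^sub>v x"]) (auto intro!: mult_mat_vec_carrier)
    ultimately show "V.basis (set cs)"
      unfolding V.basis_def injective surjective using cs by auto
  qed
qed

text \<open>The base change \<open>P\<close> intertwines \<open>A\<close> and \<open>fmat\<close>.
  Hence what depends only on the similarity class may be computed from \<open>fmat\<close>.\<close>

lemma represents_endo_similar: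
  assumes "represents_endo A H (real_hom_induced 1 X f)"
  shows "similar_mat A fmat"
proof -
  obtain cs where cs: "distinct cs" "V.basis (set cs)" "A \<in> carrier_mat (length cs) (length cs)"
    "\<And>j. j < length cs \<Longrightarrow> real_hom_induced 1 X f (cs ! j) = (\<Oplus>\<^bsub>H\<^esub>i\<in>{..<length cs}. (A $$ (i, j)) \<odot>\<^bsub>H\<^esub> (cs ! i))"
    using assms unfolding represents_endo_def by blast
  have csH: "set cs \<subseteq> carrier H" using cs(2) by (simp add: V.basis_def)
  define P where "P = mat r (length cs) (\<lambda>(l, j). class_coords (cs ! j) $ l)"
  obtain Q where n: "length cs = r" and Q: "Q \<in> carrier_mat r r" "P * Q = 1\<^sub>m r" "Q * P = 1\<^sub>m r"
    using cs(2) unfolding basis_iff_invertible[OF cs(1) csH] P_def by blast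
  have P: "P \<in> carrier_mat r r" by (simp add: P_def n)
  have A: "A \<in> carrier_mat r r" using cs(3) n by simp
  have "fmat * P = P * A"
  proof (rule eq_matI)
    fix l j assume "l < dim_row (P * A)" "j < dim_col (P * A)"
    then have lj: "l < r" "j < r" using P A by auto
    have colP: "col P j = class_coords (cs ! j)"
      using lj n by (intro eq_vecI) (auto simp: P_def)
    have "(fmat * P) $$ (l, j) = (fmat *\<^sub>v col P j) $ l" using lj P carrier_matD[OF fmat_carrier] by simp
    also have "\<dots> = class_coords (real_hom_induced 1 X f (cs ! j)) $ l"
    proof -
      have "cs ! j \<in> carrier H" using nth_mem[of j cs] csH lj(2) n by auto
      from class_coords_induced(1)[OF this] show ?thesis unfolding colP by simp
    qed
    also have "\<dots> = (\<Sum>i<length cs. A $$ (i, j) * class_coords (cs ! i) $ l)"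
    proof -
      have "real_hom_induced 1 X f (cs ! j) = (\<Oplus>\<^bsub>H\<^esub>i\<in>{..<length cs}. (A $$ (i, j)) \<odot>\<^bsub>H\<^esub> (cs ! i))"
        using cs(4) lj(2) n by simp
      then have e: "class_coords (real_hom_induced 1 X f (cs ! j)) $ l
          = class_coords (\<Oplus>\<^bsub>H\<^esub>i\<in>{..<length cs}. (A $$ (i, j)) \<odot>\<^bsub>H\<^esub> (cs ! i)) $ l" by (rule arg_cong)
      have in_H: "cs ! i \<in> carrier H" if "i \<in> {..<length cs}" for i
        using nth_mem[of i cs] csH that by (meson lessThan_iff subsetD)
      show ?thesis unfolding e by (rule class_coords_finsum[OF finite_lessThan in_H lj(1)])
    qed
    also have "\<dots> = (P * A) $$ (l, j)"
      using lj P A n by (simp add: P_def scalar_prod_def atLeast0LessThan mult.commute)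
    finally show "(fmat * P) $$ (l, j) = (P * A) $$ (l, j)" .
  qed (use P A carrier_matD[OF fmat_carrier] in auto)
  then have "Q * fmat * P = Q * (P * A)" using assoc_mult_mat[OF Q(1) fmat_carrier P] by simp
  also have "\<dots> = A" using assoc_mult_mat[OF Q(1) P A] Q(3) A by simp
  finally show ?thesis
    using A P Q by (intro similar_matI[of _ _ Q P r]) auto
qed

lemma represents_endo_fmat: "represents_endo fmat H (real_hom_induced 1 X f)"
proof -
  let ?cs = "map (h_class X) bs"
  have cls: "class_coords (?cs ! j) = unit_vec r j" if "j < r" for j
    using that class_coords_class[OF bs_in[OF that]] coords_bs[OF that] by simp
  have csH: "set ?cs \<subseteq> carrier H" using classes_in_H by simp
  have "mat r (length ?cs) (\<lambda>(l, j). class_coords (?cs ! j) $ l) = 1\<^sub>m r"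
    by (rule eq_matI) (simp_all add: cls del: nth_map)
  then have "V.basis (set ?cs)"
    unfolding basis_iff_invertible[OF distinct_classes csH] by (auto intro!: exI[of _ "1\<^sub>m r"])
  moreover have "real_hom_induced 1 X f (?cs ! j) = (\<Oplus>\<^bsub>H\<^esub>i\<in>{..<length ?cs}. (fmat $$ (i, j)) \<odot>\<^bsub>H\<^esub> (?cs ! i))"
    if j: "j < length ?cs" for j
  proof (rule class_coords_inj)
    have jr: "j < r" using j by simp
    have inH: "?cs ! i \<in> carrier H" if "i < r" for i using csH that by (metis length_map nth_mem subsetD)
    show "real_hom_induced 1 X f (?cs ! j) \<in> carrier H" by (rule class_coords_induced(2)[OF inH[OF jr]])
    show "(\<Oplus>\<^bsub>H\<^esub>i\<in>{..<length ?cs}. (fmat $$ (i, j)) \<odot>\<^bsub>H\<^esub> (?cs ! i)) \<in> carrier H"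
      by (rule V.finsum_closed) (use inH V.smult_closed in auto)
    show "class_coords (real_hom_induced 1 X f (?cs ! j)) = class_coords (\<Oplus>\<^bsub>H\<^esub>i\<in>{..<length ?cs}. (fmat $$ (i, j)) \<odot>\<^bsub>H\<^esub> (?cs ! i))"
    proof (rule eq_vecI)
      fix l assume "l < dim_vec (class_coords (\<Oplus>\<^bsub>H\<^esub>i\<in>{..<length ?cs}. (fmat $$ (i, j)) \<odot>\<^bsub>H\<^esub> (?cs ! i)))"
      then have l: "l < r" by simp
      have "class_coords (\<Oplus>\<^bsub>H\<^esub>i\<in>{..<length ?cs}. (fmat $$ (i, j)) \<odot>\<^bsub>H\<^esub> (?cs ! i)) $ l
          = (\<Sum>i<length ?cs. fmat $$ (i, j) * class_coords (?cs ! i) $ l)"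
        by (rule class_coords_finsum[OF _ _ l]) (use inH in auto)
      also have "\<dots> = (\<Sum>i<r. if i = l then fmat $$ (l, j) else 0)"
        using cls l by (intro sum.cong) (auto simp del: nth_map)
      also have "\<dots> = fmat $$ (l, j)" using l by simp
      also have "\<dots> = (fmat *\<^sub>v unit_vec r j) $ l"
        using l jr carrier_matD[OF fmat_carrier] by simp
      finally show "class_coords (real_hom_induced 1 X f (?cs ! j)) $ l
          = class_coords (\<Oplus>\<^bsub>H\<^esub>i\<in>{..<length ?cs}. (fmat $$ (i, j)) \<odot>\<^bsub>H\<^esub> (?cs ! i)) $ l"
        unfolding class_coords_induced(1)[OF inH[OF jr]] cls[OF jr] by simp
    qed simp
  qed
  ultimately show ?thesis
    unfolding represents_endo_def using distinct_classes by (intro exI[of _ ?cs]) auto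
qed

text \<open>All representing matrices are similar, so they have the same size and the same
  characteristic polynomial; the definite description is therefore justified.\<close>

lemma endo_spectral_radius_fmat: "endo_spectral_radius H (real_hom_induced 1 X f) = real_spectral_radius fmat"
proof -
  have "real_spectral_radius A = real_spectral_radius fmat" if "represents_endo A H (real_hom_induced 1 X f)" for A
  proof -
    have sim: "similar_mat A fmat" by (rule represents_endo_similar[OF that])
    obtain n where "A \<in> carrier_mat n n" "fmat \<in> carrier_mat n n"
      using similar_matD[OF sim] unfolding insert_subset by metis
    then have A: "A \<in> carrier_mat r r" using carrier_matD(1)[OF fmat_carrier] by auto
    let ?h = "map_mat complex_of_real"
    have cp: "char_poly (?h A) = char_poly (?h fmat)"
      by (rule char_poly_similar[OF similar_mat_of_real[OF sim]])
    have c: "?h A \<in> carrier_mat r r" "?h fmat \<in> carrier_mat r r" using A by auto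
    have "spectrum (?h A) = spectrum (?h fmat)"
      unfolding spectrum_def eigenvalue_root_char_poly[OF c(1)] eigenvalue_root_char_poly[OF c(2)] cp ..
    moreover have "dim_row A = dim_row fmat" using A by (simp add: fmat_def)
    ultimately show ?thesis by (simp add: real_spectral_radius_def spectral_radius_def)
  qed
  note radius = this
  show ?thesis
    unfolding endo_spectral_radius_def
  proof (rule the_equality)
    show "\<exists>A. represents_endo A H (real_hom_induced 1 X f) \<and> real_spectral_radius fmat = real_spectral_radius A"
      using represents_endo_fmat by blast
    show "x = real_spectral_radius fmat"
      if "\<exists>A. represents_endo A H (real_hom_induced 1 X f) \<and> x = real_spectral_radius A" for x
      using that radius by blast
  qed
qed

end

subsection \<open>A basis of integral cycles\<close>

text \<open>A spanning subset of least cardinality is independent: a relation with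
  \<open>a i \<noteq> 0\<close> would allow \<open>bs ! i\<close> to be dropped. Choosing inside
  \<open>S\<close> makes the basis consist of integral cycles.\<close>

lemma homology_basis_exists:
  fixes X :: "'a topology"
  assumes S: "finite S" "S \<subseteq> real_cycles 1 X"
    and span: "\<And>c. c \<in> real_cycles 1 X \<Longrightarrow> combination X S UNIV \<infinity> c"
    and cont: "continuous_map X X f"
  shows "\<exists>bs. set bs \<subseteq> S \<and> homology_basis X f bs"
proof -
  define G where "G = (\<lambda>T. T \<subseteq> S \<and> (\<forall>c\<in>real_cycles 1 X. combination X T UNIV \<infinity> c))"
  have "\<exists>T. G T \<and> (\<forall>T'. G T' \<longrightarrow> card T \<le> card T')"
    by (rule ex_has_least_nat[of G S]) (use span in \<open>auto simp: G_def\<close>)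
  then obtain T where T: "T \<subseteq> S" "\<And>c. c \<in> real_cycles 1 X \<Longrightarrow> combination X T UNIV \<infinity> c"
    and least: "\<And>T'. G T' \<Longrightarrow> card T \<le> card T'" by (auto simp: G_def)
  have finT: "finite T" using S T(1) finite_subset by blast
  obtain bs where bs: "set bs = T" "distinct bs" using finite_distinct_list[OF finT] by blast
  have bij: "bij_betw ((!) bs) {..<length bs} T" by (rule bij_betw_nth[OF bs(2) refl bs(1)[symmetric]])
  have reindex: "(\<Sum>s\<in>T. rc_scale (a s) s) = (\<Sum>i<length bs. rc_scale (a (bs ! i)) (bs ! i))" for a
    using sum.reindex_bij_betw[OF bij, of "\<lambda>s. rc_scale (a s) s"] by simp
  have "homology_basis X f bs"
  proof
    show "set bs \<subseteq> real_cycles 1 X" using bs T S by auto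
    show "continuous_map X X f" by (rule cont)
    show "\<exists>a. c - (\<Sum>i<length bs. rc_scale (a i) (bs ! i)) \<in> real_boundaries 1 X" if c: "c \<in> real_cycles 1 X" for c
    proof -
      obtain a where "homologous X c (\<Sum>s\<in>T. rc_scale (a s) s)" using T(2)[OF c] unfolding combination_def by blast
      then show ?thesis unfolding reindex homologous_def by (intro exI[of _ "\<lambda>i. a (bs ! i)"])
    qed
    fix a i assume B: "(\<Sum>i<length bs. rc_scale (a i) (bs ! i)) \<in> real_boundaries 1 X" and i: "i < length bs"
    show "a i = 0"
    proof (rule ccontr)
      assume ai: "a i \<noteq> 0"
      define \<alpha> where "\<alpha> = (\<lambda>s. a (inv_into {..<length bs} ((!) bs) s))"
      have \<alpha>: "\<alpha> (bs ! j) = a j" if "j < length bs" for j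
        using inv_into_f_f[OF bij_betw_imp_inj_on[OF bij], of j] that by (simp add: \<alpha>_def)
      let ?t = "bs ! i" and ?T = "T - {bs ! i}"
      have t: "?t \<in> T" using i bs by auto
      have "(\<Sum>i<length bs. rc_scale (\<alpha> (bs ! i)) (bs ! i)) = (\<Sum>i<length bs. rc_scale (a i) (bs ! i))"
        by (rule sum.cong) (auto simp: \<alpha>)
      then have "(\<Sum>s\<in>T. rc_scale (\<alpha> s) s) \<in> real_boundaries 1 X"
        unfolding reindex using B by simp
      then have "rc_scale (a i) ?t + (\<Sum>s\<in>?T. rc_scale (\<alpha> s) s) \<in> real_boundaries 1 X"
        by (simp add: sum.remove[OF finT t] \<alpha>[OF i])
      from rc_subspaceD(3)[OF rc_subspace_real_boundaries this, of "1 / a i"]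
      have "?t - (\<Sum>s\<in>?T. rc_scale (- (\<alpha> s / a i)) s) \<in> real_boundaries 1 X"
        using ai by (simp add: rc_scale_distrib rc_scale_sum sum_negf)
      then have "combination X ?T UNIV \<infinity> ?t"
        unfolding combination_def homologous_def by (intro exI[of _ "\<lambda>s. - (\<alpha> s / a i)"]) auto
      moreover have "combination X ?T UNIV \<infinity> s" if "s \<in> ?T" for s
        by (rule combination_mono[OF combination_basic]) (use that finT subring_UNIV_Ints in auto)
      ultimately have sT: "combination X ?T UNIV \<infinity> s" if "s \<in> T" for s
        using that by (cases "s = ?t") auto
      have "combination X ?T UNIV \<infinity> c" if c: "c \<in> real_cycles 1 X" for c
      proof -
        obtain b where b: "homologous X c (\<Sum>s\<in>T. rc_scale (b s) s)" using T(2)[OF c] unfolding combination_def by blast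
        have "combination X ?T UNIV \<infinity> (\<Sum>s\<in>T. rc_scale (b s) s)"
          by (intro combination_sum combination_scale sT subring_UNIV_Ints) auto
        then show ?thesis by (rule combination_homologous[OF _ b])
      qed
      then have "G ?T" using T(1) by (auto simp: G_def)
      then have "card T \<le> card ?T" by (rule least)
      then show False using card_Diff1_less[OF finT t] by simp
    qed
  qed
  then show ?thesis using bs T(1) by blast
qed

lemma common_denominator:
  fixes Q :: "real set"
  assumes "finite Q" "Q \<subseteq> \<rat>"
  shows "\<exists>D>0::int. \<forall>x\<in>Q. of_int D * x \<in> \<int>"
  using assms
proof (induction Q rule: finite_induct)
  case (insert x Q)
  then obtain D where D: "D > 0" "\<forall>x\<in>Q. of_int D * x \<in> \<int>" by auto
  obtain a b :: int where ab: "b > 0" "x = of_int a / of_int b"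
    using insert.prems by (auto elim: Rats_cases')
  have "of_int (D * b) * x = of_int (D * a)" using ab by simp
  then have "of_int (D * b) * x \<in> \<int>" by (metis Ints_of_int)
  moreover have "of_int (D * b) * y \<in> \<int>" if "y \<in> Q" for y
  proof -
    have "of_int (D * b) * y = of_int b * (of_int D * y)" by simp
    also have "\<dots> \<in> \<int>" by (rule Ints_mult) (use D(2) that in auto)
    finally show ?thesis .
  qed
  ultimately show ?case using D(1) ab(1) by (intro exI[of _ "D * b"]) (auto simp del: of_int_mult)
qed (auto intro!: exI[of _ 1])

lemma integral_chain_scale: "integral_chain c \<Longrightarrow> x \<in> \<int> \<Longrightarrow> integral_chain (rc_scale x c)"
  by (simp add: integral_chain_def)

lemma integral_chain_sum: "(\<And>i. i \<in> I \<Longrightarrow> integral_chain (g i)) \<Longrightarrow> integral_chain (sum g I)"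
  by (simp add: integral_chain_def lookup_sum Ints_sum)

lemma integral_chain_chain_map:
  assumes "integral_chain c"
  shows "integral_chain (real_chain_map p f c)"
proof -
  have "integral_chain (Poly_Mapping.single x 1)" for x :: "(nat \<Rightarrow> real) \<Rightarrow> 'b"
    by (auto simp: integral_chain_def lookup_single when_def)
  then show ?thesis
    unfolding real_chain_map_def rc_extend_def
    by (intro integral_chain_sum integral_chain_scale) (use assms in \<open>auto simp: integral_chain_def\<close>)
qed

context homology_basis
begin

text \<open>The finitely many elements of \<open>S\<close> have rational coordinates, by
  \<open>rational_relation\<close> and uniqueness of coordinates. A common denominator for them
  serves all integral cycles, since these are integral combinations of \<open>S\<close> up to
  homology.\<close>

lemma integral_coords_denominator:
  assumes S: "finite S" "\<And>s. s \<in> S \<Longrightarrow> s \<in> real_cycles 1 X \<and> integral_chain s" and bsS: "set bs \<subseteq> S"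
    and comb: "\<And>c. c \<in> real_cycles 1 X \<Longrightarrow> integral_chain c \<Longrightarrow> combination X S \<int> \<infinity> c"
  shows "\<exists>D>0::int. \<forall>c l. c \<in> real_cycles 1 X \<longrightarrow> integral_chain c \<longrightarrow> l < r \<longrightarrow> of_int D * coords c $ l \<in> \<int>"
proof -
  have rat: "coords s $ l \<in> \<rat>" if s: "s \<in> S" and l: "l < r" for s l
  proof -
    have "\<exists>b. (\<forall>i. b i \<in> \<rat>) \<and> s - (\<Sum>i<r. rc_scale (b i) (bs ! i)) \<in> real_boundaries 1 X"
    proof (rule rational_relation)
      show "integral_chain (bs ! i)" if "i \<in> {..<r}" for i using S(2) bsS that nth_mem by auto
      show "s - (\<Sum>i<r. rc_scale (coords s $ i) (bs ! i)) \<in> real_boundaries 1 X"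
        using S(2)[OF s] by (intro coords_decomposition) simp
    qed (use S(2)[OF s] in auto)
    then obtain b where "\<forall>i. b i \<in> \<rat>" "s - (\<Sum>i<r. rc_scale (b i) (bs ! i)) \<in> real_boundaries 1 X" by blast
    then show ?thesis using coords_eqI[of s b] S(2)[OF s] l by simp
  qed
  have "finite ((\<lambda>(s, l). coords s $ l) ` (S \<times> {..<r}))" using S(1) by simp
  from common_denominator[OF this] rat obtain D where D: "D > 0" "\<And>s l. s \<in> S \<Longrightarrow> l < r \<Longrightarrow> of_int D * coords s $ l \<in> \<int>"
    by force
  have "of_int D * coords c $ l \<in> \<int>" if c: "c \<in> real_cycles 1 X" "integral_chain c" and l: "l < r" for c l
  proof -
    obtain a where a: "\<forall>s. a s \<in> \<int>" "homologous X c (\<Sum>s\<in>S. rc_scale (a s) s)"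
      using comb[OF c] unfolding combination_def by blast
    have "(\<Sum>s\<in>S. rc_scale (a s) s) \<in> real_cycles 1 X"
      using S(2) by (intro rc_subspace_sum[OF rc_subspace_real_cycles] rc_subspaceD(3)[OF rc_subspace_real_cycles]) auto
    then have "coords c = coords (\<Sum>s\<in>S. rc_scale (a s) s)"
      using a(2) coords_eq_iff c(1) by (simp add: homologous_def)
    then have "of_int D * coords c $ l = of_int D * (\<Sum>s\<in>S. a s * coords s $ l)"
      using coords_sum[of S "\<lambda>s. s" l a] S(2) l by simp
    also have "\<dots> = (\<Sum>s\<in>S. a s * (of_int D * coords s $ l))"
      by (simp add: sum_distrib_left mult_ac)
    also have "\<dots> \<in> \<int>"
    proof (rule Ints_sum)
      fix s assume "s \<in> S"
      then show "a s * (of_int D * coords s $ l) \<in> \<int>" by (intro Ints_mult[OF _ D(2)] l) (use a(1) in simp)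
    qed
    finally show ?thesis .
  qed
  then show ?thesis using D(1) by blast
qed

lemma integral_pow_cycles:
  assumes "c \<in> real_cycles 1 X" "integral_chain c"
  shows "(real_chain_map 1 f ^^ i) c \<in> real_cycles 1 X" "integral_chain ((real_chain_map 1 f ^^ i) c)"
  using assms by (induction i) (auto intro: f_cycles integral_chain_chain_map)

text \<open>In this way all powers of \<open>fmat\<close> inherit one denominator: their entries are
  coordinates of integral cycles when the basis is integral.\<close>

lemma fmat_pow_entry:
  assumes "i < r" "j < r"
  shows "(fmat ^\<^sub>m k) $$ (i, j) = coords ((real_chain_map 1 f ^^ k) (bs ! j)) $ i"
proof -
  have "fmat ^\<^sub>m k \<in> carrier_mat r r" by simp
  from mat_mult_unit_vec_index[OF this assms] show ?thesis
    using coords_chain_map_pow[OF bs_in[OF assms(2)], of k] coords_bs[OF assms(2)] by simp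
qed

text \<open>A vector in the kernel comes from a cycle whose image under \<open>f\<close> bounds;
  applying the left inverse \<open>g\<close>, the cycle itself bounds.\<close>

lemma det_fmat_nonzero:
  assumes g: "continuous_map X X g" "\<And>x. x \<in> topspace X \<Longrightarrow> g (f x) = x"
  shows "det fmat \<noteq> 0"
proof
  assume "det fmat = 0"
  then obtain v where v: "v \<in> carrier_vec r" "v \<noteq> 0\<^sub>v r" "fmat *\<^sub>v v = 0\<^sub>v r"
    using det_0_iff_vec_prod_zero[OF fmat_carrier] by auto
  let ?c = "\<Sum>i<r. rc_scale (v $ i) (bs ! i)"
  have c: "?c \<in> real_cycles 1 X"
    by (intro rc_subspace_sum[OF rc_subspace_real_cycles] rc_subspaceD(3)[OF rc_subspace_real_cycles] bs_in) simp
  have "coords ?c = vec r (\<lambda>i. v $ i)"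
    by (rule coords_eqI[OF c]) (simp add: rc_subspaceD(1)[OF rc_subspace_real_boundaries])
  then have cv: "coords ?c = v" using v(1) by auto
  have z: "0 \<in> real_cycles 1 X" by (rule rc_subspaceD(1)[OF rc_subspace_real_cycles])
  have "coords (real_chain_map 1 f ?c) = coords 0"
    unfolding coords_chain_map[OF c] cv v(3) coords_0 ..
  then have "real_chain_map 1 f ?c \<in> real_boundaries 1 X"
    using coords_eq_iff[OF f_cycles[OF c] z] by simp
  then have "real_chain_map 1 g (real_chain_map 1 f ?c) \<in> real_boundaries 1 X"
    by (rule real_chain_map_boundaries[OF _ g(1)])
  moreover have "real_chain_map 1 g (real_chain_map 1 f ?c) = ?c"
    using c g(2) by (intro real_chain_map_compose_inverse[of _ _ X]) (auto simp: real_cycles_def)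
  ultimately have "coords ?c = coords 0" using coords_eq_iff[OF c z] by simp
  then show False using cv coords_0 v(2) by simp
qed

end

subsection \<open>Spanning numbers\<close>

lemma dyn_dist_le_iff: "dyn_dist d f n x y \<le> e \<longleftrightarrow> (\<forall>i\<le>n. d ((f ^^ i) x) ((f ^^ i) y) \<le> e)"
  unfolding dyn_dist_def by (subst Max_le_iff) auto

lemma dyn_cover_iff:
  "A \<subseteq> M \<Longrightarrow> M = (\<Union>x\<in>A. dyn_ball M d f x n e) \<longleftrightarrow> (\<forall>y\<in>M. \<exists>x\<in>A. \<forall>i\<le>n. d ((f ^^ i) x) ((f ^^ i) y) \<le> e)"
  unfolding dyn_ball_def dyn_dist_le_iff by blast

text \<open>Compactness provides some finite cover, without which the least cardinality would be
  unspecified.\<close>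

lemma (in lc_system) spanning_number_attained:
  assumes "e > 0"
  shows "\<exists>A. finite A \<and> A \<subseteq> M \<and> card A = spanning_number M d f e n \<and>
    (\<forall>y\<in>M. \<exists>x\<in>A. \<forall>i\<le>n. d ((f ^^ i) x) ((f ^^ i) y) \<le> e)"
proof -
  obtain F where F: "finite F" "F \<subseteq> M" "\<forall>y\<in>M. \<exists>x\<in>F. \<forall>i\<le>n. d ((f ^^ i) x) ((f ^^ i) y) \<le> e"
    using finite_net_exists[OF assms, of n] by blast
  have "\<exists>E. finite E \<and> E \<subseteq> M \<and> card E = spanning_number M d f e n \<and> M = (\<Union>x\<in>E. dyn_ball M d f x n e)"
    unfolding spanning_number_def
  proof (rule LeastI[of _ "card F"])
    have "M = (\<Union>x\<in>F. dyn_ball M d f x n e)" using dyn_cover_iff[OF F(2)] F(3) by blast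
    then show "\<exists>E. finite E \<and> E \<subseteq> M \<and> card E = card F \<and> M = (\<Union>x\<in>E. dyn_ball M d f x n e)"
      using F(1,2) by blast
  qed
  then obtain A where A: "finite A" "A \<subseteq> M" "card A = spanning_number M d f e n" "M = (\<Union>x\<in>A. dyn_ball M d f x n e)"
    by blast
  then show ?thesis using dyn_cover_iff[OF A(2), of d f n e] by (intro exI[of _ A] conjI) blast+
qed

lemma (in lc_system) growth_seq_spanning_number:
  assumes "e > 0"
  shows "growth_seq (\<lambda>n. real (spanning_number M d f e n))"
  unfolding growth_seq_def
proof (intro conjI allI impI)
  fix m n :: nat assume mn: "1 \<le> m \<and> m \<le> n"
  obtain A where A: "finite A" "A \<subseteq> M" "card A = spanning_number M d f e n"
    "\<forall>y\<in>M. \<exists>x\<in>A. \<forall>i\<le>n. d ((f ^^ i) x) ((f ^^ i) y) \<le> e"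
    using spanning_number_attained[OF assms, of n] by blast
  then have "\<forall>y\<in>M. \<exists>x\<in>A. \<forall>i\<le>m. d ((f ^^ i) x) ((f ^^ i) y) \<le> e"
    using mn by (meson le_trans)
  then have "M = (\<Union>x\<in>A. dyn_ball M d f x m e)" using dyn_cover_iff[OF A(2)] by blast
  then have "spanning_number M d f e m \<le> card A"
    unfolding spanning_number_def using A(1,2) by (intro Least_le) blast
  then show "real (spanning_number M d f e m) \<le> real (spanning_number M d f e n)" using A(3) by simp
qed simp

text \<open>The entropy is a supremum over scales, so a lower bound at one scale suffices. Both
  sequences must satisfy \<open>growth_seq\<close> for their classes to be comparable.\<close>

lemma growth_class_le_generalized_entropy:
  assumes "e > 0" "growth_seq a" "growth_seq (\<lambda>n. real (spanning_number M d f e n))"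
    and "growth_le a (\<lambda>n. real (spanning_number M d f e n))"
  shows "dm_embed (growth_class a) \<le> generalized_entropy M d f"
proof -
  have "dm_embed (growth_class a) \<le> dm_embed (growth_class (\<lambda>n. real (spanning_number M d f e n)))"
    using assms by (simp add: dm_embed_le_iff growth_class_le_iff)
  also have "\<dots> \<le> generalized_entropy M d f"
    unfolding generalized_entropy_def by (rule SUP_upper) (use assms(1) in simp)
  finally show ?thesis .
qed

section \<open>Polynomial lower bound for the entropy\<close>

lemma mult_mat_vec_index:
  assumes "A \<in> carrier_mat m n" "v \<in> carrier_vec n" "i < m"
  shows "(A *\<^sub>v v) $ i = (\<Sum>p\<in>{0..<n}. A $$ (i, p) * v $ p)"
  using assms by (auto simp: scalar_prod_def)

lemma char_matrix_pow_of_real: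
  assumes "M \<in> carrier_mat n n"
  shows "(char_matrix (map_mat complex_of_real M ^\<^sub>m q) 1) ^\<^sub>m j
    = map_mat complex_of_real ((char_matrix (M ^\<^sub>m q) 1) ^\<^sub>m j)"
proof -
  have Mq: "M ^\<^sub>m q \<in> carrier_mat n n" using assms by simp
  have "char_matrix (map_mat complex_of_real (M ^\<^sub>m q)) 1 = map_mat complex_of_real (char_matrix (M ^\<^sub>m q) 1)"
    using carrier_matD[OF Mq] by (intro eq_matI) (auto simp: char_matrix_def simp del: pow_mat_dim)
  then show ?thesis
    by (simp add: of_real_hom.mat_hom_pow[OF assms] of_real_hom.mat_hom_pow[OF char_matrix_closed[OF Mq]])
qed

lemma map_mat_of_real_eq_0_iff:
  assumes "A \<in> carrier_mat n n"
  shows "map_mat complex_of_real A = 0\<^sub>m n n \<longleftrightarrow> A = 0\<^sub>m n n"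
proof
  assume *: "map_mat complex_of_real A = 0\<^sub>m n n"
  have "complex_of_real (A $$ (i, j)) = 0" if "i < n" "j < n" for i j
    using arg_cong[OF *, of "\<lambda>B. B $$ (i, j)"] that assms by simp
  then show "A = 0\<^sub>m n n" using assms by (intro eq_matI) auto
qed (auto intro!: eq_matI)

theorem theorem6:
  fixes X :: "'a topology" and d :: "'a \<Rightarrow> 'a \<Rightarrow> real" and f :: "'a \<Rightarrow> 'a" and m :: nat
  assumes manifold: "compact_manifold m X"
    and metric: "Metric_space (topspace X) d" "Metric_space.mtopology (topspace X) d = X"
    and homeo: "homeomorphic_map X X f"
    and sp: "endo_spectral_radius (real_homology 1 X) (real_hom_induced 1 X f) = 1"
  shows "\<exists>k::nat.
    (\<exists>A J. represents_endo A (real_homology 1 X) (real_hom_induced 1 X f) \<and> real_jordan_nf A J) \<and>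
    (\<forall>A J. represents_endo A (real_homology 1 X) (real_hom_induced 1 X f) \<and> real_jordan_nf A J \<longrightarrow>
       real k = max (real (k_real J)) (real (k_complex J) / 2) - 1) \<and>
    dm_embed (growth_class (\<lambda>n. real n ^ k)) \<le> generalized_entropy (topspace X) d f"
proof -
  let ?M = "topspace X"
  have cont: "continuous_map X X f" by (rule homeomorphic_imp_continuous_map[OF homeo])
  have "lc_system_axioms ?M d f"
    unfolding lc_system_axioms_def metric(2)
    using cont compact_manifold_locally_contractible[OF manifold] manifold by (simp add: compact_manifold_def)
  then interpret lc: lc_system ?M d f
    using metric(1) by (simp add: lc_system_def)
  note bound = lc.spanning_set_homology_bound[unfolded metric(2)]
  obtain S \<epsilon> where \<epsilon>: "\<epsilon> > 0" and finS: "finite S" and S: "\<forall>s\<in>S. s \<in> real_cycles 1 X \<and> integral_chain s"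
    and S_span: "\<forall>c\<in>real_cycles 1 X. combination X S UNIV \<infinity> c"
    and S_int: "\<forall>c\<in>real_cycles 1 X. integral_chain c \<longrightarrow> combination X S \<int> \<infinity> c"
    and S_bound: "\<forall>n A. finite A \<and> A \<subseteq> ?M \<and> (\<forall>y\<in>?M. \<exists>x\<in>A. \<forall>i\<le>n. d ((f ^^ i) x) ((f ^^ i) y) \<le> \<epsilon>) \<longrightarrow>
      (\<exists>Z. finite Z \<and> (\<forall>z\<in>Z. z \<in> real_cycles 1 X \<and> integral_chain z) \<and>
        (\<forall>c\<in>real_cycles 1 X. combination X Z UNIV \<infinity> c) \<and>
        (\<forall>z\<in>Z. \<forall>i\<le>n. combination X S UNIV (ereal (2 * real (card A))) ((real_chain_map 1 f ^^ i) z)))"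
    using bound by (elim exE conjE) (rule that)
  have "\<exists>bs. set bs \<subseteq> S \<and> homology_basis X f bs"
    by (rule homology_basis_exists[OF finS _ _ cont]) (use S S_span in auto)
  then obtain bs where bsS: "set bs \<subseteq> S" and "homology_basis X f bs" by blast
  then interpret hb: homology_basis X f bs by simp
  let ?r = "length bs" and ?M1 = "hb.fmat"
  let ?MC = "map_mat complex_of_real ?M1"
  have MC: "?MC \<in> carrier_mat ?r ?r" by simp
  have rad: "real_spectral_radius ?M1 = 1" using sp hb.endo_spectral_radius_fmat by simp
  \<comment> \<open>In dimension 0 \<open>real_spectral_radius\<close> is 0, so radius 1 excludes
    trivial homology; this guarantees that a largest Jordan block exists.\<close>
  then have r0: "?r > 0" and radC: "spectral_radius ?MC = 1"
    using carrier_matD[OF hb.fmat_carrier] by (auto simp: real_spectral_radius_def split: if_splits)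
  have le1: "norm a \<le> 1" if "eigenvalue ?MC a" for a
    using spectral_radius_mem_max(2)[OF MC r0, of "norm a"] that radC by (auto simp: spectrum_def)
  obtain D :: int where D: "D > 0"
    and D_int: "\<And>c l. c \<in> real_cycles 1 X \<Longrightarrow> integral_chain c \<Longrightarrow> l < ?r \<Longrightarrow> of_int D * hb.coords c $ l \<in> \<int>"
    using hb.integral_coords_denominator[OF finS _ bsS] S S_int by blast
  have bs_int: "bs ! i \<in> real_cycles 1 X" "integral_chain (bs ! i)" if "i < ?r" for i
    using that bsS S nth_mem by blast+
  have M_int: "of_int D * (?M1 ^\<^sub>m k) $$ (i, j) \<in> \<int>" if "i < ?r" "j < ?r" for k i j
    unfolding hb.fmat_pow_entry[OF that]
    by (rule D_int[OF hb.integral_pow_cycles[OF bs_int[OF that(2)]] that(1)])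
  obtain g where g: "homeomorphic_maps X X f g"
    using homeo by (auto simp: homeomorphic_map_maps)
  have det: "det ?M1 \<noteq> 0"
    using g by (intro hb.det_fmat_nonzero[of g]) (auto simp: homeomorphic_maps_def)
  obtain as where "char_poly ?MC = (\<Prod>a\<leftarrow>as. [:- a, 1:])"
    using char_poly_factorized[OF MC] by auto
  from jordan_nf_exists[OF MC this] obtain xs where xs: "jordan_nf ?MC xs" ..
  obtain q where q: "q > 0" and roots: "\<And>m a. (m, a) \<in> set xs \<Longrightarrow> a ^ q = 1"
    using eigenvalues_roots_of_unity[OF hb.fmat_carrier D M_int le1 det xs] by blast
  define K where "K = Max (fst ` set xs)"
  have "xs \<noteq> []"
  proof
    assume "xs = []"
    then have "similar_mat ?MC (0\<^sub>m 0 0)" using xs by (simp add: jordan_nf_def jordan_matrix_def)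
    then obtain n where n: "?MC \<in> carrier_mat n n" "(0\<^sub>m 0 0 :: complex mat) \<in> carrier_mat n n"
      using similar_matD unfolding insert_subset by metis
    then have "n = 0" using carrier_matD(1)[OF n(2)] by simp
    then show False using carrier_matD(1)[OF n(1)] carrier_matD(1)[OF MC] r0 by simp
  qed
  then have "K \<in> fst ` set xs" unfolding K_def by (intro Max_in) auto
  then obtain a where Ka: "(K, a) \<in> set xs" by auto
  have K_max: "l \<le> K" if "(l, b) \<in> set xs" for l b
    unfolding K_def using imageI[OF that, of fst] by (intro Max_ge) auto
  have "K \<noteq> 0" using xs Ka by (force simp: jordan_nf_def)
  \<comment> \<open>The powers of a unipotent matrix of index \<open>K\<close> grow with degree
    \<open>K - 1\<close>.\<close>
  then obtain k where k: "K = Suc k" by (cases K) auto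
  let ?N = "char_matrix (?M1 ^\<^sub>m q) 1"
  have N: "?N ^\<^sub>m j \<in> carrier_mat ?r ?r" for j by simp
  have N_iff: "?N ^\<^sub>m j = 0\<^sub>m ?r ?r \<longleftrightarrow> (\<forall>(l, b)\<in>set xs. l \<le> j)" for j
    using jordan_nf_unipotent_index[OF MC xs q roots, where j = j]
    unfolding char_matrix_pow_of_real[OF hb.fmat_carrier] map_mat_of_real_eq_0_iff[OF N] .
  have nil: "?N ^\<^sub>m Suc k = 0\<^sub>m ?r ?r" unfolding N_iff using K_max k by auto
  have ne: "?N ^\<^sub>m k \<noteq> 0\<^sub>m ?r ?r" unfolding N_iff using Ka k by force

  have "\<exists>A J. represents_endo A (real_homology 1 X) (real_hom_induced 1 X f) \<and> real_jordan_nf A J"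
    using hb.represents_endo_fmat real_jordan_nf_exists[OF hb.fmat_carrier] by blast
  moreover have "real k = max (real (k_real J)) (real (k_complex J) / 2) - 1"
    if "represents_endo A (real_homology 1 X) (real_hom_induced 1 X f)" "real_jordan_nf A J" for A J
  proof -
    have "similar_mat ?M1 A" by (rule similar_mat_sym[OF hb.represents_endo_similar[OF that(1)]])
    then have "real_jordan_nf ?M1 J"
      using that(2) similar_mat_trans unfolding real_jordan_nf_def by blast
    then have "jordan_nf ?MC (concat (map complex_blocks J))" by (rule real_jordan_nf_imp_jordan_nf)
    \<comment> \<open>\<open>J\<close> may be any real form of any representing matrix; only its set
      of complex blocks matters, and uniqueness identifies it with that of
      \<open>xs\<close>.\<close>
    then have eq: "set (concat (map complex_blocks J)) = set xs"
      using mset_jordan_nf_unique[OF _ xs] mset_eq_setD by blast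
    have "max (real (k_real J)) (real (k_complex J) / 2) = real K"
    proof (rule max_k_real_k_complex[OF _ q])
      show "\<forall>B\<in>set J. valid_jblock B" using that(2) by (simp add: real_jordan_nf_def)
      show "b ^ q = 1" if "(l, b) \<in> set (concat (map complex_blocks J))" for l b
        using that roots unfolding eq by blast
      show "l \<le> K" if "(l, b) \<in> set (concat (map complex_blocks J))" for l b
        using that K_max unfolding eq by blast
      show "(K, a) \<in> set (concat (map complex_blocks J))" unfolding eq by (rule Ka)
    qed
    then show ?thesis using k by simp
  qed
  moreover have "dm_embed (growth_class (\<lambda>n. real n ^ k)) \<le> generalized_entropy ?M d f"
  proof (rule growth_class_le_generalized_entropy[OF \<epsilon>])
    show "growth_seq (\<lambda>n. real n ^ k)" by (auto simp: growth_seq_def intro: power_mono)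
    show "growth_seq (\<lambda>n. real (spanning_number ?M d f \<epsilon> n))" by (rule lc.growth_seq_spanning_number[OF \<epsilon>])
    \<comment> \<open>Coordinates of the fixed loops are bounded by \<open>C\<close>, so a
      combination of norm at most \<open>L\<close> has coordinates at most \<open>C * L\<close>,
      uniformly in \<open>n\<close>. The summand 1 ensures \<open>C \<ge> 1\<close>.\<close>
    define C where "C = 1 + (\<Sum>s\<in>S. \<Sum>l<?r. \<bar>hb.coords s $ l\<bar>)"
    have C1: "C \<ge> 1" unfolding C_def by (simp add: sum_nonneg)
    have C: "\<bar>hb.coords s $ l\<bar> \<le> C" if "s \<in> S" "l < ?r" for s l
    proof -
      have "\<bar>hb.coords s $ l\<bar> \<le> (\<Sum>l<?r. \<bar>hb.coords s $ l\<bar>)"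
        by (rule member_le_sum) (use that in auto)
      also have "\<dots> \<le> (\<Sum>s\<in>S. \<Sum>l<?r. \<bar>hb.coords s $ l\<bar>)"
        by (rule member_le_sum) (use that finS in \<open>auto intro: sum_nonneg\<close>)
      finally show ?thesis by (simp add: C_def)
    qed
    \<comment> \<open>The constant of \<open>unipotent_growth\<close> for
      \<open>W = C * (2 * card A)\<close>, with \<open>card A\<close> split off.\<close>
    define C' where "C' = real (2 * q * k) ^ k * 2 ^ k * of_int D * C * 2"
    have main: "real n ^ k \<le> C' * real (spanning_number ?M d f \<epsilon> n)" for n
    proof -
      obtain A where A: "finite A" "A \<subseteq> ?M" "card A = spanning_number ?M d f \<epsilon> n"
        "\<forall>y\<in>?M. \<exists>x\<in>A. \<forall>i\<le>n. d ((f ^^ i) x) ((f ^^ i) y) \<le> \<epsilon>"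
        using lc.spanning_number_attained[OF \<epsilon>, of n] by blast
      have "finite A \<and> A \<subseteq> ?M \<and> (\<forall>y\<in>?M. \<exists>x\<in>A. \<forall>i\<le>n. d ((f ^^ i) x) ((f ^^ i) y) \<le> \<epsilon>)"
        using A by (intro conjI)
      from S_bound[THEN spec, THEN spec, THEN mp, OF this]
      obtain Z where Z: "\<forall>z\<in>Z. z \<in> real_cycles 1 X \<and> integral_chain z"
        "\<forall>c\<in>real_cycles 1 X. combination X Z UNIV \<infinity> c"
        "\<forall>z\<in>Z. \<forall>i\<le>n. combination X S UNIV (ereal (2 * real (card A))) ((real_chain_map 1 f ^^ i) z)"
        by (elim exE conjE) (rule that)
      have coords_comb: "\<exists>b. ereal (\<Sum>s\<in>T. \<bar>b s\<bar>) \<le> L \<and> (\<forall>l<?r. hb.coords c $ l = (\<Sum>s\<in>T. b s * hb.coords s $ l))"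
        if "combination X T UNIV L c" "c \<in> real_cycles 1 X" "T \<subseteq> real_cycles 1 X" for T L c
      proof -
        obtain b where b: "ereal (\<Sum>s\<in>T. \<bar>b s\<bar>) \<le> L" "homologous X c (\<Sum>s\<in>T. rc_scale (b s) s)"
          using \<open>combination X T UNIV L c\<close> unfolding combination_def by blast
        have "(\<Sum>s\<in>T. rc_scale (b s) s) \<in> real_cycles 1 X"
          using that(3) by (intro rc_subspace_sum[OF rc_subspace_real_cycles] rc_subspaceD(3)[OF rc_subspace_real_cycles]) auto
        then have "hb.coords c = hb.coords (\<Sum>s\<in>T. rc_scale (b s) s)"
          using b(2) hb.coords_eq_iff that(2) by (simp add: homologous_def)
        then show ?thesis using b(1) hb.coords_sum[of T "\<lambda>s. s" _ b] that(3) by (intro exI[of _ b]) auto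
      qed
      \<comment> \<open>\<open>Z\<close> spans the homology, so the nonzero \<open>k\<close>-th
        power of \<open>?N\<close> cannot vanish on all of its elements.\<close>
      have "\<exists>z\<in>Z. ?N ^\<^sub>m k *\<^sub>v hb.coords z \<noteq> 0\<^sub>v ?r"
      proof (rule ccontr)
        assume "\<not> ?thesis"
        then have z0: "?N ^\<^sub>m k *\<^sub>v hb.coords z = 0\<^sub>v ?r" if "z \<in> Z" for z using that by blast
        have "(?N ^\<^sub>m k) $$ (l, j) = 0" if lj: "l < ?r" "j < ?r" for l j
        proof -
          obtain b where b: "\<forall>l<?r. hb.coords (bs ! j) $ l = (\<Sum>z\<in>Z. b z * hb.coords z $ l)"
            using coords_comb[OF Z(2)[rule_format, OF bs_int(1)[OF lj(2)]] bs_int(1)[OF lj(2)]] Z(1) by blast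
          have "(?N ^\<^sub>m k) $$ (l, j) = (?N ^\<^sub>m k *\<^sub>v hb.coords (bs ! j)) $ l"
            unfolding hb.coords_bs[OF lj(2)] by (rule mat_mult_unit_vec_index[OF N lj, symmetric])
          also have "\<dots> = (\<Sum>p\<in>{0..<?r}. (?N ^\<^sub>m k) $$ (l, p) * (\<Sum>z\<in>Z. b z * hb.coords z $ p))"
            unfolding mult_mat_vec_index[OF N hb.coords_carrier(1) lj(1)] using b by simp
          also have "\<dots> = (\<Sum>p\<in>{0..<?r}. \<Sum>z\<in>Z. b z * ((?N ^\<^sub>m k) $$ (l, p) * hb.coords z $ p))"
            unfolding sum_distrib_left by (intro sum.cong refl) (simp only: mult_ac)
          also have "\<dots> = (\<Sum>z\<in>Z. b z * (\<Sum>p\<in>{0..<?r}. (?N ^\<^sub>m k) $$ (l, p) * hb.coords z $ p))"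
            by (subst sum.swap) (simp add: sum_distrib_left)
          also have "\<dots> = (\<Sum>z\<in>Z. b z * (?N ^\<^sub>m k *\<^sub>v hb.coords z) $ l)"
            unfolding mult_mat_vec_index[OF N hb.coords_carrier(1) lj(1)] ..
          also have "\<dots> = 0" using z0 lj by (intro sum.neutral) simp
          finally show ?thesis .
        qed
        then have "?N ^\<^sub>m k = 0\<^sub>m ?r ?r" using carrier_matD[OF N[of k]] by (intro eq_matI) (auto simp del: pow_mat_dim)
        with ne show False ..
      qed
      then obtain z where z: "z \<in> Z" "?N ^\<^sub>m k *\<^sub>v hb.coords z \<noteq> 0\<^sub>v ?r" by blast
      note zc = bspec[OF Z(1) z(1), THEN conjunct1] and zi = bspec[OF Z(1) z(1), THEN conjunct2]
      have pow: "?M1 ^\<^sub>m i *\<^sub>v hb.coords z = hb.coords ((real_chain_map 1 f ^^ i) z)" for i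
        using hb.coords_chain_map_pow[OF zc] by simp
      have bd: "\<bar>(?M1 ^\<^sub>m i *\<^sub>v hb.coords z) $ l\<bar> \<le> C * (2 * real (card A))" if i: "i \<le> n" and l: "l < ?r" for i l
      proof -
        obtain b where b: "ereal (\<Sum>s\<in>S. \<bar>b s\<bar>) \<le> ereal (2 * real (card A))"
          "\<forall>l<?r. hb.coords ((real_chain_map 1 f ^^ i) z) $ l = (\<Sum>s\<in>S. b s * hb.coords s $ l)"
          using coords_comb[OF Z(3)[rule_format, OF z(1) i] hb.integral_pow_cycles(1)[OF zc zi]] S by blast
        have "\<bar>(?M1 ^\<^sub>m i *\<^sub>v hb.coords z) $ l\<bar> \<le> (\<Sum>s\<in>S. \<bar>b s * hb.coords s $ l\<bar>)"
          unfolding pow using b(2) l by (simp add: sum_abs)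
        also have "\<dots> \<le> (\<Sum>s\<in>S. \<bar>b s\<bar> * C)"
          using C l by (intro sum_mono) (simp add: abs_mult mult_left_mono)
        also have "\<dots> = C * (\<Sum>s\<in>S. \<bar>b s\<bar>)" by (simp add: sum_distrib_left mult.commute)
        also have "\<dots> \<le> C * (2 * real (card A))" using b(1) C1 by (intro mult_left_mono) auto
        finally show ?thesis .
      qed
      \<comment> \<open>This gives \<open>W \<ge> 1\<close>. An empty \<open>A\<close> would force
        the coordinates of \<open>z\<close> to vanish by \<open>bd\<close>, contrary to the choice
        of \<open>z\<close>.\<close>
      have "card A \<noteq> 0"
      proof
        assume "card A = 0"
        have "hb.coords z = 0\<^sub>v ?r"
        proof (rule eq_vecI)
          fix l assume "l < dim_vec (0\<^sub>v ?r :: real vec)"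
          then show "hb.coords z $ l = 0\<^sub>v ?r $ l"
            using bd[of 0 l] pow[of 0] \<open>card A = 0\<close> by simp
        qed simp
        moreover have "?N ^\<^sub>m k *\<^sub>v 0\<^sub>v ?r = 0\<^sub>v ?r"
        proof (rule eq_vecI)
          fix l assume "l < dim_vec (0\<^sub>v ?r :: real vec)"
          then have l: "l < ?r" by simp
          show "(?N ^\<^sub>m k *\<^sub>v 0\<^sub>v ?r) $ l = 0\<^sub>v ?r $ l"
            unfolding mult_mat_vec_index[OF N zero_carrier_vec l] using l by simp
        qed (simp only: dim_mult_mat_vec carrier_matD(1)[OF N] index_zero_vec)
        ultimately show False using z(2) by simp
      qed
      then have "1 \<le> real (card A)" by simp
      then have "1 * 1 \<le> C * (2 * real (card A))" using C1 by (intro mult_mono) auto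
      then have W: "1 \<le> C * (2 * real (card A))" by simp
      have "real n ^ k \<le> real (2 * q * k) ^ k * 2 ^ k * of_int D * (C * (2 * real (card A)))"
      proof (rule unipotent_growth[OF hb.fmat_carrier _ D q W nil z(2) _ bd])
        show "of_int D * (?M1 ^\<^sub>m i *\<^sub>v hb.coords z) $ l \<in> \<int>" if "l < ?r" for i l
          unfolding pow by (rule D_int[OF hb.integral_pow_cycles[OF zc zi] that])
      qed auto
      then show ?thesis using A(3) by (simp add: C'_def mult_ac)
    qed
    have "C' \<ge> 0" using C1 D by (simp add: C'_def)
    have "real n ^ k \<le> (C' + 1) * real (spanning_number ?M d f \<epsilon> n)" for n
      using main[of n] by (simp add: algebra_simps)
    then show "growth_le (\<lambda>n. real n ^ k) (\<lambda>n. real (spanning_number ?M d f \<epsilon> n))"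
      unfolding growth_le_def using \<open>C' \<ge> 0\<close> by (intro exI[of _ "C' + 1"]) auto
  qed
  ultimately show ?thesis by blast
qed

end
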